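(* Let $d\ge 2$, let $n_1,\dots,n_d$ be positive integers, let $r_1,\dots,r_{d-1}\ge 0$ be integers, and let $\mathcal{M}=\mathcal{M}_{\leq(r_{1},\dots,r_{d-1})}^{n_{1}\times\dots\times n_{d}}$. For $A\in\mathcal{M}$ and $\mathcal{X}\in T_A\mathcal{M}$, let $k_i$ be the rank of $A^{(n_1\dots n_i)\times(n_{i+1}\dots n_d)}$, let $s_i=r_i-k_i$, let $A=A_1\cdots A_d$ be a left-orthogonal TT factorization of $A$, and write $\mathcal{X}$ in an admissible parametrization $$\mathcal{X}=\begin{pmatrix} A_{1} & U_{1} & X_{1} \end{pmatrix}\begin{pmatrix} A_{2} & U_{2} & X_{2} \\ 0 & Z_{2} & V_{2} \\ 0 & 0 & A_{2} \end{pmatrix}\cdots\begin{pmatrix} A_{d-1} & U_{d-1} & X_{d-1} \\ 0 & Z_{d-1} & V_{d-1} \\ 0 & 0 & A_{d-1} \end{pmatrix}\begin{pmatrix} X_{d} \\ V_{d} \\ A_{d} \end{pmatrix}$$ (both notions as defined in the context). Then the function $$R:(A,\mathcal{X})\mapsto\begin{pmatrix} A_{1}+X_{1} & U_{1} \end{pmatrix}\begin{pmatrix} A_{2}+X_{2} & U_{2} \\ V_{2} & Z_{2} \end{pmatrix}\cdots\begin{pmatrix} A_{d-1}+X_{d-1} & U_{d-1} \\ V_{d-1} & Z_{d-1} \end{pmatrix}\begin{pmatrix} A_{d}+X_{d} \\ V_{d} \end{pmatrix}$$ defines a retraction from the tangent bundle of $\mathcal{M}$ to $\mathcal{M}$.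
   Context: Tensors are elements of $\mathbb{R}^{m_1\times\dots\times m_r}$. $A^{(n_1\dots n_i)\times(n_{i+1}\dots n_d)}$ denotes the matricization of $A\in\mathbb{R}^{n_1\times\dots\times n_d}$ grouping the first $i$ indices as row index and the remaining ones as column index. $B^L$ is the matricization of $B$ with the first index as row index and all others as column index; $B^R$ is the matricization with the last index as column index and all others as row index (for a matrix, $B^L=B^R=B$). TT product: for $A\in\mathbb{R}^{n_1\times\dots\times n_i\times k}$ and $B\in\mathbb{R}^{k\times n_{i+1}\times\dots\times n_d}$, $AB\in\mathbb{R}^{n_1\times\dots\times n_d}$ has entries $(AB)(j_1,\dots,j_d)=\sum_{m=1}^kA(j_1,\dots,j_i,m)B(m,j_{i+1},\dots,j_d)$; it is associative. A block matrix whose blocks are order 3 tensors denotes the order 3 tensor obtained by placing the blocks along the first index (block rows) and last index (block columns), the middle index being shared. TT variety: $\mathcal{M}_{\leq(r_{1},\dots,r_{d-1})}^{n_{1}\times\dots\times n_{d}}=\{A\in\mathbb{R}^{n_{1}\times\dots\times n_{d}}:\forall i:\operatorname{rank}(A^{(n_{1}\dots n_{i})\times(n_{i+1}\dots n_{d})})\leq r_{i}\}$. Tangent cone of $\mathcal{M}\subset\mathbb{R}^N$ at $A\in\mathcal{M}$: $T_{A}\mathcal{M}=\{\xi\in\mathbb{R}^{N}:\exists(x_{n})\subset\mathcal{M},(a_{n})\subset\mathbb{R}^{+}\text{ s.t. }x_{n}\rightarrow A,\ a_{n}(x_{n}-A)\rightarrow\xi\}$. Left-orthogonal TT factorization of $A$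 with ranks $(k_1,\dots,k_{d-1})$: $A=A_1\cdots A_d$ with $A_1\in\mathbb{R}^{n_1\times k_1}$, $A_i\in\mathbb{R}^{k_{i-1}\times n_i\times k_i}$ ($2\le i\le d-1$), $A_d\in\mathbb{R}^{k_{d-1}\times n_d}$, $A_1^TA_1=I$ and $(A_i^R)^TA_i^R=I$ for $2\le i\le d-1$. Admissible parametrization of $\mathcal{X}\in T_A\mathcal{M}$: the displayed block factorization in the claim, with $U_1\in\mathbb{R}^{n_1\times s_1}$, $X_1\in\mathbb{R}^{n_1\times k_1}$; $U_i\in\mathbb{R}^{k_{i-1}\times n_i\times s_i}$, $X_i\in\mathbb{R}^{k_{i-1}\times n_i\times k_i}$, $Z_i\in\mathbb{R}^{s_{i-1}\times n_i\times s_i}$, $V_i\in\mathbb{R}^{s_{i-1}\times n_i\times k_i}$ ($2\le i\le d-1$); $X_d\in\mathbb{R}^{k_{d-1}\times n_d}$, $V_d\in\mathbb{R}^{s_{d-1}\times n_d}$, such that $(A_{i}^{R})^{T}U_{i}^{R}=0$ and $(A_{i}^{R})^{T}X_{i}^{R}=0$ for $1\le i\le d-1$, and $(V_{i}A_{i+1}\cdots A_{d})^{L}((A_{i}\cdots A_{d})^{L})^{T}=0$ for $2\le i\le d$. (Every $\mathcal{X}\in T_A\mathcal{M}$ has such a parametrization.) Tangent bundle of $\mathcal{M}$: $\bigcup_{x\in\mathcal{M}}(\{x\}\times T_x\mathcal{M})$. A retraction is a function $R$ from the tangent bundle to $\mathcal{M}$ such that for any fixed $x\in\mathcal{M}$ and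 $v\in T_x\mathcal{M}$ the function $t\mapsto R(x,tv)$ is continuous on $[0,\infty)$ and $\lim_{t\searrow0}\frac{R(x,tv)-x-tv}{t}=0$. *)

theory Defs
  imports "HOL-Analysis.Function_Topology" "Jordan_Normal_Form.DL_Rank"
begin

section \<open>Tensors\<close>

text \<open>
  A tensor of size \<open>m\<^sub>1 \<times> \<dots> \<times> m\<^sub>r\<close> is a real function on multi-indices
  \<open>[j\<^sub>1, \<dots>, j\<^sub>r]\<close>, counted from 0, that vanishes unless \<open>j\<^sub>1 < m\<^sub>1, \<dots>, j\<^sub>r < m\<^sub>r\<close>.
  Equality of functions is thus equality of tensors, and the topology of pointwise
  convergence on the function type induces the usual topology on
  \<open>\<real>\<close>-valued tensors of a fixed size, since only finitely many entries are free.
\<close>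

type_synonym tensor = "nat list \<Rightarrow> real"

definition tensors :: "nat list \<Rightarrow> tensor set" where
  "tensors ms = {A. \<forall>j. A j \<noteq> 0 \<longrightarrow> list_all2 (<) j ms}"

definition multi_indices :: "nat list \<Rightarrow> nat list list" where
  "multi_indices ms = product_lists (map (\<lambda>m. [0..<m]) ms)"

text \<open>Rows and columns are enumerated lexicographically. With \<open>ps = [m]\<close> this is the
  unfolding \<open>A\<^sup>L\<close>, with \<open>qs = [m]\<close> it is \<open>A\<^sup>R\<close>.\<close>

definition matricize :: "nat list \<Rightarrow> nat list \<Rightarrow> tensor \<Rightarrow> real mat" where
  "matricize ps qs A =
     mat (length (multi_indices ps)) (length (multi_indices qs))
       (\<lambda>(a, b). A (multi_indices ps ! a @ multi_indices qs ! b))"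

text \<open>The product contracting the last index of \<open>A\<close>, which has \<open>p\<close> indices before it,
  with the first index of \<open>B\<close>; both range over \<open>{..<k}\<close>.\<close>

definition tt_prod :: "nat \<Rightarrow> nat \<Rightarrow> tensor \<Rightarrow> tensor \<Rightarrow> tensor" where
  "tt_prod p k A B = (\<lambda>j. \<Sum>m<k. A (take p j @ [m]) * B (m # drop p j))"

text \<open>Block tensors: \<open>hcat k A B\<close> is \<open>(A B)\<close>, joined along the last index, and \<open>vcat k A B\<close>
  puts \<open>A\<close> above \<open>B\<close>, joined along the first index; \<open>k\<close> is the size of \<open>A\<close> in that index.\<close>

definition hcat :: "nat \<Rightarrow> tensor \<Rightarrow> tensor \<Rightarrow> tensor" where
  "hcat k A B = (\<lambda>j. if j = [] then 0
     else if last j < k then A j else B (butlast j @ [last j - k]))"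

definition vcat :: "nat \<Rightarrow> tensor \<Rightarrow> tensor \<Rightarrow> tensor" where
  "vcat k A B = (\<lambda>j. case j of [] \<Rightarrow> 0
     | a # js \<Rightarrow> if a < k then A j else B ((a - k) # js))"


section \<open>Tensor train factorizations and the TT variety\<close>

text \<open>Everything below is indexed as on paper: sizes \<open>n i\<close> and cores \<open>C i\<close> for \<open>i \<in> {1..d}\<close>,
  ranks for \<open>i \<in> {1..d-1}\<close>. Values outside these ranges are never used.\<close>

definition sizes :: "(nat \<Rightarrow> nat) \<Rightarrow> nat \<Rightarrow> nat \<Rightarrow> nat list" where
  "sizes n i j = map n [i..<Suc j]"

definition tt_rank :: "nat \<Rightarrow> (nat \<Rightarrow> nat) \<Rightarrow> tensor \<Rightarrow> nat \<Rightarrow> nat" where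
  "tt_rank d n A i =
     vec_space.rank (length (multi_indices (sizes n 1 i)))
       (matricize (sizes n 1 i) (sizes n (Suc i) d) A)"

definition tt_variety :: "nat \<Rightarrow> (nat \<Rightarrow> nat) \<Rightarrow> (nat \<Rightarrow> nat) \<Rightarrow> tensor set" where
  "tt_variety d n r = {A \<in> tensors (sizes n 1 d). \<forall>i\<in>{1..d-1}. tt_rank d n A i \<le> r i}"

text \<open>The product \<open>C\<^sub>i C\<^sub>i\<^sub>+\<^sub>1 \<cdots> C\<^sub>d\<close> with inner sizes \<open>k\<close>. The first core of a train is a
  matrix, with a single index before the contracted one; later cores have two.\<close>

definition tt_prods :: "nat \<Rightarrow> (nat \<Rightarrow> nat) \<Rightarrow> (nat \<Rightarrow> tensor) \<Rightarrow> nat \<Rightarrow> tensor" where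
  "tt_prods d k C i =
     foldr (\<lambda>m B. tt_prod (if m = 1 then 1 else 2) (k m) (C m) B) [i..<d] (C d)"

text \<open>The sizes of core \<open>i\<close> in all but its last index, given the inner sizes \<open>k\<close> on its left.\<close>

definition front :: "(nat \<Rightarrow> nat) \<Rightarrow> (nat \<Rightarrow> nat) \<Rightarrow> nat \<Rightarrow> nat list" where
  "front n k i = (if i = 1 then [n 1] else [k (i - 1), n i])"

definition left_orthogonal_tt ::
  "nat \<Rightarrow> (nat \<Rightarrow> nat) \<Rightarrow> (nat \<Rightarrow> nat) \<Rightarrow> tensor \<Rightarrow> (nat \<Rightarrow> tensor) \<Rightarrow> bool" where
  "left_orthogonal_tt d n k A C \<longleftrightarrow>
     (\<forall>i\<in>{1..d-1}. C i \<in> tensors (front n k i @ [k i])) \<and>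
     C d \<in> tensors [k (d - 1), n d] \<and>
     A = tt_prods d k C 1 \<and>
     (\<forall>i\<in>{1..d-1}.
        transpose_mat (matricize (front n k i) [k i] (C i)) * matricize (front n k i) [k i] (C i)
          = 1\<^sub>m (k i))"


section \<open>Tangent cones and retractions\<close>

definition tangent_cone :: "nat list \<Rightarrow> tensor set \<Rightarrow> tensor \<Rightarrow> tensor set" where
  "tangent_cone ms M A = {\<xi> \<in> tensors ms.
     \<exists>(x :: nat \<Rightarrow> tensor) (a :: nat \<Rightarrow> real).
       (\<forall>m. x m \<in> M) \<and> (\<forall>m. a m > 0) \<and> x \<longlonglongrightarrow> A \<and>
       (\<lambda>m j. a m * (x m j - A j)) \<longlonglongrightarrow> \<xi>}"

definition tangent_bundle :: "nat list \<Rightarrow> tensor set \<Rightarrow> (tensor \<times> tensor) set" where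
  "tangent_bundle ms M = (SIGMA x:M. tangent_cone ms M x)"

definition is_retraction :: "nat list \<Rightarrow> tensor set \<Rightarrow> (tensor \<times> tensor \<Rightarrow> tensor) \<Rightarrow> bool" where
  "is_retraction ms M R \<longleftrightarrow>
     (\<forall>p\<in>tangent_bundle ms M. R p \<in> M) \<and>
     (\<forall>x\<in>M. \<forall>v\<in>tangent_cone ms M x.
        continuous_on {0..} (\<lambda>t::real. R (x, \<lambda>j. t * v j)) \<and>
        ((\<lambda>t::real. \<lambda>j. (R (x, \<lambda>j. t * v j) j - x j - t * v j) / t) \<longlongrightarrow> (\<lambda>_. 0)) (at_right 0))"


section \<open>The parametrization of the tangent cone\<close>

definition tangent_core ::
  "nat \<Rightarrow> (nat \<Rightarrow> nat) \<Rightarrow> (nat \<Rightarrow> nat) \<Rightarrow> (nat \<Rightarrow> tensor) \<Rightarrow>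
   (nat \<Rightarrow> tensor) \<Rightarrow> (nat \<Rightarrow> tensor) \<Rightarrow> (nat \<Rightarrow> tensor) \<Rightarrow> (nat \<Rightarrow> tensor) \<Rightarrow> nat \<Rightarrow> tensor" where
  "tangent_core d k s C U X Z V i =
    (if i = 1 then hcat (k i) (C i) (hcat (s i) (U i) (X i))
     else if i = d then vcat (k (i-1)) (X i) (vcat (s (i-1)) (V i) (C i))
     else vcat (k (i-1)) (hcat (k i) (C i) (hcat (s i) (U i) (X i)))
         (vcat (s (i-1)) (hcat (k i) (\<lambda>_. 0) (hcat (s i) (Z i) (V i)))
                         (hcat (k i) (\<lambda>_. 0) (hcat (s i) (\<lambda>_. 0) (C i)))))"

text \<open>In the last condition, \<open>tt_prods d k (C(i := V i)) i\<close> is \<open>V\<^sub>i C\<^sub>i\<^sub>+\<^sub>1 \<cdots> C\<^sub>d\<close>.\<close>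

definition admissible ::
  "nat \<Rightarrow> (nat \<Rightarrow> nat) \<Rightarrow> (nat \<Rightarrow> nat) \<Rightarrow> (nat \<Rightarrow> nat) \<Rightarrow> (nat \<Rightarrow> tensor) \<Rightarrow> tensor \<Rightarrow>
   (nat \<Rightarrow> tensor) \<Rightarrow> (nat \<Rightarrow> tensor) \<Rightarrow> (nat \<Rightarrow> tensor) \<Rightarrow> (nat \<Rightarrow> tensor) \<Rightarrow> bool" where
  "admissible d n k s C \<X> U X Z V \<longleftrightarrow>
     (\<forall>i\<in>{1..d-1}. U i \<in> tensors (front n k i @ [s i])) \<and>
     (\<forall>i\<in>{1..d-1}. X i \<in> tensors (front n k i @ [k i])) \<and>
     X d \<in> tensors [k (d-1), n d] \<and>
     (\<forall>i\<in>{2..d-1}. Z i \<in> tensors [s (i-1), n i, s i]) \<and>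
     (\<forall>i\<in>{2..d-1}. V i \<in> tensors [s (i-1), n i, k i]) \<and>
     V d \<in> tensors [s (d-1), n d] \<and>
     \<X> = tt_prods d (\<lambda>i. k i + s i + k i) (tangent_core d k s C U X Z V) 1 \<and>
     (\<forall>i\<in>{1..d-1}.
        transpose_mat (matricize (front n k i) [k i] (C i)) * matricize (front n k i) [s i] (U i)
          = 0\<^sub>m (k i) (s i)) \<and>
     (\<forall>i\<in>{1..d-1}.
        transpose_mat (matricize (front n k i) [k i] (C i)) * matricize (front n k i) [k i] (X i)
          = 0\<^sub>m (k i) (k i)) \<and>
     (\<forall>i\<in>{2..d}.
        matricize [s (i-1)] (sizes n i d) (tt_prods d k (C(i := V i)) i)
          * transpose_mat (matricize [k (i-1)] (sizes n i d) (tt_prods d k C i))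
          = 0\<^sub>m (s (i-1)) (k (i-1)))"


section \<open>The retraction\<close>

definition retr_core ::
  "nat \<Rightarrow> (nat \<Rightarrow> nat) \<Rightarrow> (nat \<Rightarrow> nat) \<Rightarrow> (nat \<Rightarrow> tensor) \<Rightarrow>
   (nat \<Rightarrow> tensor) \<Rightarrow> (nat \<Rightarrow> tensor) \<Rightarrow> (nat \<Rightarrow> tensor) \<Rightarrow> (nat \<Rightarrow> tensor) \<Rightarrow> nat \<Rightarrow> tensor" where
  "retr_core d k s C U X Z V i =
    (if i = 1 then hcat (k i) (\<lambda>j. C i j + X i j) (U i)
     else if i = d then vcat (k (i-1)) (\<lambda>j. C i j + X i j) (V i)
     else vcat (k (i-1)) (hcat (k i) (\<lambda>j. C i j + X i j) (U i))
                         (hcat (k i) (V i) (Z i)))"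

text \<open>\<open>Y\<close> is the value at \<open>(A, \<X>)\<close> obtained from some choice of a left-orthogonal
  factorization of \<open>A\<close> and an admissible parametrization of \<open>\<X>\<close>.\<close>

definition retr_value ::
  "nat \<Rightarrow> (nat \<Rightarrow> nat) \<Rightarrow> (nat \<Rightarrow> nat) \<Rightarrow> tensor \<Rightarrow> tensor \<Rightarrow> tensor \<Rightarrow> bool" where
  "retr_value d n r A \<X> Y \<longleftrightarrow>
     (let k = tt_rank d n A; s = (\<lambda>i. r i - k i) in
      \<exists>C U X Z V. left_orthogonal_tt d n k A C \<and> admissible d n k s C \<X> U X Z V \<and>
        Y = tt_prods d (\<lambda>i. k i + s i) (retr_core d k s C U X Z V) 1)"

end

theory Submission
  imports Defs
begin

text \<open>
  Contracting the tails of the trains over the block states gives three recursions for the tail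
  of \<open>A\<close>, of \<open>\<X>\<close> and of the excursion blocks \<open>V\<close>, \<open>Z\<close>; the parametrization enters the retraction
  only through them.

  Value: contracting with the left-orthogonal heads recovers the tails of \<open>A\<close> and \<open>\<X>\<close> from the
  full tensors, and excursion tails are orthogonal to tails of \<open>A\<close>. So whenever two
  parametrizations agree on row combinations of these tails, they agree, by descending induction
  on the position, on the corresponding row combinations of the tails of the retraction.

  Existence: let \<open>P\<^sub>m\<close> and \<open>Q\<^sub>m\<close> be the projections onto the orthogonal complements of the column and
  row space of the \<open>m\<close>-th unfolding of \<open>A\<close>. A determinant argument shows that \<open>P\<^sub>m \<X> Q\<^sub>m\<close> has rank at
  most \<open>s\<^sub>m\<close> for every tangent vector \<open>\<X>\<close>. Rank factorizations of these matrices play the role of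
  Hankel factorizations in realization theory: \<open>P\<^sub>m\<^sub>-\<^sub>1 \<X> Q\<^sub>m\<close> has its rows in the row space of
  \<open>P\<^sub>m \<X> Q\<^sub>m\<close>, which gives the cores \<open>Z\<^sub>m\<close>, and \<open>U\<^sub>m\<close>, \<open>V\<^sub>m\<close>, \<open>X\<^sub>m\<close> are read off.

  Order of approximation: \<open>t \<X>\<close> is parametrized by \<open>U\<close>, \<open>t X\<close>, \<open>Z\<close>, \<open>t V\<close>, so the retraction is a
  polynomial in \<open>t\<close>, with linear part \<open>A + t \<X>\<close>.
\<close>

section \<open>Rank and factorizations\<close>

text \<open>The comparison therefore never inverts anything on the excursion side. It speaks of all
  row combinations with equal tails, which includes combinations with tail zero; these must then be
  invisible to the retraction too. On the side of \<open>A\<close> the ranks are minimal, and there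
  left orthogonality and a right pseudoinverse of the tails suffice.

  The same slack shapes the existence proof: the normal part of \<open>\<X>\<close> may have rank
  below \<open>s i\<close>, so an orthonormal basis of its column space is padded with zero columns.
  The bound on that rank comes from minors: rows normal to \<open>A\<close> are rescaled by the
  factors of the sequence, so that the limit of the minor is triangular with unit diagonal.

  Ranks occur as inner sizes of factorizations, so that unfoldings can keep multi-indices as rows
  and columns.\<close>

definition factors :: "'a set \<Rightarrow> 'b set \<Rightarrow> nat \<Rightarrow> ('a \<Rightarrow> 'b \<Rightarrow> real) \<Rightarrow> bool" where
  "factors I J r M \<longleftrightarrow> (\<exists>L R. \<forall>i\<in>I. \<forall>j\<in>J. M i j = (\<Sum>c<r. L i c * R c j))"

lemma sum_lessThan_pad:
  fixes f :: "nat \<Rightarrow> 'a::comm_monoid_add"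
  assumes "m \<le> n"
  shows "(\<Sum>c<n. if c < m then f c else 0) = (\<Sum>c<m. f c)"
proof -
  have "(\<Sum>c<m. f c) = (\<Sum>c<n. if c < m then f c else 0)"
    by (rule sum.mono_neutral_cong_left) (use assms in auto)
  then show ?thesis by simp
qed

lemma sum_lessThan_add:
  fixes f :: "nat \<Rightarrow> 'a::comm_monoid_add"
  shows "(\<Sum>c<m + n. f c) = (\<Sum>c<m. f c) + (\<Sum>c<n. f (m + c))"
  by (induction n) (simp_all add: add.assoc)

lemma factors_mono:
  assumes "factors I J r M" "r \<le> r'"
  shows "factors I J r' M"
proof -
  obtain L R where "\<forall>i\<in>I. \<forall>j\<in>J. M i j = (\<Sum>c<r. L i c * R c j)"
    using assms(1) unfolding factors_def by blast
  moreover have "(\<Sum>c<r'. (if c < r then L i c else 0) * R c j) = (\<Sum>c<r. L i c * R c j)" for i j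
    by (subst sum_lessThan_pad[OF assms(2), symmetric]) (rule sum.cong, auto)
  ultimately show ?thesis unfolding factors_def
    by (intro exI[of _ "\<lambda>i c. if c < r then L i c else 0"] exI[of _ R]) simp
qed

text \<open>Compressing \<open>M\<close> from both sides cannot enlarge its inner size. Every minor
  used below has this form, with vectors \<open>p\<close> and \<open>q\<close> in place of selected
  rows and columns.\<close>

lemma factors_sandwich:
  assumes "factors I J r M"
  shows "factors A B r (\<lambda>a b. \<Sum>i\<in>I. \<Sum>j\<in>J. p a i * M i j * q j b)"
proof -
  obtain L R where LR: "\<And>i j. i \<in> I \<Longrightarrow> j \<in> J \<Longrightarrow> M i j = (\<Sum>c<r. L i c * R c j)"
    using assms(1) unfolding factors_def by blast
  have "(\<Sum>i\<in>I. \<Sum>j\<in>J. p a i * M i j * q j b) = (\<Sum>c<r. (\<Sum>i\<in>I. p a i * L i c) * (\<Sum>j\<in>J. R c j * q j b))" for a b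
  proof -
    have "(\<Sum>i\<in>I. \<Sum>j\<in>J. p a i * M i j * q j b) = (\<Sum>i\<in>I. \<Sum>j\<in>J. \<Sum>c<r. p a i * L i c * (R c j * q j b))"
      by (intro sum.cong refl) (simp add: LR sum_distrib_left sum_distrib_right mult.assoc)
    also have "\<dots> = (\<Sum>i\<in>I. \<Sum>c<r. \<Sum>j\<in>J. p a i * L i c * (R c j * q j b))"
      by (intro sum.cong refl sum.swap)
    also have "\<dots> = (\<Sum>c<r. \<Sum>i\<in>I. \<Sum>j\<in>J. p a i * L i c * (R c j * q j b))"
      by (rule sum.swap)
    finally show ?thesis by (simp add: sum_product)
  qed
  then show ?thesis unfolding factors_def
    by (intro exI[of _ "\<lambda>a c. \<Sum>i\<in>I. p a i * L i c"] exI[of _ "\<lambda>c b. \<Sum>j\<in>J. R c j * q j b"]) simp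
qed

lemma factors_cong:
  assumes "\<And>i j. i \<in> I \<Longrightarrow> j \<in> J \<Longrightarrow> M i j = N i j"
  shows "factors I J r M \<longleftrightarrow> factors I J r N"
  unfolding factors_def using assms by simp

text \<open>Padding the left factor with zero columns to size \<open>N\<close> makes it singular,
  and the determinant is multiplicative.\<close>

lemma det_factors:
  assumes "factors {..<N} {..<N} r M" "r < N"
  shows "det (mat N N (\<lambda>(i, j). M i j)) = 0"
proof -
  obtain L R where LR: "\<And>i j. i < N \<Longrightarrow> j < N \<Longrightarrow> M i j = (\<Sum>c<r. L i c * R c j)"
    using assms(1) unfolding factors_def by auto
  define B where "B = mat N N (\<lambda>(i, c). if c < r then L i c else 0)"
  define C where "C = mat N N (\<lambda>(c, j). R c j)"
  have carr: "B \<in> carrier_mat N N" "C \<in> carrier_mat N N" by (auto simp: B_def C_def)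
  have "mat N N (\<lambda>(i, j). M i j) = B * C"
  proof (rule eq_matI)
    fix i j assume ij: "i < dim_row (B * C)" "j < dim_col (B * C)"
    then have "(B * C) $$ (i, j) = (\<Sum>c<N. (if c < r then L i c else 0) * R c j)"
      by (simp add: B_def C_def scalar_prod_def atLeast0LessThan)
    also have "\<dots> = (\<Sum>c<N. if c < r then L i c * R c j else 0)"
      by (rule sum.cong) auto
    also have "\<dots> = M i j" using ij assms(2) by (simp add: LR sum_lessThan_pad B_def C_def)
    finally show "mat N N (\<lambda>(i, j). M i j) $$ (i, j) = (B * C) $$ (i, j)"
      using ij by (simp add: B_def C_def)
  qed (auto simp: B_def C_def)
  moreover have "det B = 0"
  proof -
    \<comment> \<open>Column \<open>r\<close> of the padded factor exists because
      \<open>r < N\<close>, and it is zero.\<close>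
    have "B *\<^sub>v unit_vec N r = 0\<^sub>v N"
      by (rule eq_vecI) (use assms(2) in \<open>auto simp: B_def scalar_prod_def unit_vec_def intro!: sum.neutral\<close>)
    moreover have "unit_vec N r \<noteq> (0\<^sub>v N :: real vec)"
      using assms(2) by (metis index_unit_vec(1) index_zero_vec(1) zero_neq_one)
    ultimately show ?thesis
      using det_0_iff_vec_prod_zero_field[OF carr(1)] unit_vec_carrier by blast
  qed
  ultimately show ?thesis using det_mult[OF carr] by simp
qed

lemma det_mat_one: "det (mat N N (\<lambda>(i, j). if i = j then 1 else 0 :: real)) = 1"
proof -
  have "mat N N (\<lambda>(i, j). if i = j then 1 else 0 :: real) = 1\<^sub>m N" by (rule eq_matI) auto
  then show ?thesis by simp
qed

text \<open>The compression is an identity matrix, whose determinant is one, so it cannot factor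
  through fewer than \<open>k\<close> states.\<close>

lemma factors_lower_bound:
  assumes "factors I J r M"
    and "\<And>c c'. c < k \<Longrightarrow> c' < k \<Longrightarrow> (\<Sum>i\<in>I. \<Sum>j\<in>J. p c i * M i j * q j c') = (if c = c' then 1 else 0)"
  shows "k \<le> r"
proof (rule ccontr)
  assume "\<not> k \<le> r"
  moreover have "factors {..<k} {..<k} r (\<lambda>c c'. \<Sum>i\<in>I. \<Sum>j\<in>J. p c i * M i j * q j c')"
    by (rule factors_sandwich[OF assms(1)])
  then have "factors {..<k} {..<k} r (\<lambda>c c'. if c = c' then 1 else 0)"
    by (subst factors_cong[of _ _ _ "\<lambda>c c'. \<Sum>i\<in>I. \<Sum>j\<in>J. p c i * M i j * q j c'"]) (auto simp: assms(2))
  ultimately have "det (mat k k (\<lambda>(i, j). if i = j then 1 else 0 :: real)) = 0"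
    by (intro det_factors[where M = "\<lambda>i j. if i = j then 1 else 0"]) auto
  then show False by (simp add: det_mat_one)
qed

text \<open>Gram-Schmidt on the columns of \<open>M\<close>. By the second conclusion the vectors
  \<open>\<Phi>\<close> lie in the column space, by the third they span it. The coefficients
  \<open>S\<close> later turn vectors of the column space back into products with
  \<open>M\<close>.\<close>

lemma orthonormal_factorization:
  fixes M :: "'a \<Rightarrow> 'b \<Rightarrow> real"
  assumes "finite I" "finite J"
  obtains k :: nat and \<Phi> S where
    "\<And>c c'. c < k \<Longrightarrow> c' < k \<Longrightarrow> (\<Sum>i\<in>I. \<Phi> i c * \<Phi> i c') = (if c = c' then 1 else 0)"
    "\<And>i c. i \<in> I \<Longrightarrow> c < k \<Longrightarrow> \<Phi> i c = (\<Sum>j\<in>J. M i j * S j c)"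
    "\<And>i j. i \<in> I \<Longrightarrow> j \<in> J \<Longrightarrow> M i j = (\<Sum>c<k. \<Phi> i c * (\<Sum>i'\<in>I. \<Phi> i' c * M i' j))"
proof -
  have "\<exists>(k::nat) \<Phi> S. (\<forall>c<k. \<forall>c'<k. (\<Sum>i\<in>I. \<Phi> i c * \<Phi> i c') = (if c = c' then 1 else 0)) \<and>
    (\<forall>i\<in>I. \<forall>c<k. \<Phi> i c = (\<Sum>j\<in>J. M i j * S j c)) \<and>
    (\<forall>i\<in>I. \<forall>j\<in>J. M i j = (\<Sum>c<k. \<Phi> i c * (\<Sum>i'\<in>I. \<Phi> i' c * M i' j)))"
    using assms(2)
  proof (induction J rule: finite_induct)
    case empty
    show ?case by (rule exI[of _ "0::nat"]) auto
  next
    case (insert j0 J)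
    obtain k :: nat and \<Phi> S where
      orth: "\<And>c c'. c < k \<Longrightarrow> c' < k \<Longrightarrow> (\<Sum>i\<in>I. \<Phi> i c * \<Phi> i c') = (if c = c' then 1 else 0 :: real)"
      and span: "\<And>i c. i \<in> I \<Longrightarrow> c < k \<Longrightarrow> \<Phi> i c = (\<Sum>j\<in>J. M i j * S j c)"
      and repr: "\<And>i j. i \<in> I \<Longrightarrow> j \<in> J \<Longrightarrow> M i j = (\<Sum>c<k. \<Phi> i c * (\<Sum>i'\<in>I. \<Phi> i' c * M i' j))"
      using insert.IH
    proof (elim exE conjE, goal_cases)
      case (1 k \<Phi> S)
      show ?case
      proof (rule 1(1)[of k \<Phi> S])
        show "c < k \<Longrightarrow> c' < k \<Longrightarrow> (\<Sum>i\<in>I. \<Phi> i c * \<Phi> i c') = (if c = c' then 1 else 0)" for c c'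
          by (rule 1(2)[rule_format])
        show "i \<in> I \<Longrightarrow> c < k \<Longrightarrow> \<Phi> i c = (\<Sum>j\<in>J. M i j * S j c)" for i c
          by (rule 1(3)[rule_format])
        show "i \<in> I \<Longrightarrow> j \<in> J \<Longrightarrow> M i j = (\<Sum>c<k. \<Phi> i c * (\<Sum>i'\<in>I. \<Phi> i' c * M i' j))" for i j
          by (rule 1(4)[rule_format])
      qed
    qed
    \<comment> \<open>\<open>w\<close> is the residual of the new column \<open>j0\<close> after
      projection onto the basis found so far; the basis grows exactly when it is nonzero.\<close>
    define y where "y c = (\<Sum>i\<in>I. \<Phi> i c * M i j0)" for c
    define w where "w i = M i j0 - (\<Sum>c<k. \<Phi> i c * y c)" for i
    have wperp: "(\<Sum>i\<in>I. \<Phi> i c * w i) = 0" if "c < k" for c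
    proof -
      have "(\<Sum>i\<in>I. \<Phi> i c * w i) = y c - (\<Sum>i\<in>I. \<Sum>c'<k. \<Phi> i c * \<Phi> i c' * y c')"
        by (simp add: w_def y_def right_diff_distrib sum_subtractf sum_distrib_left mult.assoc)
      also have "(\<Sum>i\<in>I. \<Sum>c'<k. \<Phi> i c * \<Phi> i c' * y c') = (\<Sum>c'<k. (\<Sum>i\<in>I. \<Phi> i c * \<Phi> i c') * y c')"
        by (subst sum.swap) (simp add: sum_distrib_right)
      also have "\<dots> = (\<Sum>c'<k. if c = c' then y c' else 0)"
        by (rule sum.cong) (use orth that in auto)
      finally show ?thesis using that by simp
    qed
    show ?case
    proof (cases "\<forall>i\<in>I. w i = 0")
      case True
      have j0: "M i j0 = (\<Sum>c<k. \<Phi> i c * (\<Sum>i'\<in>I. \<Phi> i' c * M i' j0))" if "i \<in> I" for i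
      proof -
        have "w i = 0" using True that by blast
        then show ?thesis unfolding w_def y_def by linarith
      qed
      have "(\<Sum>j\<in>insert j0 J. M i j * (if j = j0 then 0 else S j c)) = (\<Sum>j\<in>J. M i j * S j c)" for i c
      proof -
        have "(\<Sum>j\<in>J. M i j * (if j = j0 then 0 else S j c)) = (\<Sum>j\<in>J. M i j * S j c)"
          by (rule sum.cong) (use insert.hyps in auto)
        then show ?thesis using insert.hyps by simp
      qed
      then have span': "\<Phi> i c = (\<Sum>j\<in>insert j0 J. M i j * (if j = j0 then 0 else S j c))" if "i \<in> I" "c < k" for i c
        by (simp only: span[OF that])
      have repr': "M i j = (\<Sum>c<k. \<Phi> i c * (\<Sum>i'\<in>I. \<Phi> i' c * M i' j))"
        if "i \<in> I" "j \<in> insert j0 J" for i j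
      proof (cases "j = j0")
        case True
        show ?thesis unfolding True by (rule j0[OF that(1)])
      next
        case False
        then have "j \<in> J" using that by simp
        then show ?thesis by (rule repr[OF that(1)])
      qed
      show ?thesis
      proof (rule exI[of _ k], rule exI[of _ \<Phi>], rule exI[of _ "\<lambda>j c. if j = j0 then 0 else S j c"],
          intro conjI allI impI ballI)
        show "c < k \<Longrightarrow> c' < k \<Longrightarrow> (\<Sum>i\<in>I. \<Phi> i c * \<Phi> i c') = (if c = c' then 1 else 0)" for c c'
          by (rule orth)
        show "i \<in> I \<Longrightarrow> c < k \<Longrightarrow> \<Phi> i c = (\<Sum>j\<in>insert j0 J. M i j * (if j = j0 then 0 else S j c))" for i c
          by (rule span')
        show "i \<in> I \<Longrightarrow> j \<in> insert j0 J \<Longrightarrow> M i j = (\<Sum>c<k. \<Phi> i c * (\<Sum>i'\<in>I. \<Phi> i' c * M i' j))" for i j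
          by (rule repr')
      qed
    next
      case False
      define \<nu> where "\<nu> = sqrt (\<Sum>i\<in>I. w i * w i)"
      have pos: "(\<Sum>i\<in>I. w i * w i) > 0"
      proof -
        obtain i where "i \<in> I" "w i \<noteq> 0" using False by blast
        then show ?thesis by (intro sum_pos2[OF assms(1), of i]) (auto simp: zero_less_mult_iff)
      qed
      then have nu: "\<nu> * \<nu> = (\<Sum>i\<in>I. w i * w i)" "\<nu> > 0" by (auto simp: \<nu>_def)
      define \<Phi>' where "\<Phi>' i c = (if c < k then \<Phi> i c else w i / \<nu>)" for i c
      \<comment> \<open>The new basis vector is the residual divided by its norm
        \<open>\<nu>\<close>: coefficient one on column \<open>j0\<close>, and the subtracted
        projection rewritten in the old columns through \<open>S\<close>.\<close>
      define S' where "S' j c = (if c < k then (if j = j0 then 0 else S j c)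
          else ((if j = j0 then 1 else - (\<Sum>c<k. S j c * y c)) / \<nu>))" for j c
      have o1: "(\<Sum>i\<in>I. \<Phi>' i c * \<Phi>' i c') = (if c = c' then 1 else 0)" if h: "c < Suc k" "c' < Suc k" for c c'
      proof -
        consider "c < k" "c' < k" | "c < k" "c' = k" | "c = k" "c' < k" | "c = k" "c' = k"
          using h unfolding less_Suc_eq by blast
        then show ?thesis
        proof cases
          case 1 then show ?thesis by (simp add: \<Phi>'_def orth)
        next
          case 2 then show ?thesis using wperp[of c]
            by (simp add: \<Phi>'_def sum_divide_distrib[symmetric] )
        next
          case 3
          then have "(\<Sum>i\<in>I. \<Phi>' i c * \<Phi>' i c') = (\<Sum>i\<in>I. \<Phi> i c' * w i) / \<nu>"
            by (simp add: \<Phi>'_def sum_divide_distrib mult.commute)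
          then show ?thesis using wperp[of c'] 3 by simp
        next
          case 4
          then have "(\<Sum>i\<in>I. \<Phi>' i c * \<Phi>' i c') = (\<Sum>i\<in>I. w i * w i) / (\<nu> * \<nu>)"
            by (simp add: \<Phi>'_def sum_divide_distrib)
          then show ?thesis using nu 4 pos by simp
        qed
      qed
      have o2: "\<Phi>' i c = (\<Sum>j\<in>insert j0 J. M i j * S' j c)" if i: "i \<in> I" and c: "c < Suc k" for i c
      proof (cases "c < k")
        case True
        have "(\<Sum>j\<in>J. M i j * S' j c) = (\<Sum>j\<in>J. M i j * S j c)"
          by (rule sum.cong) (use insert.hyps True in \<open>auto simp: S'_def\<close>)
        then show ?thesis using True insert.hyps span[OF i True] by (simp add: \<Phi>'_def S'_def)
      next
        case False
        have "(\<Sum>j\<in>J. M i j * S' j c) = (\<Sum>j\<in>J. M i j * (- (\<Sum>c<k. S j c * y c) / \<nu>))"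
          by (rule sum.cong) (use insert.hyps False in \<open>auto simp: S'_def\<close>)
        also have "\<dots> = - (\<Sum>j\<in>J. \<Sum>c<k. M i j * S j c * y c) / \<nu>"
          by (simp add: sum_divide_distrib sum_negf sum_distrib_left mult.assoc)
        also have "(\<Sum>j\<in>J. \<Sum>c<k. M i j * S j c * y c) = (\<Sum>c<k. \<Phi> i c * y c)"
          by (subst sum.swap) (simp add: sum_distrib_right[symmetric] span[OF i])
        finally show ?thesis using False insert.hyps
          by (simp add: \<Phi>'_def S'_def w_def diff_divide_distrib)
      qed
      have o3: "M i j = (\<Sum>c<Suc k. \<Phi>' i c * (\<Sum>i'\<in>I. \<Phi>' i' c * M i' j))"
        if i: "i \<in> I" and j: "j \<in> insert j0 J" for i j
      proof -
        have eq: "(\<Sum>c<Suc k. \<Phi>' i c * (\<Sum>i'\<in>I. \<Phi>' i' c * M i' j))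
           = (\<Sum>c<k. \<Phi> i c * (\<Sum>i'\<in>I. \<Phi> i' c * M i' j)) + w i / (\<nu> * \<nu>) * (\<Sum>i'\<in>I. w i' * M i' j)"
          by (simp add: \<Phi>'_def sum_divide_distrib[symmetric])
        have wphi: "(\<Sum>i'\<in>I. w i' * (\<Sum>c<k. \<Phi> i' c * z c)) = 0" for z
        proof -
          have "(\<Sum>i'\<in>I. w i' * (\<Sum>c<k. \<Phi> i' c * z c)) = (\<Sum>c<k. (\<Sum>i'\<in>I. \<Phi> i' c * w i') * z c)"
            unfolding sum_distrib_left sum_distrib_right by (subst sum.swap) (simp add: mult_ac)
          then show ?thesis by (simp add: wperp)
        qed
        show ?thesis
        proof (cases "j = j0")
          case True
          have "(\<Sum>i'\<in>I. w i' * M i' j0) = (\<Sum>i'\<in>I. w i' * w i' + w i' * (\<Sum>c<k. \<Phi> i' c * y c))"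
            by (rule sum.cong) (auto simp: w_def algebra_simps)
          also have "\<dots> = \<nu> * \<nu>" using wphi[of y] nu by (simp add: sum.distrib)
          finally have "w i / (\<nu> * \<nu>) * (\<Sum>i'\<in>I. w i' * M i' j0) = w i" using nu(2) by simp
          then have "M i j0 = (\<Sum>c<k. \<Phi> i c * (\<Sum>i'\<in>I. \<Phi> i' c * M i' j0))
              + w i / (\<nu> * \<nu>) * (\<Sum>i'\<in>I. w i' * M i' j0)"
            by (simp add: w_def y_def)
          then show ?thesis using eq True by simp
        next
          case False
          then have "j \<in> J" using j by simp
          define z where "z c = (\<Sum>i'\<in>I. \<Phi> i' c * M i' j)" for c
          have Mz: "M i' j = (\<Sum>c<k. \<Phi> i' c * z c)" if "i' \<in> I" for i'
            unfolding z_def by (rule repr[OF that \<open>j \<in> J\<close>])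
          have "(\<Sum>i'\<in>I. w i' * M i' j) = (\<Sum>i'\<in>I. w i' * (\<Sum>c<k. \<Phi> i' c * z c))"
            by (simp add: Mz)
          then have "(\<Sum>i'\<in>I. w i' * M i' j) = 0" by (simp only: wphi)
          then show ?thesis using Mz[OF i] eq by (simp add: z_def)
        qed
      qed
      show ?thesis
      proof (rule exI[of _ "Suc k"], rule exI[of _ \<Phi>'], rule exI[of _ S'], intro conjI allI impI ballI)
        show "c < Suc k \<Longrightarrow> c' < Suc k \<Longrightarrow> (\<Sum>i\<in>I. \<Phi>' i c * \<Phi>' i c') = (if c = c' then 1 else 0)" for c c'
          by (rule o1)
        show "i \<in> I \<Longrightarrow> c < Suc k \<Longrightarrow> \<Phi>' i c = (\<Sum>j\<in>insert j0 J. M i j * S' j c)" for i c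
          by (rule o2)
        show "i \<in> I \<Longrightarrow> j \<in> insert j0 J \<Longrightarrow> M i j = (\<Sum>c<Suc k. \<Phi>' i c * (\<Sum>i'\<in>I. \<Phi>' i' c * M i' j))" for i j
          by (rule o3)
      qed
    qed
  qed
  then show ?thesis
  proof (elim exE conjE, goal_cases)
    case (1 k \<Phi> S)
    show ?thesis
    proof (rule that[of k \<Phi> S])
      show "c < k \<Longrightarrow> c' < k \<Longrightarrow> (\<Sum>i\<in>I. \<Phi> i c * \<Phi> i c') = (if c = c' then 1 else 0)" for c c'
        by (rule 1(1)[rule_format])
      show "i \<in> I \<Longrightarrow> c < k \<Longrightarrow> \<Phi> i c = (\<Sum>j\<in>J. M i j * S j c)" for i c
        by (rule 1(2)[rule_format])
      show "i \<in> I \<Longrightarrow> j \<in> J \<Longrightarrow> M i j = (\<Sum>c<k. \<Phi> i c * (\<Sum>i'\<in>I. \<Phi> i' c * M i' j))" for i j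
        by (rule 1(3)[rule_format])
    qed
  qed
qed

section \<open>The rank of a matrix as the least inner size of a factorization\<close>

lemma (in vec_space) rank_mult_left:
  assumes "B \<in> carrier_mat n k" "C \<in> carrier_mat k m"
  shows "rank (B * C) \<le> rank B"
proof -
  have BC: "B * C \<in> carrier_mat n m" using assms by simp
  have cB: "set (cols B) \<subseteq> carrier_vec n" using cols_dim[of B] assms(1) by simp
  have cBC: "set (cols (B * C)) \<subseteq> carrier_vec n" by (rule cols_dim[of "B * C", unfolded carrier_matD(1)[OF BC]])
  have "set (cols (B * C)) \<subseteq> col_space B"
  proof
    fix x assume "x \<in> set (cols (B * C))"
    then obtain j where j: "j < dim_col (B * C)" "x = col (B * C) j"
      unfolding cols_def by auto
    have "col C j \<in> carrier_vec (dim_col B)" using assms by auto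
    moreover have "B *\<^sub>v col C j = x" unfolding j(2)
      by (rule eq_vecI) (use assms j(1) in auto)
    moreover have "x \<in> carrier_vec (dim_row B)"
      unfolding j(2) by (rule carrier_vecI) simp
    ultimately show "x \<in> col_space B" unfolding col_space_eq[OF assms(1)] by blast
  qed
  then have sub: "span (set (cols (B * C))) \<subseteq> span (set (cols B))"
    unfolding col_space_def by (rule span_is_subset[OF _ span_is_submodule[OF cB]])
  have sp: "subspace class_ring (span (set (cols B))) V" "subspace class_ring (span (set (cols (B * C)))) V"
    by (rule span_is_subspace[OF cB], rule span_is_subspace[OF cBC])
  have nested: "subspace class_ring (span (set (cols (B * C)))) (vs (span (set (cols B))))"
    by (rule nested_subspaces[OF sp sub])
  have vs: "vectorspace class_ring (vs (span (set (cols B))))"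
    by (rule subspace_is_vs[OF sp(1)])
  have fin: "vectorspace.fin_dim class_ring (vs (span (set (cols B))))"
    "vectorspace.fin_dim class_ring (vs (span (set (cols (B * C)))))"
    using fin_dim_span_cols assms(1) BC by blast+
  show ?thesis unfolding rank_def
    using vectorspace.subspace_dim[OF vs nested fin(1)] fin(2) by auto
qed

text \<open>A left inverse makes \<open>B\<close> injective. Distinctness of the columns is shown
  apart from independence, since independence is a property of the set of columns and does not see a
  repeated one.\<close>

lemma (in vec_space) rank_eq_left_invertible:
  assumes "B \<in> carrier_mat n k" "C \<in> carrier_mat k n" "C * B = 1\<^sub>m k"
  shows "rank B = k"
proof (rule lin_indpt_full_rank[OF assms(1)])
  have inj: "v = w" if "v \<in> carrier_vec k" "w \<in> carrier_vec k" "B *\<^sub>v v = B *\<^sub>v w" for v w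
  proof -
    have "C *\<^sub>v (B *\<^sub>v u) = u" if "u \<in> carrier_vec k" for u
      using assoc_mult_mat_vec[OF assms(2,1) that] assms(3) that by simp
    then show ?thesis using that by metis
  qed
  show dist: "distinct (cols B)"
    unfolding distinct_conv_nth
  proof (intro allI impI)
    fix i j assume ij: "i < length (cols B)" "j < length (cols B)" "i \<noteq> j"
    then have ijk: "i < k" "j < k" using assms(1) by auto
    show "cols B ! i \<noteq> cols B ! j"
    proof
      assume eq: "cols B ! i = cols B ! j"
      have "B *\<^sub>v unit_vec k l = col B l" if "l < k" for l
        using that assms(1) by (intro eq_vecI) auto
      then have "B *\<^sub>v unit_vec k i = B *\<^sub>v unit_vec k j"
        using eq ij ijk by simp
      then have "unit_vec k i = (unit_vec k j :: 'a vec)" by (rule inj[rotated 2]) auto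
      then have "unit_vec k i $ i = (unit_vec k j :: 'a vec) $ i" by simp
      then show False using ij(3) ijk by simp
    qed
  qed
  show "lin_indpt (set (cols B))"
  proof
    assume "lin_dep (set (cols B))"
    then obtain v where "v \<in> carrier_vec k" "v \<noteq> 0\<^sub>v k" "B *\<^sub>v v = 0\<^sub>v n"
      by (rule lin_depE[OF assms(1) _ dist])
    moreover have "B *\<^sub>v 0\<^sub>v k = 0\<^sub>v n" using assms(1) by (intro eq_vecI) auto
    ultimately show False using inj[of v "0\<^sub>v k"] by auto
  qed
qed

text \<open>This equivalence lets all later rank arguments run on \<open>factors\<close>. Forwards,
  an orthonormal basis of the column space is a product with \<open>M\<close> on the left and has
  its transpose as left inverse, so its size is at most the rank. Backwards, the rank of a product
  is at most that of its left factor, which has \<open>r\<close> columns.\<close>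

lemma rank_le_iff_factors:
  assumes "M \<in> carrier_mat nr nc"
  shows "vec_space.rank nr M \<le> r \<longleftrightarrow> factors {..<nr} {..<nc} r (\<lambda>i j. M $$ (i, j))"
proof
  assume r: "vec_space.rank nr M \<le> r"
  obtain k :: nat and \<Phi> S where
    orth: "\<And>c c'. c < k \<Longrightarrow> c' < k \<Longrightarrow> (\<Sum>i\<in>{..<nr}. \<Phi> i c * \<Phi> i c') = (if c = c' then 1 else 0)"
    and span: "\<And>i c. i \<in> {..<nr} \<Longrightarrow> c < k \<Longrightarrow> \<Phi> i c = (\<Sum>j\<in>{..<nc}. M $$ (i, j) * S j c)"
    and repr: "\<And>i j. i \<in> {..<nr} \<Longrightarrow> j \<in> {..<nc} \<Longrightarrow> M $$ (i, j) = (\<Sum>c<k. \<Phi> i c * (\<Sum>i'\<in>{..<nr}. \<Phi> i' c * M $$ (i', j)))"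
  proof (rule orthonormal_factorization[where I = "{..<nr}" and J = "{..<nc}" and M = "\<lambda>i j. M $$ (i, j)"],
      goal_cases)
    case (3 k \<Phi> S)
    show ?case by (rule 3(1)[of k \<Phi> S]) (fact 3(2-))+
  qed (rule finite_lessThan)+
  define P where "P = mat nr k (\<lambda>(i, c). \<Phi> i c)"
  define C where "C = mat nc k (\<lambda>(j, c). S j c)"
  have "M * C = P"
  proof (rule eq_matI)
    fix i j assume ij: "i < dim_row P" "j < dim_col P"
    then have "(M * C) $$ (i, j) = (\<Sum>l<nc. M $$ (i, l) * S l j)"
      using assms by (simp add: P_def C_def scalar_prod_def atLeast0LessThan)
    also have "\<dots> = \<Phi> i j" using ij span[of i j] by (simp add: P_def)
    finally show "(M * C) $$ (i, j) = P $$ (i, j)" using ij by (simp add: P_def)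
  qed (use assms in \<open>auto simp: P_def C_def\<close>)
  moreover have "transpose_mat P * P = 1\<^sub>m k"
    by (rule eq_matI) (auto simp: P_def scalar_prod_def atLeast0LessThan orth)
  then have "vec_space.rank nr P = k"
    by (intro vec_space.rank_eq_left_invertible[where C = "transpose_mat P"]) (auto simp: P_def)
  ultimately have "k \<le> vec_space.rank nr M"
    using vec_space.rank_mult_left[OF assms, of C k] by (simp add: C_def)
  moreover have "factors {..<nr} {..<nc} k (\<lambda>i j. M $$ (i, j))"
    unfolding factors_def
  proof (intro exI ballI)
    fix i j assume "i \<in> {..<nr}" "j \<in> {..<nc}"
    then show "M $$ (i, j) = (\<Sum>c<k. \<Phi> i c * (\<lambda>c j. \<Sum>i'\<in>{..<nr}. \<Phi> i' c * M $$ (i', j)) c j)"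
      by (rule repr)
  qed
  ultimately show "factors {..<nr} {..<nc} r (\<lambda>i j. M $$ (i, j))"
    using factors_mono[of "{..<nr}" "{..<nc}" k _ r] r by simp
next
  assume "factors {..<nr} {..<nc} r (\<lambda>i j. M $$ (i, j))"
  then obtain L R where LR: "\<And>i j. i < nr \<Longrightarrow> j < nc \<Longrightarrow> M $$ (i, j) = (\<Sum>c<r. L i c * R c j)"
    unfolding factors_def by auto
  define B where "B = mat nr r (\<lambda>(i, c). L i c)"
  define C where "C = mat r nc (\<lambda>(c, j). R c j)"
  have B: "B \<in> carrier_mat nr r" and C: "C \<in> carrier_mat r nc" by (auto simp: B_def C_def)
  have "M = B * C"
    by (rule eq_matI) (use assms in \<open>auto simp: B_def C_def LR scalar_prod_def atLeast0LessThan\<close>)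
  then have "vec_space.rank nr M \<le> vec_space.rank nr B"
    using vec_space.rank_mult_left[OF B C] by simp
  then show "vec_space.rank nr M \<le> r" using vec_space.rank_le_nc[OF B] by linarith
qed

section \<open>Multi-indices and unfoldings in terms of entries\<close>

definition idx :: "nat list \<Rightarrow> nat list set" where
  "idx ms = {j. list_all2 (<) j ms}"

lemma set_multi_indices: "set (multi_indices ms) = idx ms"
  by (auto simp: multi_indices_def idx_def product_lists_set list_all2_map2)

lemma distinct_multi_indices: "distinct (multi_indices ms)"
proof (induction ms)
  case Nil show ?case by (simp add: multi_indices_def)
next
  case (Cons m ms)
  have "distinct (concat (map (\<lambda>x. map ((#) x) (multi_indices ms)) xs))" if "distinct xs" for xs :: "nat list"
    using that by (induction xs) (use Cons in \<open>auto simp: distinct_map\<close>)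
  then show ?case by (simp add: multi_indices_def)
qed

lemma finite_idx [simp]: "finite (idx ms)"
  by (metis set_multi_indices List.finite_set)

lemma length_idx: "j \<in> idx ms \<Longrightarrow> length j = length ms"
  by (simp add: idx_def list_all2_lengthD)

lemma idx_Nil [simp]: "idx [] = {[]}"
  by (auto simp: idx_def)

lemma Cons_in_idx [simp]: "x # b \<in> idx (m # ms) \<longleftrightarrow> x < m \<and> b \<in> idx ms"
  by (simp add: idx_def)

lemma idx_Cons: "idx (m # ms) = (\<lambda>(x, b). x # b) ` ({..<m} \<times> idx ms)"
  by (auto simp: idx_def list_all2_Cons2)

lemma append_in_idx [simp]:
  "length a = length ps \<Longrightarrow> a @ b \<in> idx (ps @ qs) \<longleftrightarrow> a \<in> idx ps \<and> b \<in> idx qs"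
  by (simp add: idx_def list_all2_append)

lemma idx_append: "idx (ps @ qs) = (\<lambda>(a, b). a @ b) ` (idx ps \<times> idx qs)"
proof -
  have "j \<in> idx (ps @ qs) \<longleftrightarrow> (\<exists>a\<in>idx ps. \<exists>b\<in>idx qs. j = a @ b)" for j
    unfolding idx_def mem_Collect_eq list_all2_append2 by (auto dest: list_all2_lengthD)
  then show ?thesis by auto
qed

lemma sum_idx_Cons: "(\<Sum>j\<in>idx (m # ms). f j) = (\<Sum>x<m. \<Sum>b\<in>idx ms. f (x # b))"
  unfolding idx_Cons sum.cartesian_product by (subst sum.reindex) (auto simp: inj_on_def intro!: sum.cong)

lemma sum_idx_append: "(\<Sum>j\<in>idx (ps @ qs). f j) = (\<Sum>a\<in>idx ps. \<Sum>b\<in>idx qs. f (a @ b))"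
proof -
  have "inj_on (\<lambda>(a, b). a @ b) (idx ps \<times> idx qs)"
    by (rule inj_onI) (auto simp: length_idx append_eq_append_conv)
  then show ?thesis unfolding idx_append sum.cartesian_product by (simp add: sum.reindex case_prod_unfold)
qed

lemma sum_multi_indices:
  "(\<Sum>i<length (multi_indices ms). f (multi_indices ms ! i)) = (\<Sum>j\<in>idx ms. f j)"
  using sum.reindex_bij_betw[OF bij_betw_nth[OF distinct_multi_indices refl refl], of f ms]
  by (simp add: set_multi_indices)

text \<open>Surjective reindexing suffices for both directions: a factorization is transported back
  by choosing one preimage of each index.\<close>

lemma factors_reindex:
  assumes "f ` I' = I" "g ` J' = J"
  shows "factors I' J' r (\<lambda>i j. M (f i) (g j)) \<longleftrightarrow> factors I J r M"
proof
  assume "factors I' J' r (\<lambda>i j. M (f i) (g j))"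
  then obtain L R where "\<forall>i\<in>I'. \<forall>j\<in>J'. M (f i) (g j) = (\<Sum>c<r. L i c * R c j)"
    unfolding factors_def by blast
  then have "M a b = (\<Sum>c<r. L (inv_into I' f a) c * R c (inv_into J' g b))" if "a \<in> I" "b \<in> J" for a b
    using that inv_into_into[of a f I'] inv_into_into[of b g J'] f_inv_into_f[of a f I'] f_inv_into_f[of b g J'] assms
    by metis
  then show "factors I J r M" unfolding factors_def
    by (intro exI[of _ "\<lambda>a. L (inv_into I' f a)"] exI[of _ "\<lambda>c b. R c (inv_into J' g b)"]) simp
next
  assume "factors I J r M"
  then obtain L R where "\<forall>i\<in>I. \<forall>j\<in>J. M i j = (\<Sum>c<r. L i c * R c j)"
    unfolding factors_def by blast
  then show "factors I' J' r (\<lambda>i j. M (f i) (g j))" unfolding factors_def using assms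
    by (intro exI[of _ "\<lambda>i. L (f i)"] exI[of _ "\<lambda>c j. R c (g j)"]) blast
qed

lemma nth_image_lessThan: "(!) xs ` {..<length xs} = set xs"
  by (auto simp: set_conv_nth)

lemma rank_matricize_le_iff:
  "vec_space.rank (length (multi_indices ps)) (matricize ps qs A) \<le> r
     \<longleftrightarrow> factors (idx ps) (idx qs) r (\<lambda>a b. A (a @ b))"
proof -
  have "matricize ps qs A \<in> carrier_mat (length (multi_indices ps)) (length (multi_indices qs))"
    by (simp add: matricize_def)
  then have "vec_space.rank (length (multi_indices ps)) (matricize ps qs A) \<le> r
     \<longleftrightarrow> factors {..<length (multi_indices ps)} {..<length (multi_indices qs)} r
           (\<lambda>i j. matricize ps qs A $$ (i, j))"
    by (rule rank_le_iff_factors)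
  also have "\<dots> \<longleftrightarrow> factors {..<length (multi_indices ps)} {..<length (multi_indices qs)} r
           (\<lambda>i j. A (multi_indices ps ! i @ multi_indices qs ! j))"
    by (rule factors_cong) (simp add: matricize_def)
  also have "\<dots> \<longleftrightarrow> factors (idx ps) (idx qs) r (\<lambda>a b. A (a @ b))"
    by (rule factors_reindex) (auto simp: nth_image_lessThan set_multi_indices)
  finally show ?thesis .
qed

lemma tt_rank_le_iff:
  "tt_rank d n A i \<le> r \<longleftrightarrow>
     factors (idx (sizes n 1 i)) (idx (sizes n (Suc i) d)) r (\<lambda>a b. A (a @ b))"
  unfolding tt_rank_def by (rule rank_matricize_le_iff)

lemma multi_indices_singleton: "multi_indices [m] = map (\<lambda>x. [x]) [0..<m]"
  by (simp add: multi_indices_def)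

text \<open>With \<open>f\<close> the entries of the identity or of zero, this turns the
  orthogonality conditions on cores into sums over multi-indices.\<close>

lemma matricize_gram_right:
  "transpose_mat (matricize ps [k] A) * matricize ps [l] B = mat k l f \<longleftrightarrow>
     (\<forall>e<k. \<forall>e'<l. (\<Sum>p\<in>idx ps. A (p @ [e]) * B (p @ [e'])) = f (e, e'))"
proof -
  have "(transpose_mat (matricize ps [k] A) * matricize ps [l] B) $$ (e, e')
      = (\<Sum>p\<in>idx ps. A (p @ [e]) * B (p @ [e']))" if "e < k" "e' < l" for e e'
    using that sum_multi_indices[of "\<lambda>p. A (p @ [e]) * B (p @ [e'])" ps]
    by (simp add: matricize_def multi_indices_singleton scalar_prod_def atLeast0LessThan)
  then have "transpose_mat (matricize ps [k] A) * matricize ps [l] B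
      = mat k l (\<lambda>(e, e'). \<Sum>p\<in>idx ps. A (p @ [e]) * B (p @ [e']))"
    by (intro eq_matI) (simp_all add: matricize_def multi_indices_singleton del: index_mult_mat(1))
  then show ?thesis by (simp only:) (auto simp: mat_eq_iff)
qed

lemma matricize_gram_left:
  "matricize [k] qs A * transpose_mat (matricize [l] qs B) = mat k l f \<longleftrightarrow>
     (\<forall>e<k. \<forall>e'<l. (\<Sum>q\<in>idx qs. A (e # q) * B (e' # q)) = f (e, e'))"
proof -
  have "(matricize [k] qs A * transpose_mat (matricize [l] qs B)) $$ (e, e')
      = (\<Sum>q\<in>idx qs. A (e # q) * B (e' # q))" if "e < k" "e' < l" for e e'
    using that sum_multi_indices[of "\<lambda>q. A (e # q) * B (e' # q)" qs]
    by (simp add: matricize_def multi_indices_singleton scalar_prod_def atLeast0LessThan)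
  then have "matricize [k] qs A * transpose_mat (matricize [l] qs B)
      = mat k l (\<lambda>(e, e'). \<Sum>q\<in>idx qs. A (e # q) * B (e' # q))"
    by (intro eq_matI) (simp_all add: matricize_def multi_indices_singleton del: index_mult_mat(1))
  then show ?thesis by (simp only:) (auto simp: mat_eq_iff)
qed

section \<open>Tensor trains\<close>

text \<open>The entry of a tail at the remaining indices \<open>b\<close>, starting in state
  \<alpha> of the bond before position \<open>i\<close>. The empty tail is one, since the last bond
  is trivial. In \<open>tangent\<close> and \<open>excursion\<close>, which start in the first and
  in the middle block row of the tangent cores, the empty tail is zero: a path counts only if it
  reaches the last block row, where the tail is \<open>train\<close>.\<close>

primrec train :: "(nat \<Rightarrow> nat) \<Rightarrow> (nat \<Rightarrow> nat \<Rightarrow> nat \<Rightarrow> nat \<Rightarrow> real) \<Rightarrow> nat list \<Rightarrow> nat \<Rightarrow> nat \<Rightarrow> real" where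
  "train K A [] = (\<lambda>i \<alpha>. 1)"
| "train K A (x # b) = (\<lambda>i \<alpha>. \<Sum>\<beta><K i. A i \<alpha> x \<beta> * train K A b (Suc i) \<beta>)"

primrec excursion :: "(nat \<Rightarrow> nat) \<Rightarrow> (nat \<Rightarrow> nat) \<Rightarrow> (nat \<Rightarrow> nat \<Rightarrow> nat \<Rightarrow> nat \<Rightarrow> real) \<Rightarrow>
    (nat \<Rightarrow> nat \<Rightarrow> nat \<Rightarrow> nat \<Rightarrow> real) \<Rightarrow> (nat \<Rightarrow> nat \<Rightarrow> nat \<Rightarrow> nat \<Rightarrow> real) \<Rightarrow> nat list \<Rightarrow> nat \<Rightarrow> nat \<Rightarrow> real" where
  "excursion K S A Z V [] = (\<lambda>i \<sigma>. 0)"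
| "excursion K S A Z V (x # b) = (\<lambda>i \<sigma>. (\<Sum>\<beta><K i. V i \<sigma> x \<beta> * train K A b (Suc i) \<beta>)
     + (\<Sum>\<tau><S i. Z i \<sigma> x \<tau> * excursion K S A Z V b (Suc i) \<tau>))"

primrec tangent :: "(nat \<Rightarrow> nat) \<Rightarrow> (nat \<Rightarrow> nat) \<Rightarrow> (nat \<Rightarrow> nat \<Rightarrow> nat \<Rightarrow> nat \<Rightarrow> real) \<Rightarrow>
    (nat \<Rightarrow> nat \<Rightarrow> nat \<Rightarrow> nat \<Rightarrow> real) \<Rightarrow> (nat \<Rightarrow> nat \<Rightarrow> nat \<Rightarrow> nat \<Rightarrow> real) \<Rightarrow>
    (nat \<Rightarrow> nat \<Rightarrow> nat \<Rightarrow> nat \<Rightarrow> real) \<Rightarrow> (nat \<Rightarrow> nat \<Rightarrow> nat \<Rightarrow> nat \<Rightarrow> real) \<Rightarrow> nat list \<Rightarrow> nat \<Rightarrow> nat \<Rightarrow> real" where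
  "tangent K S A U X Z V [] = (\<lambda>i \<alpha>. 0)"
| "tangent K S A U X Z V (x # b) = (\<lambda>i \<alpha>. (\<Sum>\<beta><K i. A i \<alpha> x \<beta> * tangent K S A U X Z V b (Suc i) \<beta>)
     + (\<Sum>\<tau><S i. U i \<alpha> x \<tau> * excursion K S A Z V b (Suc i) \<tau>)
     + (\<Sum>\<beta><K i. X i \<alpha> x \<beta> * train K A b (Suc i) \<beta>))"

text \<open>The sum type separates the two block rows: \<open>Inl\<close> for the states with cores
  \<open>A + X\<close>, \<open>Inr\<close> for the excursion states. At the end only
  \<open>Inl\<close> survives.\<close>

primrec retract :: "(nat \<Rightarrow> nat) \<Rightarrow> (nat \<Rightarrow> nat) \<Rightarrow> (nat \<Rightarrow> nat \<Rightarrow> nat \<Rightarrow> nat \<Rightarrow> real) \<Rightarrow>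
    (nat \<Rightarrow> nat \<Rightarrow> nat \<Rightarrow> nat \<Rightarrow> real) \<Rightarrow> (nat \<Rightarrow> nat \<Rightarrow> nat \<Rightarrow> nat \<Rightarrow> real) \<Rightarrow>
    (nat \<Rightarrow> nat \<Rightarrow> nat \<Rightarrow> nat \<Rightarrow> real) \<Rightarrow> (nat \<Rightarrow> nat \<Rightarrow> nat \<Rightarrow> nat \<Rightarrow> real) \<Rightarrow> nat list \<Rightarrow> nat \<Rightarrow> nat + nat \<Rightarrow> real" where
  "retract K S A U X Z V [] = (\<lambda>i p. case p of Inl \<alpha> \<Rightarrow> 1 | Inr \<sigma> \<Rightarrow> 0)"
| "retract K S A U X Z V (x # b) = (\<lambda>i p. case p of
     Inl \<alpha> \<Rightarrow> (\<Sum>\<beta><K i. (A i \<alpha> x \<beta> + X i \<alpha> x \<beta>) * retract K S A U X Z V b (Suc i) (Inl \<beta>))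
       + (\<Sum>\<tau><S i. U i \<alpha> x \<tau> * retract K S A U X Z V b (Suc i) (Inr \<tau>))
   | Inr \<sigma> \<Rightarrow> (\<Sum>\<beta><K i. V i \<sigma> x \<beta> * retract K S A U X Z V b (Suc i) (Inl \<beta>))
       + (\<Sum>\<tau><S i. Z i \<sigma> x \<tau> * retract K S A U X Z V b (Suc i) (Inr \<tau>)))"

text \<open>The entry of the product of the first cores at the indices \<open>a\<close>. The
  recursion runs over the reversed list because the last index is contracted last; the position of a
  core is read off from the length of the prefix before it.\<close>

definition head :: "(nat \<Rightarrow> nat) \<Rightarrow> (nat \<Rightarrow> nat \<Rightarrow> nat \<Rightarrow> nat \<Rightarrow> real) \<Rightarrow> nat list \<Rightarrow> nat \<Rightarrow> real" where
  "head K A a = rec_list (\<lambda>c. 1) (\<lambda>x a h c. \<Sum>\<beta><K (length a). h \<beta> * A (Suc (length a)) \<beta> x c) (rev a)"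

lemma head_Nil [simp]: "head K A [] c = 1"
  by (simp add: head_def)

lemma head_snoc [simp]:
  "head K A (a @ [x]) c = (\<Sum>\<beta><K (length a). head K A a \<beta> * A (Suc (length a)) \<beta> x c)"
  by (simp add: head_def)

lemma train_append:
  assumes "K 0 = 1"
  shows "train K A (a @ b) 1 0 = (\<Sum>c<K (length a). head K A a c * train K A b (Suc (length a)) c)"
proof (induction a arbitrary: b rule: rev_induct)
  case Nil
  show ?case using assms by simp
next
  case (snoc x a)
  have "train K A ((a @ [x]) @ b) 1 0 = (\<Sum>c<K (length a). head K A a c * train K A (x # b) (Suc (length a)) c)"
    using snoc[of "x # b"] by simp
  also have "\<dots> = (\<Sum>c<K (length a). \<Sum>\<beta><K (Suc (length a)). head K A a c * A (Suc (length a)) c x \<beta> * train K A b (Suc (Suc (length a))) \<beta>)"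
    by (simp add: sum_distrib_left mult.assoc)
  also have "\<dots> = (\<Sum>\<beta><K (Suc (length a)). \<Sum>c<K (length a). head K A a c * A (Suc (length a)) c x \<beta> * train K A b (Suc (Suc (length a))) \<beta>)"
    by (rule sum.swap)
  finally show ?case by (simp add: sum_distrib_right)
qed

text \<open>Bonds at \<open>0\<close> and \<open>d\<close> make the end cores ordinary ones:
  \<open>e = 1\<close> is the trivial bond of a train, \<open>e = 0\<close> says that no excursion
  state exists before the first or after the last core.\<close>

definition bonds :: "nat \<Rightarrow> nat \<Rightarrow> (nat \<Rightarrow> nat) \<Rightarrow> nat \<Rightarrow> nat" where
  "bonds e d k i = (if 0 < i \<and> i < d then k i else e)"

lemma bonds_inner [simp]: "0 < i \<Longrightarrow> i < d \<Longrightarrow> bonds e d k i = k i"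
  by (simp add: bonds_def)

lemma bonds_outer [simp]: "bonds e d k 0 = e" "bonds e d k d = e"
  by (simp_all add: bonds_def)

text \<open>A view of the cores in which missing outer indices become dummies, so that one recursion
  serves both the matrices at the ends and the order 3 tensors between them.\<close>

definition core :: "nat \<Rightarrow> (nat \<Rightarrow> tensor) \<Rightarrow> nat \<Rightarrow> nat \<Rightarrow> nat \<Rightarrow> nat \<Rightarrow> real" where
  "core d C i \<alpha> x \<beta> = C i ((if i = 1 then [] else [\<alpha>]) @ x # (if i = d then [] else [\<beta>]))"

lemma core_inner: "1 < i \<Longrightarrow> i < d \<Longrightarrow> core d C i \<alpha> x \<beta> = C i [\<alpha>, x, \<beta>]"
  by (simp add: core_def)

lemma core_first: "1 < d \<Longrightarrow> core d C (Suc 0) \<alpha> x \<beta> = C 1 [x, \<beta>]"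
  by (simp add: core_def)

lemma core_last: "1 < d \<Longrightarrow> core d C d \<alpha> x \<beta> = C d [\<alpha>, x]"
  by (simp add: core_def)

lemma tt_prods_last: "tt_prods d k C d = C d"
  by (simp add: tt_prods_def)

lemma tt_prods_step:
  "i < d \<Longrightarrow> tt_prods d k C i = tt_prod (if i = 1 then 1 else 2) (k i) (C i) (tt_prods d k C (Suc i))"
  by (simp add: tt_prods_def upt_conv_Cons)

lemma tt_prods_train:
  assumes "1 \<le> i" "i \<le> d" "length b = Suc d - i"
  shows "tt_prods d k C i ((if i = 1 then [] else [\<alpha>]) @ b) = train (bonds 1 d k) (core d C) b i \<alpha>"
  using assms
proof (induction b arbitrary: i \<alpha>)
  case Nil
  then show ?case by simp
next
  case (Cons x b)
  show ?case
  proof (cases "i = d")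
    case True
    then have "b = []" using Cons.prems by simp
    then show ?thesis using True by (auto simp: tt_prods_last core_def)
  next
    case False
    then have i: "i < d" "0 < i" using Cons.prems by auto
    have "tt_prods d k C i ((if i = 1 then [] else [\<alpha>]) @ x # b)
       = (\<Sum>m<k i. core d C i \<alpha> x m * tt_prods d k C (Suc i) (m # b))"
      using False by (simp add: tt_prods_step[OF i(1)] tt_prod_def core_def)
    also have "\<dots> = (\<Sum>m<k i. core d C i \<alpha> x m * train (bonds 1 d k) (core d C) b (Suc i) m)"
    proof (rule sum.cong[OF refl])
      fix m
      show "core d C i \<alpha> x m * tt_prods d k C (Suc i) (m # b) = core d C i \<alpha> x m * train (bonds 1 d k) (core d C) b (Suc i) m"
        using Cons.IH[of "Suc i" m] Cons.prems i by simp
    qed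
    finally show ?thesis using i by simp
  qed
qed

text \<open>The states of bond \<open>i - 1\<close> fall into the three block rows of the upper
  triangular cores, of sizes \<open>k\<close>, \<open>s\<close> and \<open>k\<close>, and each block
  row has its own recursion. Position one is left to \<open>tangent_train\<close>, as its core is a
  single block row.\<close>

lemma tangent_train_blocks:
  fixes d k s C U X Z V
  defines "T \<equiv> train (bonds 1 d (\<lambda>i. k i + s i + k i)) (core d (tangent_core d k s C U X Z V))"
    and "K \<equiv> bonds 1 d k" and "S \<equiv> bonds 0 d s"
  assumes "2 \<le> i" "i \<le> d" "length b = Suc d - i"
  shows "(\<forall>c<k (i - 1). T b i c = tangent K S (core d C) (core d U) (core d X) (core d Z) (core d V) b i c) \<and>
    (\<forall>c<s (i - 1). T b i (k (i - 1) + c) = excursion K S (core d C) (core d Z) (core d V) b i c) \<and>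
    (\<forall>c<k (i - 1). T b i (k (i - 1) + s (i - 1) + c) = train K (core d C) b i c)"
  using assms(4-)
proof (induction b arbitrary: i)
  case Nil
  then show ?case by simp
next
  case (Cons x b)
  show ?case
  proof (cases "i = d")
    case True
    then have "b = []" using Cons.prems by simp
    then show ?thesis using True Cons.prems
      by (simp add: T_def K_def S_def core_last tangent_core_def vcat_def)
  next
    case False
    then have i: "2 \<le> i" "i < d" using Cons.prems by auto
    have KS: "K i = k i" "S i = s i" using i by (simp_all add: K_def S_def)
    have IH: "\<And>c. c < k i \<Longrightarrow> T b (Suc i) c = tangent K S (core d C) (core d U) (core d X) (core d Z) (core d V) b (Suc i) c"
      "\<And>c. c < s i \<Longrightarrow> T b (Suc i) (k i + c) = excursion K S (core d C) (core d Z) (core d V) b (Suc i) c"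
      "\<And>c. c < k i \<Longrightarrow> T b (Suc i) (k i + s i + c) = train K (core d C) b (Suc i) c"
      using Cons.IH[of "Suc i"] Cons.prems i by simp_all
    have T: "T (x # b) i c = (\<Sum>m<k i. tangent_core d k s C U X Z V i [c, x, m] * tangent K S (core d C) (core d U) (core d X) (core d Z) (core d V) b (Suc i) m)
        + (\<Sum>m<s i. tangent_core d k s C U X Z V i [c, x, k i + m] * excursion K S (core d C) (core d Z) (core d V) b (Suc i) m)
        + (\<Sum>m<k i. tangent_core d k s C U X Z V i [c, x, k i + s i + m] * train K (core d C) b (Suc i) m)" for c
      using i IH by (simp add: T_def core_inner sum_lessThan_add)
    show ?thesis
      unfolding T using i KS by (simp add: tangent_core_def vcat_def hcat_def core_inner)
  qed
qed

lemma tangent_train: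
  assumes "2 \<le> d" "length b = d"
  shows "tt_prods d (\<lambda>i. k i + s i + k i) (tangent_core d k s C U X Z V) 1 b
    = tangent (bonds 1 d k) (bonds 0 d s) (core d C) (core d U) (core d X) (core d Z) (core d V) b 1 0"
proof -
  obtain x b' where b: "b = x # b'" "length b' = d - 1" using assms by (cases b) auto
  note bl = tangent_train_blocks[of 2 d b' k s C U X Z V]
  have "tt_prods d (\<lambda>i. k i + s i + k i) (tangent_core d k s C U X Z V) 1 b
     = train (bonds 1 d (\<lambda>i. k i + s i + k i)) (core d (tangent_core d k s C U X Z V)) b 1 0"
    using tt_prods_train[of 1 d b "\<lambda>i. k i + s i + k i" "tangent_core d k s C U X Z V" 0] assms by simp
  also have "\<dots> = tangent (bonds 1 d k) (bonds 0 d s) (core d C) (core d U) (core d X) (core d Z) (core d V) b 1 0"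
    using bl assms b by (simp add: sum_lessThan_add tangent_core_def hcat_def core_first numeral_2_eq_2)
  finally show ?thesis .
qed

lemma retr_train_blocks:
  fixes d k s C U X Z V
  defines "T \<equiv> train (bonds 1 d (\<lambda>i. k i + s i)) (core d (retr_core d k s C U X Z V))"
    and "R \<equiv> retract (bonds 1 d k) (bonds 0 d s) (core d C) (core d U) (core d X) (core d Z) (core d V)"
  assumes "2 \<le> i" "i \<le> d" "length b = Suc d - i"
  shows "(\<forall>c<k (i - 1). T b i c = R b i (Inl c)) \<and>
    (\<forall>c<s (i - 1). T b i (k (i - 1) + c) = R b i (Inr c))"
  using assms(3-)
proof (induction b arbitrary: i)
  case Nil
  then show ?case by simp
next
  case (Cons x b)
  show ?case
  proof (cases "i = d")
    case True
    then have "b = []" using Cons.prems by simp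
    then show ?thesis using True Cons.prems
      by (simp add: T_def R_def core_last retr_core_def vcat_def)
  next
    case False
    then have i: "2 \<le> i" "i < d" using Cons.prems by auto
    have IH: "\<And>c. c < k i \<Longrightarrow> T b (Suc i) c = R b (Suc i) (Inl c)"
      "\<And>c. c < s i \<Longrightarrow> T b (Suc i) (k i + c) = R b (Suc i) (Inr c)"
      using Cons.IH[of "Suc i"] Cons.prems i by simp_all
    have T: "T (x # b) i c = (\<Sum>m<k i. retr_core d k s C U X Z V i [c, x, m] * R b (Suc i) (Inl m))
        + (\<Sum>m<s i. retr_core d k s C U X Z V i [c, x, k i + m] * R b (Suc i) (Inr m))" for c
      using i IH by (simp add: T_def core_inner sum_lessThan_add)
    show ?thesis
      unfolding T using i by (simp add: R_def retr_core_def vcat_def hcat_def core_inner)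
  qed
qed

lemma retr_train:
  assumes "2 \<le> d" "length b = d"
  shows "tt_prods d (\<lambda>i. k i + s i) (retr_core d k s C U X Z V) 1 b
    = retract (bonds 1 d k) (bonds 0 d s) (core d C) (core d U) (core d X) (core d Z) (core d V) b 1 (Inl 0)"
proof -
  obtain x b' where b: "b = x # b'" "length b' = d - 1" using assms by (cases b) auto
  note bl = retr_train_blocks[of 2 d b' k s C U X Z V]
  have "tt_prods d (\<lambda>i. k i + s i) (retr_core d k s C U X Z V) 1 b
     = train (bonds 1 d (\<lambda>i. k i + s i)) (core d (retr_core d k s C U X Z V)) b 1 0"
    using tt_prods_train[of 1 d b "\<lambda>i. k i + s i" "retr_core d k s C U X Z V" 0] assms by simp
  also have "\<dots> = retract (bonds 1 d k) (bonds 0 d s) (core d C) (core d U) (core d X) (core d Z) (core d V) b 1 (Inl 0)"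
    using bl assms b by (simp add: sum_lessThan_add retr_core_def hcat_def core_first numeral_2_eq_2)
  finally show ?thesis .
qed

section \<open>Supports of products and of block tensors\<close>

lemma tensors_iff: "A \<in> tensors ms \<longleftrightarrow> (\<forall>j. j \<notin> idx ms \<longrightarrow> A j = 0)"
  by (auto simp: tensors_def idx_def)

text \<open>Tensors are functions on all lists, so agreement of the entries inside the size settles
  equality only once the supports are known.\<close>

lemma tt_prod_tensors:
  assumes "A \<in> tensors (ps @ [k])" "B \<in> tensors (k # qs)" "p = length ps"
  shows "tt_prod p k A B \<in> tensors (ps @ qs)"
  unfolding tensors_iff
proof (intro allI impI)
  fix j assume j: "j \<notin> idx (ps @ qs)"
  have "A (take p j @ [m]) * B (m # drop p j) = 0" for m
  proof (rule ccontr)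
    assume "A (take p j @ [m]) * B (m # drop p j) \<noteq> 0"
    then have "take p j @ [m] \<in> idx (ps @ [k])" "m # drop p j \<in> idx (k # qs)"
      using assms(1,2) by (auto simp: tensors_iff)
    moreover from this have "length (take p j) = length ps" by (auto dest!: length_idx)
    ultimately have "take p j @ drop p j \<in> idx (ps @ qs)" by (simp del: append_take_drop_id)
    then show False using j by simp
  qed
  then show "tt_prod p k A B j = 0" by (simp add: tt_prod_def)
qed

lemma sizes_Cons: "i \<le> d \<Longrightarrow> sizes n i d = n i # sizes n (Suc i) d"
  by (simp add: sizes_def upt_conv_Cons del: upt_Suc)

lemma sizes_snoc: "sizes n 1 (Suc m) = sizes n 1 m @ [n (Suc m)]"
  by (simp add: sizes_def)

lemma sizes_empty [simp]: "d < i \<Longrightarrow> sizes n i d = []"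
  by (simp add: sizes_def)

lemma length_sizes [simp]: "length (sizes n i d) = Suc d - i"
  by (simp add: sizes_def del: upt_Suc)

lemma sizes_append: "m \<le> d \<Longrightarrow> sizes n 1 d = sizes n 1 m @ sizes n (Suc m) d"
proof -
  assume "m \<le> d"
  then obtain l where "Suc d = Suc m + l" using le_Suc_ex by auto
  then show ?thesis
    using upt_add_eq_append[of 1 "Suc m" l] by (simp add: sizes_def del: upt_Suc)
qed

lemma tt_prods_tensors:
  assumes "2 \<le> d" "\<And>j. j \<in> {1..d - 1} \<Longrightarrow> C j \<in> tensors (front n k j @ [k j])"
    and "C d \<in> tensors [k (d - 1), n d]" "1 \<le> i" "i \<le> d"
  shows "tt_prods d k C i \<in> tensors ((if i = 1 then [] else [k (i - 1)]) @ sizes n i d)"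
  using \<open>i \<le> d\<close>
proof (induction rule: inc_induct)
  case base
  show ?case using assms by (simp add: tt_prods_last sizes_Cons)
next
  case (step j)
  then have j: "1 \<le> j" "j < d" using assms by auto
  have "tt_prod (if j = 1 then 1 else 2) (k j) (C j) (tt_prods d k C (Suc j)) \<in> tensors (front n k j @ sizes n (Suc j) d)"
    by (rule tt_prod_tensors) (use assms(2)[of j] step j in \<open>auto simp: front_def\<close>)
  moreover have "sizes n j d = n j # sizes n (Suc j) d" using j by (simp add: sizes_Cons)
  ultimately show ?case using j by (auto simp: tt_prods_step front_def)
qed

lemma hcat_tensors:
  assumes "A \<in> tensors (ps @ [k])" "B \<in> tensors (ps @ [l])"
  shows "hcat k A B \<in> tensors (ps @ [k + l])"
  unfolding tensors_iff
proof (intro allI impI)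
  fix j assume j: "j \<notin> idx (ps @ [k + l])"
  show "hcat k A B j = 0"
  proof (cases j rule: rev_cases)
    case Nil
    then show ?thesis by (simp add: hcat_def)
  next
    case (snoc a e)
    show ?thesis
    proof (cases "length a = length ps")
      case True
      then have "a @ [e] \<notin> idx (ps @ [k])" if "e < k" using that j snoc by simp
      moreover have "a @ [e - k] \<notin> idx (ps @ [l])" if "\<not> e < k" using that True j snoc by auto
      ultimately show ?thesis using assms snoc by (auto simp: hcat_def tensors_iff)
    next
      case False
      then have "a @ [e] \<notin> idx (ps @ [k])" "a @ [e - k] \<notin> idx (ps @ [l])" by (auto dest!: length_idx)
      then show ?thesis using assms snoc by (auto simp: hcat_def tensors_iff)
    qed
  qed
qed

lemma vcat_tensors:
  assumes "A \<in> tensors (k # qs)" "B \<in> tensors (l # qs)"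
  shows "vcat k A B \<in> tensors ((k + l) # qs)"
  unfolding tensors_iff
proof (intro allI impI)
  fix j assume j: "j \<notin> idx ((k + l) # qs)"
  show "vcat k A B j = 0"
  proof (cases j)
    case Nil
    then show ?thesis by (simp add: vcat_def)
  next
    case (Cons e a)
    then have "e # a \<notin> idx (k # qs)" if "e < k" using that j by auto
    moreover have "(e - k) # a \<notin> idx (l # qs)" if "\<not> e < k" using that j Cons by auto
    ultimately show ?thesis using assms Cons by (auto simp: vcat_def tensors_iff)
  qed
qed

lemma tensors_zero: "(\<lambda>_. 0) \<in> tensors ms"
  by (simp add: tensors_def)

lemma tensors_add: "A \<in> tensors ms \<Longrightarrow> B \<in> tensors ms \<Longrightarrow> (\<lambda>j. A j + B j) \<in> tensors ms"
  by (simp add: tensors_iff)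

lemma tensors_scale: "A \<in> tensors ms \<Longrightarrow> (\<lambda>j. c * A j) \<in> tensors ms"
  by (simp add: tensors_iff)

section \<open>Tangent vectors of bounded rank matrices\<close>

text \<open>Minimality of \<open>k\<close> means that the rows of \<open>T\<close> are independent.
  \<open>D\<close> is the Moore-Penrose right inverse: the second conclusion is symmetry of
  \<open>D T\<close>, which makes it the orthogonal projection onto the row space. With an
  orthonormal basis \<open>\<Phi>\<close> of the row space and its coefficients \<open>S\<close>, it
  is \<open>\<Phi>\<close> times the transpose of \<open>S\<close>.\<close>

lemma right_pseudoinverse:
  fixes T :: "nat \<Rightarrow> 'b \<Rightarrow> real"
  assumes "finite J" and minimal: "\<And>r. factors {..<k} J r T \<Longrightarrow> k \<le> r"
  obtains D where
    "\<And>c e. c < k \<Longrightarrow> e < k \<Longrightarrow> (\<Sum>b\<in>J. T c b * D b e) = (if c = e then 1 else 0)"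
    "\<And>b b'. b \<in> J \<Longrightarrow> b' \<in> J \<Longrightarrow> (\<Sum>c<k. D b c * T c b') = (\<Sum>c<k. D b' c * T c b)"
proof (rule orthonormal_factorization[of J "{..<k}" "\<lambda>b c. T c b"], goal_cases)
  case (3 k' \<Phi> S)
  note that = 3(1) and orth = 3(2) and span = 3(3) and repr = 3(4)
  define Y where "Y e c = (\<Sum>b\<in>J. \<Phi> b e * T c b)" for e c
  have "factors {..<k} J k' T"
    unfolding factors_def
  proof (intro exI ballI)
    fix c b assume "c \<in> {..<k}" "b \<in> J"
    then show "T c b = (\<Sum>e<k'. Y e c * \<Phi> b e)"
      using repr[of b c] by (simp add: Y_def mult.commute)
  qed
  then have "k \<le> k'" by (rule minimal)
  have YS: "(\<Sum>c<k. Y e c * S c e') = (if e = e' then 1 else 0)" if "e < k'" "e' < k'" for e e'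
  proof -
    have "(\<Sum>c<k. Y e c * S c e') = (\<Sum>c<k. \<Sum>b\<in>J. \<Phi> b e * T c b * S c e')"
      by (simp add: Y_def sum_distrib_right)
    also have "\<dots> = (\<Sum>b\<in>J. \<Sum>c<k. \<Phi> b e * T c b * S c e')" by (rule sum.swap)
    also have "\<dots> = (\<Sum>b\<in>J. \<Phi> b e * \<Phi> b e')"
      by (rule sum.cong) (simp_all add: span[OF _ that(2)] sum_distrib_left mult.assoc)
    finally show ?thesis using orth that by simp
  qed
  have "factors J {..<k} k (\<lambda>b c. T c b)"
    unfolding factors_def
  proof (intro exI ballI)
    fix b c assume "b \<in> J" "c \<in> {..<k}"
    then show "T c b = (\<Sum>e<k. T e b * (if e = c then 1 else 0))"
      by (simp add: if_distrib[of "(*) _"] cong: if_cong)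
  qed
  moreover have "(\<Sum>b\<in>J. \<Sum>c<k. \<Phi> b e * T c b * S c e') = (if e = e' then 1 else 0)" if "e < k'" "e' < k'" for e e'
    using YS[OF that] by (subst sum.swap) (simp add: Y_def sum_distrib_right)
  ultimately have "k' \<le> k"
    by (rule factors_lower_bound[where p = "\<lambda>e b. \<Phi> b e" and q = S])
  with \<open>k \<le> k'\<close> have kk: "k' = k" by simp
  \<comment> \<open>\<open>Y S = 1\<close> is known; since both matrices are square of size
    \<open>k' = k\<close>, also \<open>S Y = 1\<close>.\<close>
  define MY where "MY = mat k k (\<lambda>(e, c). Y e c)"
  define MS where "MS = mat k k (\<lambda>(c, e). S c e)"
  have carr: "MY \<in> carrier_mat k k" "MS \<in> carrier_mat k k" by (auto simp: MY_def MS_def)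
  have "MY * MS = 1\<^sub>m k"
    by (rule eq_matI) (auto simp: MY_def MS_def scalar_prod_def atLeast0LessThan YS kk)
  then have SY': "MS * MY = 1\<^sub>m k" by (rule mat_mult_left_right_inverse[OF carr])
  have SY: "(\<Sum>e<k. S c e * Y e c') = (if c = c' then 1 else 0)" if "c < k" "c' < k" for c c'
  proof -
    have "(\<Sum>e<k. S c e * Y e c') = (MS * MY) $$ (c, c')"
      using that by (simp add: MY_def MS_def scalar_prod_def atLeast0LessThan)
    then show ?thesis using that by (simp add: SY')
  qed
  show ?case
  proof (rule that[of "\<lambda>b e. \<Sum>l<k. \<Phi> b l * S e l"])
    fix c e assume ce: "c < k" "e < k"
    have "(\<Sum>b\<in>J. T c b * (\<Sum>l<k. \<Phi> b l * S e l)) = (\<Sum>b\<in>J. \<Sum>l<k. S e l * (\<Phi> b l * T c b))"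
      by (simp add: sum_distrib_left mult_ac)
    also have "\<dots> = (\<Sum>l<k. \<Sum>b\<in>J. S e l * (\<Phi> b l * T c b))" by (rule sum.swap)
    also have "\<dots> = (\<Sum>l<k. S e l * Y l c)" by (simp add: Y_def sum_distrib_left)
    finally show "(\<Sum>b\<in>J. T c b * (\<Sum>l<k. \<Phi> b l * S e l)) = (if c = e then 1 else 0)"
      using SY ce by auto
  next
    have "(\<Sum>c<k. (\<Sum>l<k. \<Phi> b l * S c l) * T c b') = (\<Sum>l<k. \<Phi> b l * \<Phi> b' l)" if "b' \<in> J" for b b'
    proof -
      have "(\<Sum>c<k. (\<Sum>l<k. \<Phi> b l * S c l) * T c b') = (\<Sum>c<k. \<Sum>l<k. \<Phi> b l * (T c b' * S c l))"
        by (simp add: sum_distrib_right sum_distrib_left mult_ac)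
      also have "\<dots> = (\<Sum>l<k. \<Sum>c<k. \<Phi> b l * (T c b' * S c l))" by (rule sum.swap)
      also have "\<dots> = (\<Sum>l<k. \<Phi> b l * \<Phi> b' l)"
        by (rule sum.cong) (use span[OF that] kk in \<open>simp_all add: sum_distrib_left\<close>)
      finally show ?thesis .
    qed
    then show "(\<Sum>c<k. (\<Sum>l<k. \<Phi> b l * S c l) * T c b') = (\<Sum>c<k. (\<Sum>l<k. \<Phi> b' l * S c l) * T c b)"
      if "b \<in> J" "b' \<in> J" for b b'
      using that by (simp add: mult.commute)
  qed
qed (use assms in auto)

lemma tendsto_det:
  assumes "\<And>i j. i < N \<Longrightarrow> j < N \<Longrightarrow> ((\<lambda>m. F m i j) \<longlongrightarrow> L i j) net"
  shows "((\<lambda>m. det (mat N N (\<lambda>(i, j). F m i j :: real))) \<longlongrightarrow> det (mat N N (\<lambda>(i, j). L i j))) net"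
proof -
  have det: "det (mat N N (\<lambda>(i, j). H i j)) = (\<Sum>p\<in>{p. p permutes {0..<N}}. signof p * (\<Prod>i = 0..<N. H i (p i)))"
    for H :: "nat \<Rightarrow> nat \<Rightarrow> real"
  proof -
    have "(\<Prod>i = 0..<N. mat N N (\<lambda>(i, j). H i j) $$ (i, p i)) = (\<Prod>i = 0..<N. H i (p i))"
      if "p permutes {0..<N}" for p
    proof (rule prod.cong[OF refl])
      fix i assume "i \<in> {0..<N}"
      then have "i < N" "p i < N" using permutes_in_image[OF that, of i] by simp_all
      then show "mat N N (\<lambda>(i, j). H i j) $$ (i, p i) = H i (p i)" by simp
    qed
    then show ?thesis by (subst det_def'[where n = N]) (auto intro!: sum.cong)
  qed
  show ?thesis unfolding det
  proof (intro tendsto_sum tendsto_mult tendsto_const tendsto_prod)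
    fix p i assume "p \<in> {p. p permutes {0..<N}}" "i \<in> {0..<N}"
    then have "i < N" "p i < N" using permutes_in_image[of p "{0..<N}" i] by simp_all
    then show "((\<lambda>m. F m i (p i)) \<longlongrightarrow> L i (p i)) net" by (rule assms)
  qed
qed

lemma det_unit_lower_triangular:
  assumes "\<And>i j. i < j \<Longrightarrow> j < N \<Longrightarrow> L i j = 0" "\<And>i. i < N \<Longrightarrow> L i i = 1"
  shows "det (mat N N (\<lambda>(i, j). L i j :: real)) = 1"
proof -
  have "det (mat N N (\<lambda>(i, j). L i j)) = prod_list (diag_mat (mat N N (\<lambda>(i, j). L i j)))"
    by (rule det_lower_triangular[where n = N]) (use assms in auto)
  also have "diag_mat (mat N N (\<lambda>(i, j). L i j)) = replicate N 1"
    by (rule nth_equalityI) (auto simp: diag_mat_def assms)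
  finally show ?thesis by simp
qed

text \<open>An invertible \<open>k\<close> by \<open>k\<close> compression of \<open>A\<close> is
  bordered by \<rho> rows \<open>u\<close> and \<rho> columns \<open>v\<close> that annihilate
  \<open>A\<close>, and the rows \<open>u\<close> are multiplied by \<open>a m\<close>. Since
  \<open>u A = 0\<close>, these rows see only \<open>a m * (x m - A)\<close> and tend to
  \<open>u \<xi>\<close>; since \<open>A v = 0\<close>, the limit is block lower triangular with
  identity blocks on the diagonal. For \<open>k + \<rho> > r\<close> all these minors of
  \<open>x m\<close> vanish, while their limit is one.\<close>

lemma tangent_rank_bound:
  fixes x :: "nat \<Rightarrow> 'a \<Rightarrow> 'b \<Rightarrow> real" and A \<xi> :: "'a \<Rightarrow> 'b \<Rightarrow> real"
  assumes fin: "finite I" "finite J"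
    and rank: "\<And>m. factors I J r (x m)"
    and lim: "\<And>i j. i \<in> I \<Longrightarrow> j \<in> J \<Longrightarrow> (\<lambda>m. x m i j) \<longlonglongrightarrow> A i j"
    and lim': "\<And>i j. i \<in> I \<Longrightarrow> j \<in> J \<Longrightarrow> (\<lambda>m. a m * (x m i j - A i j)) \<longlonglongrightarrow> \<xi> i j"
    and pAq: "\<And>c e. c < k \<Longrightarrow> e < k \<Longrightarrow> (\<Sum>i\<in>I. \<Sum>j\<in>J. p c i * A i j * q j e) = (if c = e then 1 else 0)"
    and uA: "\<And>c j. c < \<rho> \<Longrightarrow> j \<in> J \<Longrightarrow> (\<Sum>i\<in>I. u c i * A i j) = 0"
    and Av: "\<And>i c. i \<in> I \<Longrightarrow> c < \<rho> \<Longrightarrow> (\<Sum>j\<in>J. A i j * v j c) = 0"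
    and u\<xi>v: "\<And>c e. c < \<rho> \<Longrightarrow> e < \<rho> \<Longrightarrow> (\<Sum>i\<in>I. \<Sum>j\<in>J. u c i * \<xi> i j * v j e) = (if c = e then 1 else 0)"
  shows "k + \<rho> \<le> r"
proof (rule ccontr)
  assume "\<not> k + \<rho> \<le> r"
  define z where "z j e = (if e < k then q j e else v j (e - k))" for j e
  define F where "F m c e = (\<Sum>i\<in>I. \<Sum>j\<in>J. (if c < k then p c i else a m * u (c - k) i) * x m i j * z j e)" for m c e
  define L where "L c e = (if c < k then (\<Sum>i\<in>I. \<Sum>j\<in>J. p c i * A i j * z j e)
      else (\<Sum>i\<in>I. \<Sum>j\<in>J. u (c - k) i * \<xi> i j * z j e))" for c e
  have "factors {..<k + \<rho>} {..<k + \<rho>} r (F m)" for m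
    unfolding F_def by (rule factors_sandwich[OF rank])
  then have "det (mat (k + \<rho>) (k + \<rho>) (\<lambda>(i, j). F m i j)) = 0" for m
    using \<open>\<not> k + \<rho> \<le> r\<close> by (intro det_factors) auto
  moreover have "(\<lambda>m. det (mat (k + \<rho>) (k + \<rho>) (\<lambda>(i, j). F m i j))) \<longlonglongrightarrow> det (mat (k + \<rho>) (k + \<rho>) (\<lambda>(i, j). L i j))"
  proof (rule tendsto_det)
    fix c e assume ce: "c < k + \<rho>" "e < k + \<rho>"
    show "(\<lambda>m. F m c e) \<longlonglongrightarrow> L c e"
    proof (cases "c < k")
      case True
      then show ?thesis unfolding F_def L_def by (simp add: tendsto_intros lim tendsto_sum)
    next
      case False
      have "F m c e = (\<Sum>i\<in>I. \<Sum>j\<in>J. u (c - k) i * (a m * (x m i j - A i j)) * z j e)" for m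
      proof -
        have "(\<Sum>i\<in>I. \<Sum>j\<in>J. u (c - k) i * A i j * z j e) = (\<Sum>j\<in>J. (\<Sum>i\<in>I. u (c - k) i * A i j) * z j e)"
          by (subst sum.swap) (simp add: sum_distrib_right)
        also have "\<dots> = 0" using False ce uA by (simp add: less_diff_conv2)
        finally have "a m * (\<Sum>i\<in>I. \<Sum>j\<in>J. u (c - k) i * A i j * z j e) = 0" by simp
        then show ?thesis using False
          by (simp add: F_def algebra_simps sum_subtractf sum_distrib_left)
      qed
      then show ?thesis unfolding L_def using False by (simp add: tendsto_intros lim' tendsto_sum)
    qed
  qed
  moreover have "det (mat (k + \<rho>) (k + \<rho>) (\<lambda>(i, j). L i j)) = 1"
  proof (rule det_unit_lower_triangular)
    fix c assume "c < k + \<rho>"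
    then show "L c c = 1" using pAq[of c c] u\<xi>v[of "c - k" "c - k"] by (auto simp: L_def z_def)
  next
    fix c e assume ce: "c < e" "e < k + \<rho>"
    consider "e < k" | "c < k" "k \<le> e" | "k \<le> c" "k \<le> e" using ce by linarith
    then show "L c e = 0"
    proof cases
      case 1 then show ?thesis using ce pAq[of c e] by (simp add: L_def z_def)
    next
      case 2
      then have "(\<Sum>i\<in>I. \<Sum>j\<in>J. p c i * A i j * z j e) = (\<Sum>i\<in>I. p c i * (\<Sum>j\<in>J. A i j * v j (e - k)))"
        by (simp add: z_def sum_distrib_left mult.assoc)
      also have "\<dots> = 0" using 2 ce Av by simp
      finally show ?thesis using 2 by (simp add: L_def)
    next
      case 3 then show ?thesis using ce u\<xi>v[of "c - k" "e - k"] by (simp add: L_def z_def)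
    qed
  qed
  ultimately show False by (simp add: LIMSEQ_const_iff)
qed

section \<open>Orthogonality relations of a parametrization\<close>

lemma sum_vec_mat_vec:
  fixes \<mu> :: "'a \<Rightarrow> real"
  shows "(\<Sum>\<alpha>\<in>I. \<mu> \<alpha> * (\<Sum>\<beta>\<in>J. M \<alpha> \<beta> * t \<beta>)) = (\<Sum>\<beta>\<in>J. (\<Sum>\<alpha>\<in>I. \<mu> \<alpha> * M \<alpha> \<beta>) * t \<beta>)"
  unfolding sum_distrib_left sum_distrib_right by (subst sum.swap) (simp add: mult.assoc)

text \<open>Used to pass minimality down: a smaller inner size for the tail would give a smaller one
  for the whole unfolding.\<close>

lemma factors_mult_left:
  assumes "factors {..<k} J r T" "\<And>a b. a \<in> I \<Longrightarrow> b \<in> J \<Longrightarrow> M a b = (\<Sum>c<k. \<Phi> a c * T c b)"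
  shows "factors I J r M"
proof -
  obtain L R where LR: "\<And>c b. c < k \<Longrightarrow> b \<in> J \<Longrightarrow> T c b = (\<Sum>e<r. L c e * R e b)"
    using assms(1) unfolding factors_def by auto
  have "M a b = (\<Sum>e<r. (\<Sum>c<k. \<Phi> a c * L c e) * R e b)" if "a \<in> I" "b \<in> J" for a b
  proof -
    have "M a b = (\<Sum>c<k. \<Phi> a c * (\<Sum>e<r. L c e * R e b))" using assms(2) LR that by simp
    then show ?thesis by (simp only: sum_vec_mat_vec)
  qed
  then show ?thesis unfolding factors_def by (intro exI ballI)
qed

lemma sum_left_snoc:
  "(\<Sum>a\<in>idx (sizes n 1 (Suc m)). f a) = (\<Sum>a\<in>idx (sizes n 1 m). \<Sum>x<n (Suc m). f (a @ [x]))"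
  unfolding sizes_snoc sum_idx_append sum_idx_Cons by simp

lemma sum_right_Cons:
  "i \<le> d \<Longrightarrow> (\<Sum>b\<in>idx (sizes n i d). f b) = (\<Sum>x<n i. \<Sum>b\<in>idx (sizes n (Suc i) d). f (x # b))"
  by (simp only: sizes_Cons sum_idx_Cons)

text \<open>Contracting a head with the full tensor peels off one core at a time. \<open>F\<close>
  is any family with the one-step property, because both the tails of \<open>A\<close> and those of
  \<open>\<X>\<close> have it.\<close>

lemma head_contract:
  assumes "K 0 = 1"
    and step: "\<And>i c b. i \<in> {1..<d} \<Longrightarrow> c < K i \<Longrightarrow>
      (\<Sum>\<alpha><K (i - 1). \<Sum>x<n i. A i \<alpha> x c * F (x # b) i \<alpha>) = F b (Suc i) c"
    and "m < d" "c < K m"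
  shows "(\<Sum>a\<in>idx (sizes n 1 m). head K A a c * F (a @ b) 1 0) = (F b (Suc m) c :: real)"
  using assms(3,4)
proof (induction m arbitrary: b c)
  case 0
  then show ?case using assms(1) by simp
next
  case (Suc m)
  have "(\<Sum>a\<in>idx (sizes n 1 (Suc m)). head K A a c * F (a @ b) 1 0)
     = (\<Sum>a\<in>idx (sizes n 1 m). \<Sum>x<n (Suc m). \<Sum>\<beta><K m. A (Suc m) \<beta> x c * (head K A a \<beta> * F (a @ x # b) 1 0))"
    unfolding sum_left_snoc
    by (intro sum.cong refl) (auto dest!: length_idx simp: sum_distrib_left sum_distrib_right mult_ac)
  also have "\<dots> = (\<Sum>a\<in>idx (sizes n 1 m). \<Sum>\<beta><K m. \<Sum>x<n (Suc m). A (Suc m) \<beta> x c * (head K A a \<beta> * F (a @ x # b) 1 0))"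
    by (intro sum.cong refl sum.swap)
  also have "\<dots> = (\<Sum>\<beta><K m. \<Sum>a\<in>idx (sizes n 1 m). \<Sum>x<n (Suc m). A (Suc m) \<beta> x c * (head K A a \<beta> * F (a @ x # b) 1 0))"
    by (rule sum.swap)
  also have "\<dots> = (\<Sum>\<beta><K m. \<Sum>x<n (Suc m). \<Sum>a\<in>idx (sizes n 1 m). A (Suc m) \<beta> x c * (head K A a \<beta> * F (a @ x # b) 1 0))"
    by (intro sum.cong refl sum.swap)
  also have "\<dots> = (\<Sum>\<beta><K m. \<Sum>x<n (Suc m). A (Suc m) \<beta> x c * F (x # b) (Suc m) \<beta>)"
    using Suc by (simp add: sum_distrib_left[symmetric])
  also have "\<dots> = F b (Suc (Suc m)) c"
    using step[of "Suc m" c b] Suc.prems by simp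
  finally show ?case .
qed

lemma sum2_contract:
  assumes "\<And>\<beta>. \<beta> \<in> J \<Longrightarrow> (\<Sum>\<alpha>\<in>I. \<Sum>x\<in>N. P \<alpha> x * Q \<alpha> x \<beta>) = (g \<beta> :: real)"
  shows "(\<Sum>\<alpha>\<in>I. \<Sum>x\<in>N. P \<alpha> x * (\<Sum>\<beta>\<in>J. Q \<alpha> x \<beta> * t \<beta>)) = (\<Sum>\<beta>\<in>J. g \<beta> * t \<beta>)"
proof -
  have "(\<Sum>\<alpha>\<in>I. \<Sum>x\<in>N. P \<alpha> x * (\<Sum>\<beta>\<in>J. Q \<alpha> x \<beta> * t \<beta>))
      = (\<Sum>\<alpha>\<in>I. \<Sum>\<beta>\<in>J. \<Sum>x\<in>N. P \<alpha> x * Q \<alpha> x \<beta> * t \<beta>)"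
    by (simp add: sum_vec_mat_vec sum_distrib_right)
  also have "\<dots> = (\<Sum>\<beta>\<in>J. \<Sum>\<alpha>\<in>I. \<Sum>x\<in>N. P \<alpha> x * Q \<alpha> x \<beta> * t \<beta>)" by (rule sum.swap)
  finally show ?thesis using assms by (simp add: sum_distrib_right[symmetric])
qed

lemma sum_delta_mult:
  fixes t :: "nat \<Rightarrow> real"
  assumes "c < k"
  shows "(\<Sum>\<beta><k. (if c = \<beta> then 1 else 0) * t \<beta>) = t c"
proof -
  have "(\<Sum>\<beta><k. (if c = \<beta> then 1 else 0) * t \<beta>) = (\<Sum>\<beta><k. if \<beta> = c then t \<beta> else 0)"
    by (rule sum.cong) auto
  then show ?thesis using assms by simp
qed

text \<open>The orthogonality relations in terms of entries, for bonds already extended to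
  \<open>0\<close> and \<open>d\<close>. In \<open>orthV\<close> the first index of the tail is
  summed separately, which is the form met when the position is increased by one.\<close>

locale tt_param =
  fixes d :: nat and n K S :: "nat \<Rightarrow> nat" and A U X Z V :: "nat \<Rightarrow> nat \<Rightarrow> nat \<Rightarrow> nat \<Rightarrow> real"
  assumes d2: "2 \<le> d" and K0: "K 0 = 1" and Kd: "K d = 1" and Sd: "S d = 0"
    and orthA: "\<And>i e e'. i \<in> {1..<d} \<Longrightarrow> e < K i \<Longrightarrow> e' < K i \<Longrightarrow>
      (\<Sum>\<alpha><K (i - 1). \<Sum>x<n i. A i \<alpha> x e * A i \<alpha> x e') = (if e = e' then 1 else 0)"
    and orthU: "\<And>i e \<tau>. i \<in> {1..<d} \<Longrightarrow> e < K i \<Longrightarrow> \<tau> < S i \<Longrightarrow>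
      (\<Sum>\<alpha><K (i - 1). \<Sum>x<n i. A i \<alpha> x e * U i \<alpha> x \<tau>) = 0"
    and orthX: "\<And>i e e'. i \<in> {1..<d} \<Longrightarrow> e < K i \<Longrightarrow> e' < K i \<Longrightarrow>
      (\<Sum>\<alpha><K (i - 1). \<Sum>x<n i. A i \<alpha> x e * X i \<alpha> x e') = 0"
    and orthV: "\<And>i \<sigma> e. i \<in> {2..d} \<Longrightarrow> \<sigma> < S (i - 1) \<Longrightarrow> e < K (i - 1) \<Longrightarrow>
      (\<Sum>x<n i. \<Sum>b\<in>idx (sizes n (Suc i) d).
        (\<Sum>\<beta><K i. V i \<sigma> x \<beta> * train K A b (Suc i) \<beta>) * train K A (x # b) i e) = 0"
begin

abbreviation "LI m \<equiv> idx (sizes n 1 m)"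
abbreviation "RI m \<equiv> idx (sizes n (Suc m) d)"
abbreviation "tn \<equiv> train K A"
abbreviation "ex \<equiv> excursion K S A Z V"
abbreviation "tg \<equiv> tangent K S A U X Z V"
abbreviation "rt \<equiv> retract K S A U X Z V"
abbreviation "hh \<equiv> head K A"

lemma train_step:
  assumes "i \<in> {1..<d}" "c < K i"
  shows "(\<Sum>\<alpha><K (i - 1). \<Sum>x<n i. A i \<alpha> x c * tn (x # b) i \<alpha>) = tn b (Suc i) c"
proof -
  have "(\<Sum>\<alpha><K (i - 1). \<Sum>x<n i. A i \<alpha> x c * tn (x # b) i \<alpha>)
     = (\<Sum>\<beta><K i. (if c = \<beta> then 1 else 0) * tn b (Suc i) \<beta>)"
    unfolding train.simps by (rule sum2_contract) (use orthA assms in auto)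
  then show ?thesis using assms(2) by (simp add: sum_delta_mult)
qed

text \<open>Left orthogonality of \<open>A\<close> reproduces the part through \<open>A\<close>; the
  conditions on \<open>U\<close> and \<open>X\<close> remove the other two parts.\<close>

lemma tangent_step:
  assumes "i \<in> {1..<d}" "c < K i"
  shows "(\<Sum>\<alpha><K (i - 1). \<Sum>x<n i. A i \<alpha> x c * tg (x # b) i \<alpha>) = tg b (Suc i) c"
proof -
  have "(\<Sum>\<alpha><K (i - 1). \<Sum>x<n i. A i \<alpha> x c * (\<Sum>\<beta><K i. A i \<alpha> x \<beta> * tg b (Suc i) \<beta>))
     = (\<Sum>\<beta><K i. (if c = \<beta> then 1 else 0) * tg b (Suc i) \<beta>)"
    by (rule sum2_contract) (use orthA assms in auto)
  also have "\<dots> = tg b (Suc i) c" using assms(2) by (simp add: sum_delta_mult)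
  moreover have "(\<Sum>\<alpha><K (i - 1). \<Sum>x<n i. A i \<alpha> x c * (\<Sum>\<tau><S i. U i \<alpha> x \<tau> * ex b (Suc i) \<tau>))
     = (\<Sum>\<tau><S i. 0 * ex b (Suc i) \<tau>)"
    by (rule sum2_contract) (use orthU assms in auto)
  moreover have "(\<Sum>\<alpha><K (i - 1). \<Sum>x<n i. A i \<alpha> x c * (\<Sum>\<beta><K i. X i \<alpha> x \<beta> * tn b (Suc i) \<beta>))
     = (\<Sum>\<beta><K i. 0 * tn b (Suc i) \<beta>)"
    by (rule sum2_contract) (use orthX assms in auto)
  ultimately show ?thesis by (simp add: distrib_left sum.distrib)
qed

lemma head_train: "m < d \<Longrightarrow> c < K m \<Longrightarrow> (\<Sum>a\<in>LI m. hh a c * tn (a @ b) 1 0) = tn b (Suc m) c"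
  by (rule head_contract[where F = tn]) (use K0 train_step in auto)

lemma head_tangent: "m < d \<Longrightarrow> c < K m \<Longrightarrow> (\<Sum>a\<in>LI m. hh a c * tg (a @ b) 1 0) = tg b (Suc m) c"
  by (rule head_contract[where F = tg]) (use K0 tangent_step in auto)

lemma train_split:
  assumes "a \<in> LI m"
  shows "tn (a @ b) 1 0 = (\<Sum>c<K m. hh a c * tn b (Suc m) c)"
  using train_append[of K A a b] K0 length_idx[OF assms] by simp

text \<open>The condition \<open>orthV\<close> covers only what leaves the excursion through
  \<open>V i\<close>. The part through \<open>Z i\<close> reduces to later positions: a tail of
  \<open>A\<close> with its first index fixed is a combination of the tails one position further
  on.\<close>

lemma excursion_orth:
  assumes "2 \<le> i" "i \<le> Suc d" "\<sigma> < S (i - 1)" "e < K (i - 1)"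
  shows "(\<Sum>b\<in>idx (sizes n i d). ex b i \<sigma> * tn b i e) = 0"
  using assms(2,1,3,4)
proof (induction i arbitrary: \<sigma> e rule: inc_induct)
  case base
  then show ?case using Sd by simp
next
  case (step i)
  have i: "i \<le> d" using step by simp
  have IH: "(\<Sum>b\<in>RI i. ex b (Suc i) \<tau> * tn b (Suc i) \<beta>) = 0" if "\<tau> < S i" "\<beta> < K i" for \<tau> \<beta>
    using step that by simp
  have "(\<Sum>b\<in>idx (sizes n i d). ex b i \<sigma> * tn b i e)
     = (\<Sum>x<n i. \<Sum>b\<in>RI i. (\<Sum>\<beta><K i. V i \<sigma> x \<beta> * tn b (Suc i) \<beta>) * tn (x # b) i e)
     + (\<Sum>x<n i. \<Sum>b\<in>RI i. (\<Sum>\<tau><S i. Z i \<sigma> x \<tau> * ex b (Suc i) \<tau>) * tn (x # b) i e)"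
    unfolding sum_right_Cons[OF i] excursion.simps distrib_right sum.distrib ..
  also have "(\<Sum>x<n i. \<Sum>b\<in>RI i. (\<Sum>\<beta><K i. V i \<sigma> x \<beta> * tn b (Suc i) \<beta>) * tn (x # b) i e) = 0"
    by (rule orthV) (use step in auto)
  also have "(\<Sum>x<n i. \<Sum>b\<in>RI i. (\<Sum>\<tau><S i. Z i \<sigma> x \<tau> * ex b (Suc i) \<tau>) * tn (x # b) i e)
     = (\<Sum>x<n i. \<Sum>\<tau><S i. \<Sum>\<beta><K i. Z i \<sigma> x \<tau> * A i e x \<beta> *
         (\<Sum>b\<in>RI i. ex b (Suc i) \<tau> * tn b (Suc i) \<beta>))"
  proof (rule sum.cong[OF refl])
    fix x
    have "(\<Sum>b\<in>RI i. (\<Sum>\<tau><S i. Z i \<sigma> x \<tau> * ex b (Suc i) \<tau>) * tn (x # b) i e)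
      = (\<Sum>b\<in>RI i. \<Sum>\<tau><S i. \<Sum>\<beta><K i. Z i \<sigma> x \<tau> * A i e x \<beta> * (ex b (Suc i) \<tau> * tn b (Suc i) \<beta>))"
      by (simp only: train.simps sum_product) (simp add: mult_ac)
    also have "\<dots> = (\<Sum>\<tau><S i. \<Sum>b\<in>RI i. \<Sum>\<beta><K i. Z i \<sigma> x \<tau> * A i e x \<beta> * (ex b (Suc i) \<tau> * tn b (Suc i) \<beta>))"
      by (rule sum.swap)
    also have "\<dots> = (\<Sum>\<tau><S i. \<Sum>\<beta><K i. \<Sum>b\<in>RI i. Z i \<sigma> x \<tau> * A i e x \<beta> * (ex b (Suc i) \<tau> * tn b (Suc i) \<beta>))"
      by (intro sum.cong refl sum.swap)
    finally show "(\<Sum>b\<in>RI i. (\<Sum>\<tau><S i. Z i \<sigma> x \<tau> * ex b (Suc i) \<tau>) * tn (x # b) i e)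
      = (\<Sum>\<tau><S i. \<Sum>\<beta><K i. Z i \<sigma> x \<tau> * A i e x \<beta> *
         (\<Sum>b\<in>RI i. ex b (Suc i) \<tau> * tn b (Suc i) \<beta>))"
      by (simp add: sum_distrib_left)
  qed
  also have "\<dots> = 0" using IH by simp
  finally show ?case by simp
qed

lemma train_pseudoinverse:
  assumes "m \<in> {1..<d}"
    and "\<And>r. factors (LI m) (RI m) r (\<lambda>a b. tn (a @ b) 1 0) \<Longrightarrow> K m \<le> r"
  obtains D where
    "\<And>c e. c < K m \<Longrightarrow> e < K m \<Longrightarrow> (\<Sum>b\<in>RI m. tn b (Suc m) c * D b e) = (if c = e then 1 else 0)"
proof -
  have minimal: "K m \<le> r" if "factors {..<K m} (RI m) r (\<lambda>c b. tn b (Suc m) c)" for r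
    by (rule assms(2), rule factors_mult_left[OF that train_split])
  show ?thesis
    by (rule right_pseudoinverse[OF finite_idx minimal], assumption, rule that)
qed

text \<open>The heads are the unfolding times \<open>D\<close>, hence lie in its column space.
  Through this, statements about the full tensor reach the heads.\<close>

lemma head_via_pseudoinverse:
  assumes "\<And>c e. c < K m \<Longrightarrow> e < K m \<Longrightarrow> (\<Sum>b\<in>RI m. tn b (Suc m) c * D b e) = (if c = e then 1 else 0)"
    and "a \<in> LI m" "e < K m"
  shows "(\<Sum>b\<in>RI m. tn (a @ b) 1 0 * D b e) = hh a e"
proof -
  have "(\<Sum>b\<in>RI m. tn (a @ b) 1 0 * D b e)
     = (\<Sum>b\<in>RI m. D b e * (\<Sum>c<K m. tn b (Suc m) c * hh a c))"
    by (simp only: train_split[OF assms(2)] mult.commute)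
  also have "\<dots> = (\<Sum>c<K m. (\<Sum>b\<in>RI m. D b e * tn b (Suc m) c) * hh a c)"
    by (rule sum_vec_mat_vec)
  also have "\<dots> = (\<Sum>c<K m. if c = e then hh a c else 0)"
    by (rule sum.cong) (use assms(1,3) in \<open>simp_all add: mult.commute\<close>)
  finally show ?thesis using assms(3) by simp
qed

end

section \<open>Independence of the parametrization\<close>

text \<open>Two parametrizations with the same values. Minimality is stated for one of them and is
  transferred by \<open>minimal'\<close>, as the full tensors agree.\<close>

locale tt_param_pair =
  P: tt_param d n K S A U X Z V + P': tt_param d n K S A' U' X' Z' V'
  for d n K S A U X Z V A' U' X' Z' V' +
  assumes train_eq: "\<And>j. j \<in> idx (sizes n 1 d) \<Longrightarrow> P.tn j 1 0 = P'.tn j 1 0"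
    and tangent_eq: "\<And>j. j \<in> idx (sizes n 1 d) \<Longrightarrow> P.tg j 1 0 = P'.tg j 1 0"
    and minimal: "\<And>m r. m \<in> {1..<d} \<Longrightarrow>
      factors (idx (sizes n 1 m)) (idx (sizes n (Suc m) d)) r (\<lambda>a b. P.tn (a @ b) 1 0) \<Longrightarrow> K m \<le> r"
begin

lemma append_in_full:
  assumes "a \<in> P.LI m" "b \<in> P.RI m" "m \<le> d"
  shows "a @ b \<in> idx (sizes n 1 d)"
  unfolding sizes_append[OF assms(3)] using assms length_idx[OF assms(1)] by simp

lemma minimal':
  assumes "m \<in> {1..<d}"
    and "factors (P.LI m) (P.RI m) r (\<lambda>a b. P'.tn (a @ b) 1 0)"
  shows "K m \<le> r"
proof (rule minimal[OF assms(1)])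
  show "factors (P.LI m) (P.RI m) r (\<lambda>a b. P.tn (a @ b) 1 0)"
    using assms append_in_full train_eq
    by (subst factors_cong[where N = "\<lambda>a b. P'.tn (a @ b) 1 0"]) auto
qed

lemma head_train':
  assumes "m < d" "c < K m" "b \<in> P.RI m"
  shows "(\<Sum>a\<in>P.LI m. P'.hh a c * P.tn (a @ b) 1 0) = P'.tn b (Suc m) c"
  using P'.head_train[OF assms(1,2)] append_in_full assms train_eq by simp

lemma head_tangent':
  assumes "m < d" "c < K m" "b \<in> P.RI m"
  shows "(\<Sum>a\<in>P.LI m. P'.hh a c * P.tg (a @ b) 1 0) = P'.tg b (Suc m) c"
  using P'.head_tangent[OF assms(1,2)] append_in_full assms tangent_eq by simp

text \<open>The combination of the heads lies in the column space of the unfolding, on which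
  contracting with the tensor is injective.\<close>

lemma heads_eq:
  assumes m: "m \<in> {1..<d}"
    and eq: "\<And>b. b \<in> P.RI m \<Longrightarrow>
      (\<Sum>c<K m. \<mu> c * P.tn b (Suc m) c) = (\<Sum>c<K m. \<mu>' c * P'.tn b (Suc m) c)"
    and a: "a \<in> P.LI m"
  shows "(\<Sum>c<K m. \<mu> c * P.hh a c) = (\<Sum>c<K m. \<mu>' c * P'.hh a c)"
proof -
  define \<nu> where "\<nu> a = (\<Sum>c<K m. \<mu> c * P.hh a c) - (\<Sum>c<K m. \<mu>' c * P'.hh a c)" for a
  have \<nu>0: "(\<Sum>a\<in>P.LI m. \<nu> a * P.tn (a @ b) 1 0) = 0" if b: "b \<in> P.RI m" for b
  proof -
    have "(\<Sum>a\<in>P.LI m. (\<Sum>c<K m. \<mu> c * P.hh a c) * P.tn (a @ b) 1 0)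
        = (\<Sum>c<K m. \<mu> c * (\<Sum>a\<in>P.LI m. P.hh a c * P.tn (a @ b) 1 0))"
      by (rule sum_vec_mat_vec[symmetric])
    moreover have "(\<Sum>a\<in>P.LI m. (\<Sum>c<K m. \<mu>' c * P'.hh a c) * P.tn (a @ b) 1 0)
        = (\<Sum>c<K m. \<mu>' c * (\<Sum>a\<in>P.LI m. P'.hh a c * P.tn (a @ b) 1 0))"
      by (rule sum_vec_mat_vec[symmetric])
    ultimately show ?thesis
      using m b eq[OF b] P.head_train[of m _ b] head_train'[of m _ b]
      by (simp add: \<nu>_def left_diff_distrib sum_subtractf)
  qed
  obtain D where D: "\<And>c e. c < K m \<Longrightarrow> e < K m \<Longrightarrow>
      (\<Sum>b\<in>P.RI m. P.tn b (Suc m) c * D b e) = (if c = e then 1 else 0)"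
    by (rule P.train_pseudoinverse[OF m minimal[OF m]], assumption, rule that)
  obtain D' where D': "\<And>c e. c < K m \<Longrightarrow> e < K m \<Longrightarrow>
      (\<Sum>b\<in>P.RI m. P'.tn b (Suc m) c * D' b e) = (if c = e then 1 else 0)"
    by (rule P'.train_pseudoinverse[OF m minimal'[OF m]], assumption, rule that)
  \<comment> \<open>A head is the unfolding times \<open>D\<close>, so \<open>\<nu>\<close>, which
    the unfolding annihilates, is orthogonal to it.\<close>
  have hh: "(\<Sum>a\<in>P.LI m. \<nu> a * P.hh a e) = 0" if "e < K m" for e
  proof -
    have "(\<Sum>a\<in>P.LI m. \<nu> a * P.hh a e)
       = (\<Sum>a\<in>P.LI m. \<nu> a * (\<Sum>b\<in>P.RI m. P.tn (a @ b) 1 0 * D b e))"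
      using P.head_via_pseudoinverse[OF D _ that] by (intro sum.cong refl) simp
    also have "\<dots> = (\<Sum>b\<in>P.RI m. (\<Sum>a\<in>P.LI m. \<nu> a * P.tn (a @ b) 1 0) * D b e)"
      by (rule sum_vec_mat_vec)
    finally show ?thesis using \<nu>0 by simp
  qed
  have hh': "(\<Sum>a\<in>P.LI m. \<nu> a * P'.hh a e) = 0" if "e < K m" for e
  proof -
    have "(\<Sum>a\<in>P.LI m. \<nu> a * P'.hh a e)
       = (\<Sum>a\<in>P.LI m. \<nu> a * (\<Sum>b\<in>P.RI m. P.tn (a @ b) 1 0 * D' b e))"
    proof (intro sum.cong refl)
      fix a assume a: "a \<in> P.LI m"
      have "(\<Sum>b\<in>P.RI m. P.tn (a @ b) 1 0 * D' b e)
         = (\<Sum>b\<in>P.RI m. P'.tn (a @ b) 1 0 * D' b e)"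
        using append_in_full[OF a] m train_eq by simp
      also have "\<dots> = P'.hh a e" by (rule P'.head_via_pseudoinverse[OF D' a that])
      finally show "\<nu> a * P'.hh a e = \<nu> a * (\<Sum>b\<in>P.RI m. P.tn (a @ b) 1 0 * D' b e)" by simp
    qed
    also have "\<dots> = (\<Sum>b\<in>P.RI m. (\<Sum>a\<in>P.LI m. \<nu> a * P.tn (a @ b) 1 0) * D' b e)"
      by (rule sum_vec_mat_vec)
    finally show ?thesis using \<nu>0 by simp
  qed
  \<comment> \<open>\<open>\<nu>\<close> is itself a combination of heads of the two factorizations,
    so it is orthogonal to itself.\<close>
  have "(\<Sum>a\<in>P.LI m. \<nu> a * \<nu> a)
     = (\<Sum>a\<in>P.LI m. \<nu> a * (\<Sum>c<K m. P.hh a c * \<mu> c)) - (\<Sum>a\<in>P.LI m. \<nu> a * (\<Sum>c<K m. P'.hh a c * \<mu>' c))"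
    by (subst (2) \<nu>_def) (simp add: right_diff_distrib sum_subtractf mult.commute)
  also have "\<dots> = 0" unfolding sum_vec_mat_vec by (simp add: hh hh' del: One_nat_def)
  finally have "\<nu> a * \<nu> a = 0"
    using a sum_nonneg_eq_0_iff[of "P.LI m" "\<lambda>a. \<nu> a * \<nu> a"] by simp
  then show ?thesis by (simp add: \<nu>_def)
qed

text \<open>Tangent tails are the full \<open>\<X>\<close> contracted with the heads, so an identity
  between combinations of tails of \<open>A\<close> passes through the heads to tangent tails. The
  range starts at two because \<open>heads_eq\<close> rests on minimality of an inner rank; at
  \<open>Suc d\<close> the empty tangent tails are zero.\<close>

lemma tangent_rows_eq:
  assumes i: "2 \<le> i" "i \<le> Suc d"
    and eq: "\<And>b. b \<in> idx (sizes n i d) \<Longrightarrow> (\<Sum>c<K (i - 1). \<mu> c * P.tn b i c) = (\<Sum>c<K (i - 1). \<mu>' c * P'.tn b i c)"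
    and b: "b \<in> idx (sizes n i d)"
  shows "(\<Sum>c<K (i - 1). \<mu> c * P.tg b i c) = (\<Sum>c<K (i - 1). \<mu>' c * P'.tg b i c)"
proof (cases "i = Suc d")
  case True
  then show ?thesis using b by simp
next
  case False
  define m where "m = i - 1"
  have m: "m \<in> {1..<d}" "i = Suc m" "m < d" using i False by (auto simp: m_def)
  have "(\<Sum>c<K m. \<mu> c * P.tg b (Suc m) c) = (\<Sum>c<K m. \<mu> c * (\<Sum>a\<in>P.LI m. P.hh a c * P.tg (a @ b) 1 0))"
    using P.head_tangent[OF m(3), of _ b] by simp
  also have "\<dots> = (\<Sum>a\<in>P.LI m. (\<Sum>c<K m. \<mu> c * P.hh a c) * P.tg (a @ b) 1 0)"
    by (rule sum_vec_mat_vec)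
  also have "\<dots> = (\<Sum>a\<in>P.LI m. (\<Sum>c<K m. \<mu>' c * P'.hh a c) * P.tg (a @ b) 1 0)"
    using heads_eq[OF m(1), of \<mu> \<mu>'] eq m by simp
  also have "\<dots> = (\<Sum>c<K m. \<mu>' c * (\<Sum>a\<in>P.LI m. P'.hh a c * P.tg (a @ b) 1 0))"
    by (rule sum_vec_mat_vec[symmetric])
  also have "\<dots> = (\<Sum>c<K m. \<mu>' c * P'.tg b (Suc m) c)"
    using head_tangent'[OF m(3), of _ b] b m by simp
  finally show ?thesis using m by simp
qed

lemma orth_sums:
  assumes "\<And>\<tau> c. \<tau> < s \<Longrightarrow> c < k \<Longrightarrow> (\<Sum>b\<in>J. R b \<tau> * T b c) = (0 :: real)"
  shows "(\<Sum>b\<in>J. (\<Sum>\<tau><s. g \<tau> * R b \<tau>) * (\<Sum>c<(k::nat). f c * T b c)) = 0"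
proof -
  have "(\<Sum>b\<in>J. (\<Sum>\<tau><s. g \<tau> * R b \<tau>) * (\<Sum>c<k. f c * T b c))
     = (\<Sum>b\<in>J. \<Sum>\<tau><s. \<Sum>c<k. g \<tau> * f c * (R b \<tau> * T b c))"
    by (simp only: sum_product) (simp add: mult_ac)
  also have "\<dots> = (\<Sum>\<tau><s. \<Sum>b\<in>J. \<Sum>c<k. g \<tau> * f c * (R b \<tau> * T b c))"
    by (rule sum.swap)
  also have "\<dots> = (\<Sum>\<tau><s. \<Sum>c<k. \<Sum>b\<in>J. g \<tau> * f c * (R b \<tau> * T b c))"
    by (intro sum.cong refl sum.swap)
  also have "\<dots> = 0" using assms by (simp add: sum_distrib_left[symmetric])
  finally show ?thesis .
qed

text \<open>Each tail of one factorization of \<open>A\<close> is a combination of tails of the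
  other, with inner products of heads as coefficients. Both families therefore span the same row
  space, and orthogonality to it carries over.\<close>

lemma excursion_orth_mixed:
  assumes "2 \<le> i" "i \<le> Suc d" "\<sigma> < S (i - 1)" "e < K (i - 1)"
  shows "(\<Sum>b\<in>idx (sizes n i d). P.ex b i \<sigma> * P'.tn b i e) = 0"
    and "(\<Sum>b\<in>idx (sizes n i d). P'.ex b i \<sigma> * P.tn b i e) = 0"
proof -
  define m where "m = i - 1"
  have "i \<noteq> Suc d" using assms(3) P.Sd by auto
  then have m: "m < d" "i = Suc m" "m \<le> d" using assms by (auto simp: m_def)
  have "P'.tn b i e = (\<Sum>c<K m. (\<Sum>a\<in>P.LI m. P'.hh a e * P.hh a c) * P.tn b i c)"
    if b: "b \<in> idx (sizes n i d)" for b
  proof -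
    have "P'.tn b i e = (\<Sum>a\<in>P.LI m. P'.hh a e * (\<Sum>c<K m. P.hh a c * P.tn b (Suc m) c))"
      using head_train'[OF m(1), of e b] b m assms by (simp add: P.train_split[simplified])
    then show ?thesis unfolding sum_vec_mat_vec using m by simp
  qed
  then show "(\<Sum>b\<in>idx (sizes n i d). P.ex b i \<sigma> * P'.tn b i e) = 0"
    using P.excursion_orth[OF assms(1-3)] m by (simp add: sum_vec_mat_vec mult.commute[of _ "P.tn _ _ _"])
  have "P.tn b i e = (\<Sum>c<K m. (\<Sum>a\<in>P.LI m. P.hh a e * P'.hh a c) * P'.tn b i c)"
    if b: "b \<in> idx (sizes n i d)" for b
  proof -
    have "P.tn b i e = (\<Sum>a\<in>P.LI m. P.hh a e * P.tn (a @ b) 1 0)"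
      using P.head_train[OF m(1), of e b] m assms by simp
    also have "\<dots> = (\<Sum>a\<in>P.LI m. P.hh a e * (\<Sum>c<K m. P'.hh a c * P'.tn b (Suc m) c))"
      using append_in_full[OF _ b[unfolded m(2)] m(3)] train_eq P'.train_split by (intro sum.cong refl) simp
    finally show ?thesis unfolding sum_vec_mat_vec using m by simp
  qed
  then show "(\<Sum>b\<in>idx (sizes n i d). P'.ex b i \<sigma> * P.tn b i e) = 0"
    using P'.excursion_orth[OF assms(1-3)] m by (simp add: sum_vec_mat_vec mult.commute[of _ "P'.tn _ _ _"])
qed

text \<open>The difference of the two train parts equals a difference of excursion parts, to which
  it is orthogonal; so it is orthogonal to itself and vanishes.\<close>

lemma split_eq:
  assumes i: "2 \<le> i" "i \<le> Suc d"
    and eq: "\<And>b. b \<in> idx (sizes n i d) \<Longrightarrow>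
      (\<Sum>c<K (i - 1). f c * P.tn b i c) + (\<Sum>\<tau><S (i - 1). g \<tau> * P.ex b i \<tau>)
      = (\<Sum>c<K (i - 1). f' c * P'.tn b i c) + (\<Sum>\<tau><S (i - 1). g' \<tau> * P'.ex b i \<tau>)"
    and b: "b \<in> idx (sizes n i d)"
  shows "(\<Sum>c<K (i - 1). f c * P.tn b i c) = (\<Sum>c<K (i - 1). f' c * P'.tn b i c)"
    and "(\<Sum>\<tau><S (i - 1). g \<tau> * P.ex b i \<tau>) = (\<Sum>\<tau><S (i - 1). g' \<tau> * P'.ex b i \<tau>)"
proof -
  define F where "F b = (\<Sum>c<K (i - 1). f c * P.tn b i c)" for b
  define F' where "F' b = (\<Sum>c<K (i - 1). f' c * P'.tn b i c)" for b
  define G where "G b = (\<Sum>\<tau><S (i - 1). g \<tau> * P.ex b i \<tau>)" for b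
  define G' where "G' b = (\<Sum>\<tau><S (i - 1). g' \<tau> * P'.ex b i \<tau>)" for b
  have zero: "(\<Sum>b\<in>idx (sizes n i d). G b * F b) = 0" "(\<Sum>b\<in>idx (sizes n i d). G b * F' b) = 0"
    "(\<Sum>b\<in>idx (sizes n i d). G' b * F b) = 0" "(\<Sum>b\<in>idx (sizes n i d). G' b * F' b) = 0"
    unfolding G_def F_def G'_def F'_def
    by (rule orth_sums; (rule P.excursion_orth P'.excursion_orth excursion_orth_mixed; (rule i | assumption)))+
  have "(\<Sum>b\<in>idx (sizes n i d). (F b - F' b) * (F b - F' b)) = (\<Sum>b\<in>idx (sizes n i d). (G' b - G b) * (F b - F' b))"
  proof (rule sum.cong[OF refl])
    fix b assume "b \<in> idx (sizes n i d)"
    then have "F b - F' b = G' b - G b" using eq unfolding F_def F'_def G_def G'_def by force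
    then show "(F b - F' b) * (F b - F' b) = (G' b - G b) * (F b - F' b)" by simp
  qed
  also have "\<dots> = 0" using zero by (simp add: algebra_simps sum_subtractf sum.distrib)
  finally have "(F b - F' b) * (F b - F' b) = 0"
    using b sum_nonneg_eq_0_iff[of "idx (sizes n i d)" "\<lambda>b. (F b - F' b) * (F b - F' b)"] by simp
  then have FF: "F b = F' b" by simp
  then show "(\<Sum>c<K (i - 1). f c * P.tn b i c) = (\<Sum>c<K (i - 1). f' c * P'.tn b i c)"
    by (simp add: F_def F'_def)
  show "(\<Sum>\<tau><S (i - 1). g \<tau> * P.ex b i \<tau>) = (\<Sum>\<tau><S (i - 1). g' \<tau> * P'.ex b i \<tau>)"
    using FF eq[OF b] unfolding F_def F'_def by linarith
qed

text \<open>The coefficients are quantified because each step creates new ones: fixing the first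
  index sends \<open>\<mu>\<close> to its products with \<open>A\<close>, \<open>X\<close> and
  \<open>U\<close>. In the equation between tangent tails, the part through \<open>A\<close> agrees
  by \<open>tangent_rows_eq\<close> and can be subtracted; \<open>split_eq\<close> separates the
  rest into the parts through \<open>X\<close> and \<open>U\<close>, and \<open>A + X\<close> and
  \<open>U\<close> feed the two induction hypotheses. Position one is out of reach of
  \<open>tangent_rows_eq\<close>, so equality of tangent tails stays a hypothesis of the
  claim.\<close>

lemma retract_rows_eq:
  assumes "1 \<le> i" "i \<le> Suc d"
  shows "(\<forall>\<mu> \<mu>'. (\<forall>b\<in>idx (sizes n i d). (\<Sum>c<K (i - 1). \<mu> c * P.tn b i c) = (\<Sum>c<K (i - 1). \<mu>' c * P'.tn b i c)) \<longrightarrow>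
      (\<forall>b\<in>idx (sizes n i d). (\<Sum>c<K (i - 1). \<mu> c * P.tg b i c) = (\<Sum>c<K (i - 1). \<mu>' c * P'.tg b i c)) \<longrightarrow>
      (\<forall>b\<in>idx (sizes n i d). (\<Sum>c<K (i - 1). \<mu> c * P.rt b i (Inl c)) = (\<Sum>c<K (i - 1). \<mu>' c * P'.rt b i (Inl c)))) \<and>
    (\<forall>\<kappa> \<kappa>'. (\<forall>b\<in>idx (sizes n i d). (\<Sum>\<sigma><S (i - 1). \<kappa> \<sigma> * P.ex b i \<sigma>) = (\<Sum>\<sigma><S (i - 1). \<kappa>' \<sigma> * P'.ex b i \<sigma>)) \<longrightarrow>
      (\<forall>b\<in>idx (sizes n i d). (\<Sum>\<sigma><S (i - 1). \<kappa> \<sigma> * P.rt b i (Inr \<sigma>)) = (\<Sum>\<sigma><S (i - 1). \<kappa>' \<sigma> * P'.rt b i (Inr \<sigma>))))"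
    (is "(\<forall>\<mu> \<mu>'. ?T i \<mu> \<mu>' \<longrightarrow> ?G i \<mu> \<mu>' \<longrightarrow> ?R i \<mu> \<mu>') \<and> (\<forall>\<kappa> \<kappa>'. ?E i \<kappa> \<kappa>' \<longrightarrow> ?Q i \<kappa> \<kappa>')")
  using assms(2,1)
proof (induction i rule: inc_induct)
  case base
  then show ?case using P.Sd P.Kd by simp
next
  case (step i)
  have i: "i \<le> d" "2 \<le> Suc i" "Suc i \<le> Suc d" using step by auto
  have "1 \<le> Suc i" by simp
  note IH = step.IH[OF this]
  have IHP: "?R (Suc i) \<mu> \<mu>'" if "?T (Suc i) \<mu> \<mu>'" for \<mu> \<mu>'
  proof -
    have G: "?G (Suc i) \<mu> \<mu>'" using tangent_rows_eq[OF i(2,3), of \<mu> \<mu>'] that by blast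
    show ?thesis by (rule IH[THEN conjunct1, THEN spec, THEN spec, THEN mp, THEN mp, OF that G])
  qed
  have IHQ: "?Q (Suc i) \<kappa> \<kappa>'" if "?E (Suc i) \<kappa> \<kappa>'" for \<kappa> \<kappa>'
    by (rule IH[THEN conjunct2, THEN spec, THEN spec, THEN mp, OF that])
  have all: "(\<forall>b\<in>idx (sizes n i d). P b) \<longleftrightarrow> (\<forall>x<n i. \<forall>b\<in>P.RI i. P (x # b))" for P
    unfolding sizes_Cons[OF i(1)] idx_Cons by auto
  show ?case
  proof (intro conjI allI impI)
    fix \<mu> \<mu>' assume T: "?T i \<mu> \<mu>'" and G: "?G i \<mu> \<mu>'"
    show "?R i \<mu> \<mu>'" unfolding all
    proof (intro allI impI)
      fix x assume x: "x < n i"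
      define fA where "fA \<beta> = (\<Sum>\<alpha><K (i - 1). \<mu> \<alpha> * A i \<alpha> x \<beta>)" for \<beta>
      define fA' where "fA' \<beta> = (\<Sum>\<alpha><K (i - 1). \<mu>' \<alpha> * A' i \<alpha> x \<beta>)" for \<beta>
      define fX where "fX \<beta> = (\<Sum>\<alpha><K (i - 1). \<mu> \<alpha> * X i \<alpha> x \<beta>)" for \<beta>
      define fX' where "fX' \<beta> = (\<Sum>\<alpha><K (i - 1). \<mu>' \<alpha> * X' i \<alpha> x \<beta>)" for \<beta>
      define g where "g \<tau> = (\<Sum>\<alpha><K (i - 1). \<mu> \<alpha> * U i \<alpha> x \<tau>)" for \<tau>
      define g' where "g' \<tau> = (\<Sum>\<alpha><K (i - 1). \<mu>' \<alpha> * U' i \<alpha> x \<tau>)" for \<tau>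
      have TA: "?T (Suc i) fA fA'"
        using T[unfolded all] x unfolding train.simps sum_vec_mat_vec fA_def fA'_def by simp
      have GA: "?G (Suc i) fA fA'" using tangent_rows_eq[OF i(2,3), of fA fA'] TA by blast
      have XU: "(\<Sum>c<K (Suc i - 1). fX c * P.tn b (Suc i) c) + (\<Sum>\<tau><S (Suc i - 1). g \<tau> * P.ex b (Suc i) \<tau>)
          = (\<Sum>c<K (Suc i - 1). fX' c * P'.tn b (Suc i) c) + (\<Sum>\<tau><S (Suc i - 1). g' \<tau> * P'.ex b (Suc i) \<tau>)"
        if b: "b \<in> P.RI i" for b
      proof -
        have "(\<Sum>c<K i. fA c * P.tg b (Suc i) c) + (\<Sum>\<tau><S i. g \<tau> * P.ex b (Suc i) \<tau>) + (\<Sum>c<K i. fX c * P.tn b (Suc i) c)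
          = (\<Sum>c<K i. fA' c * P'.tg b (Suc i) c) + (\<Sum>\<tau><S i. g' \<tau> * P'.ex b (Suc i) \<tau>) + (\<Sum>c<K i. fX' c * P'.tn b (Suc i) c)"
          using G[unfolded all] x b
          unfolding tangent.simps distrib_left sum.distrib sum_vec_mat_vec fA_def fA'_def fX_def fX'_def g_def g'_def by blast
        then show ?thesis using GA b by simp
      qed
      have "?T (Suc i) fX fX'" using split_eq(1)[OF i(2,3) XU] by blast
      then have "?T (Suc i) (\<lambda>c. fA c + fX c) (\<lambda>c. fA' c + fX' c)"
        using TA by (simp add: distrib_right sum.distrib)
      then have R: "?R (Suc i) (\<lambda>c. fA c + fX c) (\<lambda>c. fA' c + fX' c)" by (rule IHP)
      have "?E (Suc i) g g'" using split_eq(2)[OF i(2,3) XU] by blast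
      then have Q: "?Q (Suc i) g g'" by (rule IHQ)
      have f: "fA c + fX c = (\<Sum>\<alpha><K (i - 1). \<mu> \<alpha> * (A i \<alpha> x c + X i \<alpha> x c))"
        "fA' c + fX' c = (\<Sum>\<alpha><K (i - 1). \<mu>' \<alpha> * (A' i \<alpha> x c + X' i \<alpha> x c))" for c
        by (simp_all add: fA_def fX_def fA'_def fX'_def distrib_left sum.distrib)
      show "\<forall>b\<in>P.RI i. (\<Sum>c<K (i - 1). \<mu> c * P.rt (x # b) i (Inl c)) = (\<Sum>c<K (i - 1). \<mu>' c * P'.rt (x # b) i (Inl c))"
        using R Q unfolding f retract.simps sum.case distrib_left[of "\<mu> _" "sum _ _"] distrib_left[of "\<mu>' _" "sum _ _"] sum.distrib sum_vec_mat_vec g_def g'_def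
        by simp
    qed
  next
    fix \<mu> \<mu>' assume E: "?E i \<mu> \<mu>'"
    show "?Q i \<mu> \<mu>'" unfolding all
    proof (intro allI impI)
      fix x assume x: "x < n i"
      define f where "f \<beta> = (\<Sum>\<alpha><S (i - 1). \<mu> \<alpha> * V i \<alpha> x \<beta>)" for \<beta>
      define f' where "f' \<beta> = (\<Sum>\<alpha><S (i - 1). \<mu>' \<alpha> * V' i \<alpha> x \<beta>)" for \<beta>
      define g where "g \<tau> = (\<Sum>\<alpha><S (i - 1). \<mu> \<alpha> * Z i \<alpha> x \<tau>)" for \<tau>
      define g' where "g' \<tau> = (\<Sum>\<alpha><S (i - 1). \<mu>' \<alpha> * Z' i \<alpha> x \<tau>)" for \<tau>
      have VZ: "(\<Sum>c<K (Suc i - 1). f c * P.tn b (Suc i) c) + (\<Sum>\<tau><S (Suc i - 1). g \<tau> * P.ex b (Suc i) \<tau>)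
          = (\<Sum>c<K (Suc i - 1). f' c * P'.tn b (Suc i) c) + (\<Sum>\<tau><S (Suc i - 1). g' \<tau> * P'.ex b (Suc i) \<tau>)"
        if b: "b \<in> P.RI i" for b
        using E[unfolded all] x b
        unfolding excursion.simps distrib_left sum.distrib sum_vec_mat_vec f_def f'_def g_def g'_def by simp
      have "?T (Suc i) f f'" using split_eq(1)[OF i(2,3) VZ] by blast
      then have R: "?R (Suc i) f f'" by (rule IHP)
      have "?E (Suc i) g g'" using split_eq(2)[OF i(2,3) VZ] by blast
      then have Q: "?Q (Suc i) g g'" by (rule IHQ)
      show "\<forall>b\<in>P.RI i. (\<Sum>\<sigma><S (i - 1). \<mu> \<sigma> * P.rt (x # b) i (Inr \<sigma>)) = (\<Sum>\<sigma><S (i - 1). \<mu>' \<sigma> * P'.rt (x # b) i (Inr \<sigma>))"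
        using R Q unfolding retract.simps sum.case distrib_left sum.distrib sum_vec_mat_vec f_def f'_def g_def g'_def
        by simp
    qed
  qed
qed

lemma retract_eq: "j \<in> idx (sizes n 1 d) \<Longrightarrow> P.rt j 1 (Inl 0) = P'.rt j 1 (Inl 0)"
  using retract_rows_eq[of 1, THEN conjunct1, rule_format, of "\<lambda>_. 1" "\<lambda>_. 1" j] train_eq tangent_eq P.K0
  by simp

end

section \<open>Existence of the parametrization\<close>

text \<open>A left-orthogonal factorization of \<open>A\<close>, viewed as a parametrization whose
  other cores are zero, with a tensor \<open>v\<close> to be parametrized and pseudoinverses
  \<open>D\<close> of the tails of \<open>A\<close>.\<close>

locale tangent_data = tt_param d n K S A "\<lambda>_ _ _ _. 0" "\<lambda>_ _ _ _. 0" "\<lambda>_ _ _ _. 0" "\<lambda>_ _ _ _. 0"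
  for d n K S A +
  fixes v :: "nat list \<Rightarrow> real" and D :: "nat \<Rightarrow> nat list \<Rightarrow> nat \<Rightarrow> real"
  assumes TD: "\<And>m c e. m \<in> {1..<d} \<Longrightarrow> c < K m \<Longrightarrow> e < K m \<Longrightarrow>
      (\<Sum>b\<in>RI m. tn b (Suc m) c * D m b e) = (if c = e then 1 else 0)"
    and DT: "\<And>m b b'. m \<in> {1..<d} \<Longrightarrow> b \<in> RI m \<Longrightarrow> b' \<in> RI m \<Longrightarrow>
      (\<Sum>c<K m. D m b c * tn b' (Suc m) c) = (\<Sum>c<K m. D m b' c * tn b (Suc m) c)"
begin

text \<open>The orthogonal projection away from the row space of the tails, written through
  \<open>D\<close>. \<open>N\<close> applies it to the rows of \<open>v\<close>, and
  \<open>G\<close> then removes the components along the heads, so \<open>G m\<close> is the part of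
  the unfolding of \<open>v\<close> that is normal on both sides.\<close>

definition Q :: "nat \<Rightarrow> (nat list \<Rightarrow> real) \<Rightarrow> nat list \<Rightarrow> real" where
  "Q m f b = f b - (\<Sum>e<K m. (\<Sum>b'\<in>RI m. f b' * D m b' e) * tn b (Suc m) e)"

definition N :: "nat \<Rightarrow> nat list \<Rightarrow> nat list \<Rightarrow> real" where
  "N m a = Q m (\<lambda>b. v (a @ b))"

definition G :: "nat \<Rightarrow> nat list \<Rightarrow> nat list \<Rightarrow> real" where
  "G m a b = N m a b - (\<Sum>c<K m. hh a c * (\<Sum>a'\<in>LI m. hh a' c * N m a' b))"

lemma Q_sum: "Q m (\<lambda>b. \<Sum>a\<in>I. l a * f a b) b = (\<Sum>a\<in>I. l a * Q m (f a) b)"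
proof -
  have "(\<Sum>b'\<in>RI m. (\<Sum>a\<in>I. l a * f a b') * D m b' e) = (\<Sum>a\<in>I. l a * (\<Sum>b'\<in>RI m. f a b' * D m b' e))" for e
    by (rule sum_vec_mat_vec[symmetric])
  then show ?thesis
    by (simp add: Q_def right_diff_distrib sum_subtractf sum_vec_mat_vec)
qed

lemma Q_diff: "Q m (\<lambda>b. f b - g b) b = Q m f b - Q m g b"
  by (simp add: Q_def left_diff_distrib sum_subtractf)

lemma Q_train: "m \<in> {1..<d} \<Longrightarrow> e < K m \<Longrightarrow> Q m (\<lambda>b. tn b (Suc m) e) b = 0"
  by (simp add: Q_def TD sum_delta_mult)

text \<open>The symmetry \<open>DT\<close> moves the projection from \<open>f\<close> onto the tail,
  where \<open>TD\<close> applies.\<close>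

lemma Q_orth:
  assumes m: "m \<in> {1..<d}" and e: "e < K m"
  shows "(\<Sum>b\<in>RI m. Q m f b * tn b (Suc m) e) = 0"
proof -
  have "(\<Sum>e'<K m. (\<Sum>b'\<in>RI m. f b' * D m b' e') * tn b (Suc m) e') = (\<Sum>b'\<in>RI m. f b' * (\<Sum>e'<K m. tn b' (Suc m) e' * D m b e'))"
    if b: "b \<in> RI m" for b
  proof -
    have "(\<Sum>e'<K m. (\<Sum>b'\<in>RI m. f b' * D m b' e') * tn b (Suc m) e') = (\<Sum>b'\<in>RI m. f b' * (\<Sum>e'<K m. D m b' e' * tn b (Suc m) e'))"
      by (rule sum_vec_mat_vec[symmetric])
    then show ?thesis using DT[OF m _ b] by (simp add: mult.commute)
  qed
  then have "(\<Sum>b\<in>RI m. Q m f b * tn b (Suc m) e) = (\<Sum>b\<in>RI m. f b * tn b (Suc m) e)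
      - (\<Sum>b\<in>RI m. tn b (Suc m) e * (\<Sum>b'\<in>RI m. (\<Sum>e'<K m. D m b e' * tn b' (Suc m) e') * f b'))"
    by (simp add: Q_def left_diff_distrib right_diff_distrib sum_subtractf mult.commute)
  also have "(\<Sum>b\<in>RI m. tn b (Suc m) e * (\<Sum>b'\<in>RI m. (\<Sum>e'<K m. D m b e' * tn b' (Suc m) e') * f b'))
     = (\<Sum>b'\<in>RI m. (\<Sum>e'<K m. (\<Sum>b\<in>RI m. tn b (Suc m) e * D m b e') * tn b' (Suc m) e') * f b')"
    by (simp only: sum_vec_mat_vec)
  also have "\<dots> = (\<Sum>b'\<in>RI m. tn b' (Suc m) e * f b')"
    using e by (simp add: TD[OF m e] sum_delta_mult)
  finally show ?thesis by (simp add: mult.commute)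
qed

text \<open>With one head written as the unfolding times \<open>D\<close>, the other head contracts
  the unfolding to a tail, and \<open>TD\<close> remains. Position zero has no \<open>D\<close> and
  is treated directly.\<close>

lemma head_orth:
  assumes "m < d" "c < K m" "e < K m"
  shows "(\<Sum>a\<in>LI m. hh a c * hh a e) = (if c = e then 1 else 0)"
proof (cases "m = 0")
  case True
  then have "LI m = {[]}" by simp
  then show ?thesis using assms K0 True by simp
next
  case False
  then have m: "m \<in> {1..<d}" using assms by simp
  have "(\<Sum>a\<in>LI m. hh a c * hh a e) = (\<Sum>a\<in>LI m. hh a c * (\<Sum>b\<in>RI m. tn (a @ b) 1 0 * D m b e))"
    using head_via_pseudoinverse[OF TD[OF m] _ assms(3)] by (intro sum.cong refl) simp
  also have "\<dots> = (\<Sum>b\<in>RI m. tn b (Suc m) c * D m b e)"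
    unfolding sum_vec_mat_vec head_train[OF assms(1,2)] ..
  finally show ?thesis using TD[OF m] assms by simp
qed

lemma head_Suc: "a \<in> LI m \<Longrightarrow> hh (a @ [x]) e = (\<Sum>\<beta><K m. hh a \<beta> * A (Suc m) \<beta> x e)"
  using length_idx[of a "sizes n 1 m"] by simp

lemma head_head_Suc:
  assumes "m < d" "c < K m"
  shows "(\<Sum>a\<in>LI m. hh a c * hh (a @ [x]) e) = A (Suc m) c x e"
proof -
  have "(\<Sum>a\<in>LI m. hh a c * hh (a @ [x]) e) = (\<Sum>a\<in>LI m. hh a c * (\<Sum>\<beta><K m. hh a \<beta> * A (Suc m) \<beta> x e))"
    by (intro sum.cong refl) (simp only: head_Suc)
  also have "\<dots> = (\<Sum>\<beta><K m. (if c = \<beta> then 1 else 0) * A (Suc m) \<beta> x e)"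
    unfolding sum_vec_mat_vec using head_orth[OF assms(1,2)] by (intro sum.cong refl) simp
  finally show ?thesis using assms by (simp add: sum_delta_mult)
qed

text \<open>A tail with its first index fixed is a combination of the next tails. The correction
  made by \<open>Q m\<close> is therefore killed by \<open>Q (Suc m)\<close>, and only the
  projection of \<open>v\<close> itself is left.\<close>

lemma N_Suc:
  assumes m: "Suc m < d" and b: "b \<in> RI (Suc m)"
  shows "Q (Suc m) (\<lambda>b. N m a (x # b)) b = N (Suc m) (a @ [x]) b"
proof -
  have "N m a (x # b) = v ((a @ [x]) @ b) - (\<Sum>\<alpha><K (Suc m). (\<Sum>e<K m. (\<Sum>b'\<in>RI m. v (a @ b') * D m b' e) * A (Suc m) e x \<alpha>) * tn b (Suc (Suc m)) \<alpha>)" for b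
    by (simp add: N_def Q_def sum_vec_mat_vec)
  then show ?thesis
    using m by (simp add: Q_diff Q_sum Q_train N_def)
qed

text \<open>By contraction with the heads, the tangent tail that every admissible parametrization of
  \<open>v\<close> must have.\<close>

definition TX :: "nat \<Rightarrow> nat \<Rightarrow> nat list \<Rightarrow> real" where
  "TX m c b = (\<Sum>a\<in>LI m. hh a c * v (a @ b))"

lemma head_N: "(\<Sum>a\<in>LI m. hh a c * N m' (a @ w) b) = Q m' (\<lambda>b. TX m c (w @ b)) b"
  by (simp add: N_def TX_def Q_sum)

lemma TX_Suc:
  "(\<Sum>c<K m. \<Sum>x<n (Suc m). A (Suc m) c x e * TX m c (x # b)) = TX (Suc m) e b"
proof -
  have "TX (Suc m) e b = (\<Sum>a\<in>LI m. \<Sum>x<n (Suc m). \<Sum>c<K m. hh a c * A (Suc m) c x e * v (a @ x # b))"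
    unfolding TX_def sum_left_snoc
    by (intro sum.cong refl) (simp only: head_Suc sum_distrib_right append_assoc append.simps)
  also have "\<dots> = (\<Sum>x<n (Suc m). \<Sum>a\<in>LI m. \<Sum>c<K m. hh a c * A (Suc m) c x e * v (a @ x # b))"
    by (rule sum.swap)
  also have "\<dots> = (\<Sum>x<n (Suc m). \<Sum>c<K m. \<Sum>a\<in>LI m. hh a c * A (Suc m) c x e * v (a @ x # b))"
    by (intro sum.cong refl sum.swap)
  also have "\<dots> = (\<Sum>c<K m. \<Sum>x<n (Suc m). \<Sum>a\<in>LI m. hh a c * A (Suc m) c x e * v (a @ x # b))"
    by (rule sum.swap)
  finally show ?thesis by (simp add: TX_def sum_distrib_left mult_ac)
qed

end

text \<open>\<open>L m\<close> stands for an orthonormal basis of the column space of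
  \<open>G m\<close>, filled up with zero columns to \<open>S m\<close> of them. The zero columns
  break orthonormality, so what is asked for is the reconstruction of \<open>G m\<close> and
  orthogonality to the heads.\<close>

locale tangent_normal_data = tangent_data +
  fixes L :: "nat \<Rightarrow> nat list \<Rightarrow> nat \<Rightarrow> real"
  assumes GL: "\<And>m a b. m \<in> {1..<d} \<Longrightarrow> a \<in> LI m \<Longrightarrow> b \<in> RI m \<Longrightarrow>
      G m a b = (\<Sum>\<tau><S m. L m a \<tau> * (\<Sum>a'\<in>LI m. L m a' \<tau> * G m a' b))"
    and HL: "\<And>m c \<tau>. m \<in> {1..<d} \<Longrightarrow> c < K m \<Longrightarrow> \<tau> < S m \<Longrightarrow>
      (\<Sum>a\<in>LI m. hh a c * L m a \<tau>) = 0"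
begin

text \<open>The right factor belonging to \<open>L\<close>; its rows are the intended excursion
  tails.\<close>

definition R :: "nat \<Rightarrow> nat \<Rightarrow> nat list \<Rightarrow> real" where
  "R m \<tau> b = (\<Sum>a\<in>LI m. L m a \<tau> * G m a b)"

lemma G_factored: "m \<in> {1..<d} \<Longrightarrow> a \<in> LI m \<Longrightarrow> b \<in> RI m \<Longrightarrow> G m a b = (\<Sum>\<tau><S m. L m a \<tau> * R m \<tau> b)"
  unfolding R_def by (rule GL)

definition nU :: "nat \<Rightarrow> nat \<Rightarrow> nat \<Rightarrow> nat \<Rightarrow> real" where
  "nU i c x \<tau> = (\<Sum>a\<in>LI (i - 1). hh a c * L i (a @ [x]) \<tau>)"

text \<open>What the tangent tail still lacks after the contribution of \<open>A i\<close>. Its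
  component in the row space of the tails will be supplied by \<open>nX\<close>, the normal
  component by \<open>nU\<close>.\<close>

definition nE :: "nat \<Rightarrow> nat \<Rightarrow> nat \<Rightarrow> nat list \<Rightarrow> real" where
  "nE i c x b = TX (i - 1) c (x # b) - (\<Sum>e<K i. A i c x e * TX i e b)"

text \<open>Coefficients with respect to the tails are read off by \<open>D\<close>. At position
  \<open>d\<close> nothing follows, and the core is the required tail itself; \<open>nV\<close> is
  built in the same way.\<close>

definition nX :: "nat \<Rightarrow> nat \<Rightarrow> nat \<Rightarrow> nat \<Rightarrow> real" where
  "nX i c x e = (if i = d then TX (d - 1) c [x] else (\<Sum>b\<in>RI i. nE i c x b * D i b e))"

definition nV :: "nat \<Rightarrow> nat \<Rightarrow> nat \<Rightarrow> nat \<Rightarrow> real" where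
  "nV i \<sigma> x e = (if i = d then R (d - 1) \<sigma> [x] else (\<Sum>b\<in>RI i. R (i - 1) \<sigma> (x # b) * D i b e))"

definition nZ :: "nat \<Rightarrow> nat \<Rightarrow> nat \<Rightarrow> nat \<Rightarrow> real" where
  "nZ i \<sigma> x \<tau> = (\<Sum>a\<in>LI (i - 1). L (i - 1) a \<sigma> * L i (a @ [x]) \<tau>)"

lemma L_perp_heads:
  assumes "m \<in> {1..<d}" "\<tau> < S m"
  shows "(\<Sum>a\<in>LI m. L m a \<tau> * (f a - (\<Sum>c<K m. hh a c * g c))) = (\<Sum>a\<in>LI m. L m a \<tau> * f a)"
proof -
  have "(\<Sum>a\<in>LI m. L m a \<tau> * (\<Sum>c<K m. hh a c * g c)) = 0"
    unfolding sum_vec_mat_vec using HL[OF assms(1) _ assms(2)] by (simp add: mult.commute)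
  then show ?thesis by (simp add: right_diff_distrib sum_subtractf)
qed

lemma R_N: "m \<in> {1..<d} \<Longrightarrow> \<tau> < S m \<Longrightarrow> R m \<tau> b = (\<Sum>a\<in>LI m. L m a \<tau> * N m a b)"
  unfolding R_def G_def by (rule L_perp_heads)

text \<open>The realization step. Fixing an index \<open>x\<close> in \<open>R m\<close> and
  projecting leaves rows of \<open>N (Suc m)\<close>. They may be replaced by rows of
  \<open>G (Suc m)\<close>: the difference is a combination of heads extended by \<open>x\<close>,
  hence of heads at \<open>m\<close>, which \<open>L m\<close> annihilates. The factorization of
  \<open>G (Suc m)\<close> then produces \<open>nZ\<close>.\<close>

lemma R_step:
  assumes m: "1 \<le> m" "Suc m < d" and \<sigma>: "\<sigma> < S m" and b: "b \<in> RI (Suc m)"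
    and x: "x < n (Suc m)"
  shows "Q (Suc m) (\<lambda>b. R m \<sigma> (x # b)) b = (\<Sum>\<tau><S (Suc m). nZ (Suc m) \<sigma> x \<tau> * R (Suc m) \<tau> b)"
proof -
  have m1: "m \<in> {1..<d}" "Suc m \<in> {1..<d}" using m by auto
  have mem: "a @ [x] \<in> LI (Suc m)" if "a \<in> LI m" for a
    unfolding sizes_snoc using that x length_idx[OF that] by simp
  have "Q (Suc m) (\<lambda>b. R m \<sigma> (x # b)) b = (\<Sum>a\<in>LI m. L m a \<sigma> * N (Suc m) (a @ [x]) b)"
    using N_Suc[OF m(2) b] by (simp add: R_N[OF m1(1) \<sigma>] Q_sum)
  also have "\<dots> = (\<Sum>a\<in>LI m. L m a \<sigma> * G (Suc m) (a @ [x]) b)"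
  proof -
    have "G (Suc m) (a @ [x]) b = N (Suc m) (a @ [x]) b
        - (\<Sum>\<beta><K m. hh a \<beta> * (\<Sum>c<K (Suc m). A (Suc m) \<beta> x c * (\<Sum>a'\<in>LI (Suc m). hh a' c * N (Suc m) a' b)))"
      if "a \<in> LI m" for a
      unfolding G_def head_Suc[OF that] sum_vec_mat_vec ..
    then have "(\<Sum>a\<in>LI m. L m a \<sigma> * G (Suc m) (a @ [x]) b) = (\<Sum>a\<in>LI m. L m a \<sigma> * (N (Suc m) (a @ [x]) b
        - (\<Sum>\<beta><K m. hh a \<beta> * (\<Sum>c<K (Suc m). A (Suc m) \<beta> x c * (\<Sum>a'\<in>LI (Suc m). hh a' c * N (Suc m) a' b)))))"
      by simp
    then show ?thesis by (simp only: L_perp_heads[OF m1(1) \<sigma>])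
  qed
  also have "\<dots> = (\<Sum>a\<in>LI m. L m a \<sigma> * (\<Sum>\<tau><S (Suc m). L (Suc m) (a @ [x]) \<tau> * R (Suc m) \<tau> b))"
    by (intro sum.cong refl) (simp only: G_factored[OF m1(2) mem b])
  finally show ?thesis unfolding sum_vec_mat_vec by (simp add: nZ_def)
qed

abbreviation "nex \<equiv> excursion K S A nZ nV"
abbreviation "ntg \<equiv> tangent K S A nU nX nZ nV"

lemma Q_split:
  "(\<Sum>e<K m. (\<Sum>b'\<in>RI m. f b' * D m b' e) * tn b (Suc m) e) + Q m f b = f b"
  by (simp add: Q_def)

lemma RI_last: "b \<in> RI (d - 1) \<longleftrightarrow> (\<exists>x<n d. b = [x])"
  using d2 by (auto simp: sizes_Cons idx_Cons)

lemma RI_Cons: "m < d \<Longrightarrow> b \<in> RI m \<longleftrightarrow> (\<exists>x b'. b = x # b' \<and> x < n (Suc m) \<and> b' \<in> RI (Suc m))"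
  by (subst sizes_Cons) (auto simp: idx_Cons)

text \<open>\<open>nV\<close> supplies the part of \<open>R m\<close> in the row space of the next
  tails, and \<open>nZ\<close>, by \<open>R_step\<close>, the part normal to it.\<close>

lemma excursion_eq:
  assumes "m \<le> d - 1" "1 \<le> m" "\<sigma> < S m" "b \<in> RI m"
  shows "nex b (Suc m) \<sigma> = R m \<sigma> b"
  using assms
proof (induction m arbitrary: \<sigma> b rule: inc_induct)
  case base
  then obtain x where "b = [x]" using RI_last by auto
  then show ?case using d2 Kd Sd by (simp add: nV_def)
next
  case (step m)
  then have m: "1 \<le> m" "Suc m < d" by auto
  obtain x b' where b: "b = x # b'" "x < n (Suc m)" "b' \<in> RI (Suc m)"
    using step.prems m RI_Cons[of m b] by auto
  have IH: "nex b' (Suc (Suc m)) \<tau> = R (Suc m) \<tau> b'" if "\<tau> < S (Suc m)" for \<tau>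
    using step.IH[of \<tau> b'] that b by simp
  have "nex b (Suc m) \<sigma> = (\<Sum>e<K (Suc m). (\<Sum>b\<in>RI (Suc m). R m \<sigma> (x # b) * D (Suc m) b e) * tn b' (Suc (Suc m)) e)
      + Q (Suc m) (\<lambda>b. R m \<sigma> (x # b)) b'"
    using m IH R_step[OF m step.prems(2) b(3,2)] by (simp add: b(1) nV_def)
  then show ?case unfolding b(1) Q_split .
qed

text \<open>The factorization of \<open>G (Suc m)\<close> is contracted with a head at
  \<open>m\<close>. Heads at \<open>m\<close> contracted with heads at \<open>Suc m\<close> give
  back the core of \<open>A\<close>, so the passage from \<open>N\<close> to \<open>G\<close>
  subtracts exactly the part through \<open>A\<close>.\<close>

lemma nE_step:
  assumes m: "Suc m < d" and b: "b \<in> RI (Suc m)" and x: "x < n (Suc m)" and c: "c < K m"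
  shows "(\<Sum>\<tau><S (Suc m). nU (Suc m) c x \<tau> * R (Suc m) \<tau> b) = Q (Suc m) (nE (Suc m) c x) b"
proof -
  have m1: "Suc m \<in> {1..<d}" using m by simp
  have mem: "a @ [x] \<in> LI (Suc m)" if "a \<in> LI m" for a
    unfolding sizes_snoc using that x length_idx[OF that] by simp
  have "(\<Sum>\<tau><S (Suc m). nU (Suc m) c x \<tau> * R (Suc m) \<tau> b) = (\<Sum>a\<in>LI m. hh a c * (\<Sum>\<tau><S (Suc m). L (Suc m) (a @ [x]) \<tau> * R (Suc m) \<tau> b))"
    unfolding sum_vec_mat_vec by (simp add: nU_def)
  also have "\<dots> = (\<Sum>a\<in>LI m. hh a c * G (Suc m) (a @ [x]) b)"
    by (intro sum.cong refl) (simp only: G_factored[OF m1 mem b])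
  also have "\<dots> = (\<Sum>a\<in>LI m. hh a c * N (Suc m) (a @ [x]) b)
      - (\<Sum>a\<in>LI m. hh a c * (\<Sum>e<K (Suc m). hh (a @ [x]) e * (\<Sum>a'\<in>LI (Suc m). hh a' e * N (Suc m) a' b)))"
    by (simp only: G_def right_diff_distrib sum_subtractf)
  also have "\<dots> = Q (Suc m) (\<lambda>b. TX m c (x # b)) b - (\<Sum>e<K (Suc m). A (Suc m) c x e * Q (Suc m) (TX (Suc m) e) b)"
  proof -
    have N1: "(\<Sum>a\<in>LI m. hh a c * N (Suc m) (a @ [x]) b) = Q (Suc m) (\<lambda>b. TX m c (x # b)) b"
      using head_N[where m = m and c = c and m' = "Suc m" and w = "[x]" and b = b] by simp
    have N2: "(\<Sum>a\<in>LI (Suc m). hh a e * N (Suc m) a b) = Q (Suc m) (TX (Suc m) e) b" for e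
      using head_N[where m = "Suc m" and c = e and m' = "Suc m" and w = "[]" and b = b] by simp
    show ?thesis unfolding N1 N2 sum_vec_mat_vec using head_head_Suc[of m c] m c by simp
  qed
  also have "\<dots> = Q (Suc m) (nE (Suc m) c x) b"
    by (simp add: nE_def[abs_def] Q_diff Q_sum)
  finally show ?thesis .
qed

lemma tangent_TX:
  assumes "m \<le> d - 1" "c < K m" "b \<in> RI m"
  shows "ntg b (Suc m) c = TX m c b"
  using assms
proof (induction m arbitrary: c b rule: inc_induct)
  case base
  then obtain x where "b = [x]" using RI_last by auto
  then show ?case using d2 Kd Sd by (simp add: nX_def)
next
  case (step m)
  then have m: "Suc m < d" by auto
  obtain x b' where b: "b = x # b'" "x < n (Suc m)" "b' \<in> RI (Suc m)"
    using step.prems m RI_Cons[of m b] by auto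
  have IH: "ntg b' (Suc (Suc m)) e = TX (Suc m) e b'" if "e < K (Suc m)" for e
    using step.IH[of e b'] that b by simp
  have ex: "nex b' (Suc (Suc m)) \<tau> = R (Suc m) \<tau> b'" if "\<tau> < S (Suc m)" for \<tau>
    using excursion_eq[of "Suc m" \<tau> b'] that b m by simp
  have "ntg b (Suc m) c = (\<Sum>e<K (Suc m). A (Suc m) c x e * TX (Suc m) e b') + Q (Suc m) (nE (Suc m) c x) b'
      + (\<Sum>e<K (Suc m). (\<Sum>b\<in>RI (Suc m). nE (Suc m) c x b * D (Suc m) b e) * tn b' (Suc (Suc m)) e)"
    using m by (simp add: b(1) IH ex nX_def nE_step[OF m b(3,2) step.prems(1)])
  also have "\<dots> = (\<Sum>e<K (Suc m). A (Suc m) c x e * TX (Suc m) e b') + nE (Suc m) c x b'"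
    using Q_split[where m = "Suc m" and f = "nE (Suc m) c x" and b = b'] by linarith
  finally show ?case by (simp add: b(1) nE_def)
qed

lemma tangent_eq: "j \<in> idx (sizes n 1 d) \<Longrightarrow> ntg j 1 0 = v j"
  using tangent_TX[of 0 0 j] K0 by (simp add: TX_def)

section \<open>Orthogonality conditions for the constructed cores\<close>

lemma nU_orth:
  assumes "Suc m < d" "\<tau> < S (Suc m)" "e < K (Suc m)"
  shows "(\<Sum>c<K m. \<Sum>x<n (Suc m). A (Suc m) c x e * nU (Suc m) c x \<tau>) = 0"
proof -
  have "(\<Sum>a\<in>LI (Suc m). hh a e * L (Suc m) a \<tau>) = (\<Sum>a\<in>LI m. \<Sum>x<n (Suc m). \<Sum>c<K m. hh a c * A (Suc m) c x e * L (Suc m) (a @ [x]) \<tau>)"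
    unfolding sum_left_snoc by (intro sum.cong refl) (simp only: head_Suc sum_distrib_right)
  also have "\<dots> = (\<Sum>x<n (Suc m). \<Sum>a\<in>LI m. \<Sum>c<K m. hh a c * A (Suc m) c x e * L (Suc m) (a @ [x]) \<tau>)"
    by (rule sum.swap)
  also have "\<dots> = (\<Sum>x<n (Suc m). \<Sum>c<K m. \<Sum>a\<in>LI m. hh a c * A (Suc m) c x e * L (Suc m) (a @ [x]) \<tau>)"
    by (intro sum.cong refl sum.swap)
  also have "\<dots> = (\<Sum>c<K m. \<Sum>x<n (Suc m). \<Sum>a\<in>LI m. hh a c * A (Suc m) c x e * L (Suc m) (a @ [x]) \<tau>)"
    by (rule sum.swap)
  also have "\<dots> = (\<Sum>c<K m. \<Sum>x<n (Suc m). A (Suc m) c x e * nU (Suc m) c x \<tau>)"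
    by (simp add: nU_def sum_distrib_left mult_ac)
  finally show ?thesis using HL[of "Suc m" e \<tau>] assms by simp
qed

text \<open>Contracting \<open>TX m\<close> with the core of \<open>A\<close> gives
  \<open>TX (Suc m)\<close>, and by left orthogonality so does contracting the subtracted part
  through \<open>A\<close>. Hence \<open>nE\<close> is annihilated, and \<open>nX\<close> inherits
  this.\<close>

lemma nX_orth:
  assumes "Suc m < d" "e' < K (Suc m)" "e < K (Suc m)"
  shows "(\<Sum>c<K m. \<Sum>x<n (Suc m). A (Suc m) c x e * nX (Suc m) c x e') = 0"
proof -
  have "(\<Sum>c<K m. \<Sum>x<n (Suc m). A (Suc m) c x e * nE (Suc m) c x b) = 0" for b
  proof -
    have "(\<Sum>c<K m. \<Sum>x<n (Suc m). A (Suc m) c x e * (\<Sum>e'<K (Suc m). A (Suc m) c x e' * TX (Suc m) e' b))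
        = (\<Sum>e'<K (Suc m). (if e = e' then 1 else 0) * TX (Suc m) e' b)"
      by (rule sum2_contract) (use orthA[of "Suc m" e] assms in simp)
    then show ?thesis using TX_Suc[of m e b] assms
      by (simp add: nE_def right_diff_distrib sum_subtractf sum_delta_mult)
  qed
  moreover have "(\<Sum>c<K m. \<Sum>x<n (Suc m). A (Suc m) c x e * nX (Suc m) c x e')
      = (\<Sum>b\<in>RI (Suc m). (\<Sum>c<K m. \<Sum>x<n (Suc m). A (Suc m) c x e * nE (Suc m) c x b) * D (Suc m) b e')"
  proof -
    have "(\<Sum>c<K m. \<Sum>x<n (Suc m). A (Suc m) c x e * nX (Suc m) c x e')
        = (\<Sum>c<K m. \<Sum>x<n (Suc m). A (Suc m) c x e * (\<Sum>b\<in>RI (Suc m). nE (Suc m) c x b * D (Suc m) b e'))"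
      using assms by (simp add: nX_def)
    also have "\<dots> = (\<Sum>b\<in>RI (Suc m). (\<Sum>c<K m. \<Sum>x<n (Suc m). A (Suc m) c x e * nE (Suc m) c x b) * D (Suc m) b e')"
      by (rule sum2_contract) simp
    finally show ?thesis .
  qed
  ultimately show ?thesis by simp
qed

lemma R_orth:
  assumes m: "m \<in> {1..<d}" and "\<sigma> < S m" "e < K m"
  shows "(\<Sum>b\<in>RI m. R m \<sigma> b * tn b (Suc m) e) = 0"
proof -
  have "(\<Sum>b\<in>RI m. R m \<sigma> b * tn b (Suc m) e) = (\<Sum>a\<in>LI m. L m a \<sigma> * (\<Sum>b\<in>RI m. N m a b * tn b (Suc m) e))"
    unfolding sum_vec_mat_vec R_N[OF m assms(2)] ..
  then show ?thesis by (simp add: N_def Q_orth[OF m assms(3)])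
qed

text \<open>Before the end, the part through \<open>nV\<close> is \<open>R m\<close> minus its
  projection. The former is orthogonal to the tails by \<open>R_orth\<close>, the latter because a
  tail with its first index fixed is a combination of the next tails.\<close>

lemma nV_orth:
  assumes m: "m \<in> {1..<d}" and \<sigma>: "\<sigma> < S m" and e: "e < K m"
  shows "(\<Sum>x<n (Suc m). \<Sum>b\<in>RI (Suc m). (\<Sum>\<beta><K (Suc m). nV (Suc m) \<sigma> x \<beta> * tn b (Suc (Suc m)) \<beta>) * tn (x # b) (Suc m) e) = 0"
proof -
  have R0: "(\<Sum>x<n (Suc m). \<Sum>b\<in>RI (Suc m). R m \<sigma> (x # b) * tn (x # b) (Suc m) e) = 0"
    using R_orth[OF m \<sigma> e] m sum_right_Cons[of "Suc m" d "\<lambda>b. R m \<sigma> b * tn b (Suc m) e" n] by simp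
  show ?thesis
  proof (cases "Suc m = d")
    case True
    then have "nV (Suc m) \<sigma> x \<beta> = R m \<sigma> [x]" for x \<beta> using m by (auto simp: nV_def)
    then show ?thesis using R0 True Kd by simp
  next
    case False
    then have m': "Suc m \<in> {1..<d}" using m by simp
    have V: "(\<Sum>\<beta><K (Suc m). nV (Suc m) \<sigma> x \<beta> * tn b (Suc (Suc m)) \<beta>) = R m \<sigma> (x # b) - Q (Suc m) (\<lambda>b. R m \<sigma> (x # b)) b" for x b
      using False by (simp add: nV_def Q_def)
    have "(\<Sum>b\<in>RI (Suc m). Q (Suc m) f b * tn (x # b) (Suc m) e) = 0" for f x
    proof -
      have "(\<Sum>b\<in>RI (Suc m). Q (Suc m) f b * tn (x # b) (Suc m) e)
         = (\<Sum>b\<in>RI (Suc m). Q (Suc m) f b * (\<Sum>\<beta><K (Suc m). tn b (Suc (Suc m)) \<beta> * A (Suc m) e x \<beta>))"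
        by (simp add: mult.commute)
      then show ?thesis unfolding sum_vec_mat_vec by (simp add: Q_orth[OF m'])
    qed
    then show ?thesis unfolding V left_diff_distrib sum_subtractf using R0 by simp
  qed
qed

lemma normal_tt_param: "tt_param d n K S A nU nX nV"
proof
  fix i e \<tau> assume "i \<in> {1..<d}" "e < K i" "\<tau> < S i"
  then show "(\<Sum>\<alpha><K (i - 1). \<Sum>x<n i. A i \<alpha> x e * nU i \<alpha> x \<tau>) = 0"
    using nU_orth[of "i - 1" \<tau> e] by simp
next
  fix i e e' assume "i \<in> {1..<d}" "e < K i" "e' < K i"
  then show "(\<Sum>\<alpha><K (i - 1). \<Sum>x<n i. A i \<alpha> x e * nX i \<alpha> x e') = 0"
    using nX_orth[of "i - 1" e' e] by simp
next
  fix i \<sigma> e assume i: "i \<in> {2..d}" "\<sigma> < S (i - 1)" "e < K (i - 1)"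
  then have "i - 1 \<in> {1..<d}" by auto
  then show "(\<Sum>x<n i. \<Sum>b\<in>RI i.
      (\<Sum>\<beta><K i. nV i \<sigma> x \<beta> * tn b (Suc i) \<beta>) * tn (x # b) i e) = 0"
    using nV_orth[of "i - 1" \<sigma> e] i by simp
qed (use d2 K0 Kd Sd orthA in auto)

end

text \<open>Here \<open>\<rho>\<close> is the size of an orthonormal basis \<open>\<Phi>\<close> of
  the column space of \<open>G m\<close>. The heads and \<open>D m\<close> compress the unfolding of
  \<open>A\<close> to the identity, \<open>\<Phi>\<close> provides rows and \<open>w\<close> columns
  annihilating it, and between these \<open>v\<close> acts as the identity; so
  \<open>tangent_rank_bound\<close> yields \<open>K m + \<rho> \<le> r\<close>.\<close>

lemma (in tangent_data) normal_factorization: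
  fixes x :: "nat \<Rightarrow> nat list \<Rightarrow> real" and c :: "nat \<Rightarrow> real"
  assumes m: "m \<in> {1..<d}"
    and rank: "\<And>l. factors (LI m) (RI m) r (\<lambda>a b. x l (a @ b))"
    and lim: "\<And>a b. a \<in> LI m \<Longrightarrow> b \<in> RI m \<Longrightarrow> (\<lambda>l. x l (a @ b)) \<longlonglongrightarrow> tn (a @ b) 1 0"
    and lim': "\<And>a b. a \<in> LI m \<Longrightarrow> b \<in> RI m \<Longrightarrow> (\<lambda>l. c l * (x l (a @ b) - tn (a @ b) 1 0)) \<longlonglongrightarrow> v (a @ b)"
    and r: "r \<le> K m + s"
  obtains L where
    "\<And>a b. a \<in> LI m \<Longrightarrow> b \<in> RI m \<Longrightarrow> G m a b = (\<Sum>\<tau><s. L a \<tau> * (\<Sum>a'\<in>LI m. L a' \<tau> * G m a' b))"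
    "\<And>e \<tau>. e < K m \<Longrightarrow> \<tau> < s \<Longrightarrow> (\<Sum>a\<in>LI m. hh a e * L a \<tau>) = 0"
proof (rule orthonormal_factorization[of "LI m" "RI m" "G m"], goal_cases)
  case (3 \<rho> \<Phi> M)
  note that = 3(1) and orth = 3(2) and span = 3(3) and repr = 3(4)
  have md: "m < d" using m by simp
  have hG: "(\<Sum>a\<in>LI m. hh a e * G m a b) = 0" if "e < K m" for e b
  proof -
    have "(\<Sum>a\<in>LI m. hh a e * (\<Sum>e'<K m. hh a e' * (\<Sum>a'\<in>LI m. hh a' e' * N m a' b)))
       = (\<Sum>e'<K m. (if e = e' then 1 else 0) * (\<Sum>a'\<in>LI m. hh a' e' * N m a' b))"
      unfolding sum_vec_mat_vec using head_orth[OF md that] by (intro sum.cong refl) simp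
    then show ?thesis using that by (simp add: G_def right_diff_distrib sum_subtractf sum_delta_mult)
  qed
  have h\<Phi>: "(\<Sum>a\<in>LI m. hh a e * \<Phi> a \<tau>) = 0" if "e < K m" "\<tau> < \<rho>" for e \<tau>
  proof -
    have "(\<Sum>a\<in>LI m. hh a e * \<Phi> a \<tau>) = (\<Sum>a\<in>LI m. hh a e * (\<Sum>b\<in>RI m. G m a b * M b \<tau>))"
      by (intro sum.cong refl) (simp only: span[OF _ that(2)])
    then show ?thesis unfolding sum_vec_mat_vec using hG[OF that(1)] by simp
  qed
  have \<Phi>h: "(\<Sum>a\<in>LI m. \<Phi> a \<tau> * (\<Sum>e<K m. hh a e * g e)) = 0" if "\<tau> < \<rho>" for \<tau> g
    unfolding sum_vec_mat_vec using h\<Phi>[OF _ that] by (simp add: mult.commute)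
  \<comment> \<open>\<open>M\<close> writes \<open>\<Phi>\<close> as combinations of columns of
    \<open>G m\<close>. Correcting it by \<open>D\<close> shifts the projection \<open>Q m\<close>
    from the rows onto the columns, so that \<open>w\<close> is annihilated by the unfolding of
    \<open>A\<close>.\<close>
  define w where "w b \<tau> = M b \<tau> - (\<Sum>e<K m. D m b e * (\<Sum>b'\<in>RI m. tn b' (Suc m) e * M b' \<tau>))" for b \<tau>
  have fw: "(\<Sum>b\<in>RI m. f b * w b \<tau>) = (\<Sum>b\<in>RI m. Q m f b * M b \<tau>)" for f \<tau>
  proof -
    have "(\<Sum>b\<in>RI m. f b * (\<Sum>e<K m. D m b e * (\<Sum>b'\<in>RI m. tn b' (Suc m) e * M b' \<tau>)))
       = (\<Sum>b'\<in>RI m. (\<Sum>e<K m. (\<Sum>b\<in>RI m. f b * D m b e) * tn b' (Suc m) e) * M b' \<tau>)"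
      unfolding sum_vec_mat_vec ..
    then show ?thesis by (simp add: w_def Q_def right_diff_distrib left_diff_distrib sum_subtractf)
  qed
  have "K m + \<rho> \<le> r"
  proof (rule tangent_rank_bound[where I = "LI m" and J = "RI m" and x = "\<lambda>l a b. x l (a @ b)"
      and A = "\<lambda>a b. tn (a @ b) 1 0" and \<xi> = "\<lambda>a b. v (a @ b)" and a = c
      and p = "\<lambda>e a. hh a e" and q = "D m" and u = "\<lambda>\<tau> a. \<Phi> a \<tau>" and v = w])
    show "finite (LI m)" "finite (RI m)" by simp_all
    show "factors (LI m) (RI m) r (\<lambda>a b. x l (a @ b))" for l by (rule rank)
    show "(\<lambda>l. x l (a @ b)) \<longlonglongrightarrow> tn (a @ b) 1 0" if "a \<in> LI m" "b \<in> RI m" for a b by (rule lim[OF that])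
    show "(\<lambda>l. c l * (x l (a @ b) - tn (a @ b) 1 0)) \<longlonglongrightarrow> v (a @ b)" if "a \<in> LI m" "b \<in> RI m" for a b
      by (rule lim'[OF that])
    show "(\<Sum>a\<in>LI m. \<Sum>b\<in>RI m. hh a e * tn (a @ b) 1 0 * D m b e') = (if e = e' then 1 else 0)"
      if "e < K m" "e' < K m" for e e'
    proof -
      have "(\<Sum>a\<in>LI m. \<Sum>b\<in>RI m. hh a e * tn (a @ b) 1 0 * D m b e')
         = (\<Sum>a\<in>LI m. hh a e * (\<Sum>b\<in>RI m. tn (a @ b) 1 0 * D m b e'))"
        by (simp add: sum_distrib_left mult.assoc)
      also have "\<dots> = (\<Sum>b\<in>RI m. tn b (Suc m) e * D m b e')"
        unfolding sum_vec_mat_vec head_train[OF md that(1)] ..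
      finally show ?thesis using TD[OF m that] by simp
    qed
    show "(\<Sum>a\<in>LI m. \<Phi> a \<tau> * tn (a @ b) 1 0) = 0" if "\<tau> < \<rho>" for \<tau> b
    proof -
      have "(\<Sum>a\<in>LI m. \<Phi> a \<tau> * tn (a @ b) 1 0) = (\<Sum>a\<in>LI m. \<Phi> a \<tau> * (\<Sum>e<K m. hh a e * tn b (Suc m) e))"
        by (intro sum.cong refl) (simp only: train_split)
      then show ?thesis using \<Phi>h[OF that] by simp
    qed
    show "(\<Sum>b\<in>RI m. tn (a @ b) 1 0 * w b \<tau>) = 0" if "a \<in> LI m" for a \<tau>
    proof -
      have "Q m (\<lambda>b. tn (a @ b) 1 0) b = 0" for b
        unfolding train_split[OF that] Q_sum by (simp add: Q_train[OF m])
      then show ?thesis unfolding fw by simp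
    qed
    show "(\<Sum>a\<in>LI m. \<Sum>b\<in>RI m. \<Phi> a \<tau> * v (a @ b) * w b \<tau>') = (if \<tau> = \<tau>' then 1 else 0)"
      if "\<tau> < \<rho>" "\<tau>' < \<rho>" for \<tau> \<tau>'
    proof -
      have "(\<Sum>a\<in>LI m. \<Sum>b\<in>RI m. \<Phi> a \<tau> * v (a @ b) * w b \<tau>') = (\<Sum>a\<in>LI m. \<Phi> a \<tau> * (\<Sum>b\<in>RI m. v (a @ b) * w b \<tau>'))"
        by (simp add: sum_distrib_left mult.assoc)
      also have "\<dots> = (\<Sum>a\<in>LI m. \<Phi> a \<tau> * (\<Sum>b\<in>RI m. N m a b * M b \<tau>'))"
        by (simp only: fw N_def)
      also have "\<dots> = (\<Sum>a\<in>LI m. \<Phi> a \<tau> * (\<Sum>b\<in>RI m. G m a b * M b \<tau>'))"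
      proof -
        have "(\<Sum>b\<in>RI m. N m a b * M b \<tau>') = (\<Sum>b\<in>RI m. G m a b * M b \<tau>')
            + (\<Sum>e<K m. hh a e * (\<Sum>b\<in>RI m. (\<Sum>a'\<in>LI m. hh a' e * N m a' b) * M b \<tau>'))" for a
          using sum_vec_mat_vec[where \<mu> = "\<lambda>e. hh a e" and M = "\<lambda>e b. \<Sum>a'\<in>LI m. hh a' e * N m a' b"
              and t = "\<lambda>b. M b \<tau>'" and I = "{..<K m}" and J = "RI m"]
          by (simp add: G_def left_diff_distrib sum_subtractf)
        then show ?thesis using \<Phi>h[OF that(1)] by (simp add: distrib_left sum.distrib)
      qed
      also have "\<dots> = (\<Sum>a\<in>LI m. \<Phi> a \<tau> * \<Phi> a \<tau>')"
        by (intro sum.cong refl) (simp only: span[OF _ that(2)])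
      finally show ?thesis using orth[OF that] by simp
    qed
  qed
  then have \<rho>: "\<rho> \<le> s" using r by simp
  show ?case
  \<comment> \<open>Zero columns fill up to \<open>s\<close> and do not affect the
    reconstruction.\<close>
  proof (rule that[of "\<lambda>a \<tau>. if \<tau> < \<rho> then \<Phi> a \<tau> else 0"])
    fix a b assume ab: "a \<in> LI m" "b \<in> RI m"
    have "(\<Sum>\<tau><s. (if \<tau> < \<rho> then \<Phi> a \<tau> else 0) * (\<Sum>a'\<in>LI m. (if \<tau> < \<rho> then \<Phi> a' \<tau> else 0) * G m a' b))
       = (\<Sum>\<tau><s. if \<tau> < \<rho> then \<Phi> a \<tau> * (\<Sum>a'\<in>LI m. \<Phi> a' \<tau> * G m a' b) else 0)"
      by (rule sum.cong) auto
    also have "\<dots> = G m a b" unfolding sum_lessThan_pad[OF \<rho>] by (rule repr[OF ab, symmetric])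
    finally show "G m a b = (\<Sum>\<tau><s. (if \<tau> < \<rho> then \<Phi> a \<tau> else 0) * (\<Sum>a'\<in>LI m. (if \<tau> < \<rho> then \<Phi> a' \<tau> else 0) * G m a' b))" ..
  next
    fix e \<tau> assume "e < K m"
    then show "(\<Sum>a\<in>LI m. hh a e * (if \<tau> < \<rho> then \<Phi> a \<tau> else 0)) = 0"
      using h\<Phi>[of e \<tau>] by (cases "\<tau> < \<rho>") simp_all
  qed
qed simp_all

text \<open>With orthonormal bases \<open>\<Phi>\<close> of the column spaces of all unfoldings, a
  basis vector at \<open>Suc m\<close> with its last index fixed lies in the span of the basis at
  \<open>m\<close>. The coefficients form the cores, whose left orthogonality follows from that of
  two successive bases, and the last core is the tail \<open>Y (d - 1)\<close>.\<close>

lemma left_orthogonal_cores: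
  fixes t :: "nat list \<Rightarrow> real" and K S :: "nat \<Rightarrow> nat"
  assumes d: "2 \<le> d" and K: "K 0 = 1" "K d = 1" "S d = 0"
    and fact: "\<And>m. m \<in> {1..<d} \<Longrightarrow> factors (idx (sizes n 1 m)) (idx (sizes n (Suc m) d)) (K m) (\<lambda>a b. t (a @ b))"
    and minimal: "\<And>m r. m \<in> {1..<d} \<Longrightarrow>
      factors (idx (sizes n 1 m)) (idx (sizes n (Suc m) d)) r (\<lambda>a b. t (a @ b)) \<Longrightarrow> K m \<le> r"
  obtains A where "tt_param d n K S A (\<lambda>_ _ _ _. 0) (\<lambda>_ _ _ _. 0) (\<lambda>_ _ _ _. 0)"
    "\<And>j. j \<in> idx (sizes n 1 d) \<Longrightarrow> train K A j 1 0 = t j"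
proof -
  let ?LI = "\<lambda>m. idx (sizes n 1 m)" and ?RI = "\<lambda>m. idx (sizes n (Suc m) d)"
  \<comment> \<open>The last clause spares position zero: the bond there has size one even for
    \<open>t = 0\<close>, when the column space contains no unit vector.\<close>
  define good where "good m \<Phi> \<longleftrightarrow>
      (\<forall>c<K m. \<forall>c'<K m. (\<Sum>a\<in>?LI m. \<Phi> a c * \<Phi> a c') = (if c = c' then 1 else 0 :: real)) \<and>
      (\<forall>a\<in>?LI m. \<forall>b\<in>?RI m. t (a @ b) = (\<Sum>c<K m. \<Phi> a c * (\<Sum>a'\<in>?LI m. \<Phi> a' c * t (a' @ b)))) \<and>
      (m \<noteq> 0 \<longrightarrow> (\<exists>M. \<forall>a\<in>?LI m. \<forall>c<K m. \<Phi> a c = (\<Sum>b\<in>?RI m. t (a @ b) * M b c)))" for m \<Phi>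
  have "\<exists>\<Phi>. good m \<Phi>" if "m < d" for m
  proof (cases "m = 0")
    case True
    then show ?thesis by (intro exI[of _ "\<lambda>_ _. 1"]) (simp add: good_def K)
  next
    case False
    then have m: "m \<in> {1..<d}" using that by simp
    show ?thesis
    proof (rule orthonormal_factorization[of "?LI m" "?RI m" "\<lambda>a b. t (a @ b)"], goal_cases)
      case (3 k \<Phi> M)
      note orth = 3(1) and span = 3(2) and repr = 3(3)
      have "factors (?LI m) (?RI m) k (\<lambda>a b. t (a @ b))"
        unfolding factors_def
      proof (intro exI ballI)
        fix a b assume "a \<in> ?LI m" "b \<in> ?RI m"
        then show "t (a @ b) = (\<Sum>c<k. \<Phi> a c * (\<lambda>c b. \<Sum>a'\<in>?LI m. \<Phi> a' c * t (a' @ b)) c b)"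
          by (rule repr)
      qed
      then have "K m \<le> k" by (rule minimal[OF m])
      moreover have "k \<le> K m"
      proof (rule factors_lower_bound[OF fact[OF m], where p = "\<lambda>c a. \<Phi> a c" and q = M])
        fix c c' assume "c < k" "c' < k"
        have "(\<Sum>a\<in>?LI m. \<Sum>b\<in>?RI m. \<Phi> a c * t (a @ b) * M b c') = (\<Sum>a\<in>?LI m. \<Phi> a c * (\<Sum>b\<in>?RI m. t (a @ b) * M b c'))"
          by (simp add: sum_distrib_left mult.assoc)
        also have "\<dots> = (\<Sum>a\<in>?LI m. \<Phi> a c * \<Phi> a c')"
          by (intro sum.cong refl) (simp only: span[OF _ \<open>c' < k\<close>])
        finally show "(\<Sum>a\<in>?LI m. \<Sum>b\<in>?RI m. \<Phi> a c * t (a @ b) * M b c') = (if c = c' then 1 else 0)"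
          using orth[OF \<open>c < k\<close> \<open>c' < k\<close>] by simp
      qed
      ultimately have k: "k = K m" by simp
      have 1: "\<forall>c<K m. \<forall>c'<K m. (\<Sum>a\<in>?LI m. \<Phi> a c * \<Phi> a c') = (if c = c' then 1 else 0)"
        by (intro allI impI) (rule orth[unfolded k])
      have 2: "\<forall>a\<in>?LI m. \<forall>b\<in>?RI m. t (a @ b) = (\<Sum>c<K m. \<Phi> a c * (\<Sum>a'\<in>?LI m. \<Phi> a' c * t (a' @ b)))"
        by (intro ballI) (rule repr[unfolded k])
      have 3: "\<forall>a\<in>?LI m. \<forall>c<K m. \<Phi> a c = (\<Sum>b\<in>?RI m. t (a @ b) * M b c)"
        by (intro ballI allI impI) (rule span[unfolded k])
      show ?case unfolding good_def
        by (rule exI[of _ \<Phi>]) (intro conjI impI 1 2 exI[of _ M] 3)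
    qed simp_all
  qed
  then have "\<forall>m. \<exists>\<Phi>. m < d \<longrightarrow> good m \<Phi>" by blast
  then obtain \<Phi>' where good': "\<forall>m. m < d \<longrightarrow> good m (\<Phi>' m)"
    by (rule choice[THEN exE])
  \<comment> \<open>At position zero a sign is still free; fixing it makes the full train equal to
    \<open>t\<close> and not to its negative.\<close>
  define \<Phi> where "\<Phi> m = (if m = 0 then (\<lambda>_ _. 1) else \<Phi>' m)" for m
  have good: "good m (\<Phi> m)" if "m < d" for m
  proof (cases "m = 0")
    case True
    then show ?thesis by (simp add: \<Phi>_def good_def K)
  next
    case False
    then show ?thesis using good'[THEN spec, THEN mp, OF that] unfolding \<Phi>_def by (simp only: if_False)
  qed
  have orth: "(\<Sum>a\<in>?LI m. \<Phi> m a c * \<Phi> m a c') = (if c = c' then 1 else 0)" if "m < d" "c < K m" "c' < K m" for m c c'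
    using good[OF that(1)] that(2,3) unfolding good_def by blast
  define Y where "Y m c b = (\<Sum>a\<in>?LI m. \<Phi> m a c * t (a @ b))" for m c b
  have repr: "t (a @ b) = (\<Sum>c<K m. \<Phi> m a c * Y m c b)" if "m < d" "a \<in> ?LI m" "b \<in> ?RI m" for m a b
    using good[OF that(1)] that(2,3) unfolding good_def Y_def by blast
  have isometry: "(\<Sum>a\<in>?LI m. \<Phi> m a c * (\<Sum>c'<K m. \<Phi> m a c' * f c')) = f c" if "m < d" "c < K m" for m c f
  proof -
    have "(\<Sum>a\<in>?LI m. \<Phi> m a c * (\<Sum>c'<K m. \<Phi> m a c' * f c')) = (\<Sum>c'<K m. (if c = c' then 1 else 0) * f c')"
      unfolding sum_vec_mat_vec using orth[OF that] by (intro sum.cong refl) simp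
    then show ?thesis using that by (simp add: sum_delta_mult)
  qed
  have inner: "(\<Sum>a\<in>?LI m. (\<Sum>c<K m. \<Phi> m a c * f c) * (\<Sum>c<K m. \<Phi> m a c * g c)) = (\<Sum>c<K m. f c * g c)"
    if "m < d" for m f g
  proof -
    have "(\<Sum>a\<in>?LI m. (\<Sum>c<K m. \<Phi> m a c * g c) * (\<Sum>c<K m. \<Phi> m a c * f c))
       = (\<Sum>c<K m. (\<Sum>a\<in>?LI m. (\<Sum>c<K m. \<Phi> m a c * g c) * \<Phi> m a c) * f c)"
      by (rule sum_vec_mat_vec)
    also have "\<dots> = (\<Sum>c<K m. g c * f c)"
      using isometry[OF that, of _ g] by (intro sum.cong refl) (simp only: lessThan_iff mult.commute[of _ "\<Phi> m _ _"])
    finally show ?thesis by (simp only: mult.commute)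
  qed
  define A where "A i \<alpha> x \<beta> = (if i = d then Y (d - 1) \<alpha> [x] else (\<Sum>a\<in>?LI (i - 1). \<Phi> (i - 1) a \<alpha> * \<Phi> i (a @ [x]) \<beta>))" for i \<alpha> x \<beta>
  have mem: "a @ [x] \<in> ?LI (Suc m)" if "a \<in> ?LI m" "x < n (Suc m)" for a x m
    unfolding sizes_snoc using that length_idx[OF that(1)] by simp
  have \<Phi>_Suc: "\<Phi> (Suc m) (a @ [x]) \<beta> = (\<Sum>\<alpha><K m. \<Phi> m a \<alpha> * A (Suc m) \<alpha> x \<beta>)"
    if m: "Suc m < d" and a: "a \<in> ?LI m" and x: "x < n (Suc m)" and \<beta>: "\<beta> < K (Suc m)" for m a x \<beta>
  proof -
    \<comment> \<open>The basis vector is a combination of columns of \<open>t\<close>; with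
      \<open>x\<close> fixed these are columns of the unfolding at \<open>m\<close>, which the basis
      at \<open>m\<close> spans.\<close>
    obtain M where M: "\<And>a. a \<in> ?LI (Suc m) \<Longrightarrow> \<Phi> (Suc m) a \<beta> = (\<Sum>b\<in>?RI (Suc m). t (a @ b) * M b \<beta>)"
      using good[OF m] \<beta> unfolding good_def by blast
    define f where "f \<alpha> = (\<Sum>b\<in>?RI (Suc m). M b \<beta> * Y m \<alpha> (x # b))" for \<alpha>
    have \<Phi>f: "\<Phi> (Suc m) (a @ [x]) \<beta> = (\<Sum>\<alpha><K m. \<Phi> m a \<alpha> * f \<alpha>)" if a: "a \<in> ?LI m" for a
    proof -
      have "\<Phi> (Suc m) (a @ [x]) \<beta> = (\<Sum>b\<in>?RI (Suc m). M b \<beta> * (\<Sum>\<alpha><K m. Y m \<alpha> (x # b) * \<Phi> m a \<alpha>))"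
      proof (subst M[OF mem[OF a x]], rule sum.cong[OF refl])
        fix b assume "b \<in> ?RI (Suc m)"
        then have "x # b \<in> ?RI m" using x m by (simp add: sizes_Cons[of "Suc m"])
        then have "t (a @ x # b) = (\<Sum>\<alpha><K m. Y m \<alpha> (x # b) * \<Phi> m a \<alpha>)"
          using repr[of m a "x # b"] m a by (simp add: mult.commute)
        then show "t ((a @ [x]) @ b) * M b \<beta> = M b \<beta> * (\<Sum>\<alpha><K m. Y m \<alpha> (x # b) * \<Phi> m a \<alpha>)" by simp
      qed
      then show ?thesis unfolding sum_vec_mat_vec f_def by (simp add: mult.commute)
    qed
    have "A (Suc m) \<alpha> x \<beta> = f \<alpha>" if "\<alpha> < K m" for \<alpha>
    proof -
      have "A (Suc m) \<alpha> x \<beta> = (\<Sum>a\<in>?LI m. \<Phi> m a \<alpha> * (\<Sum>\<alpha>'<K m. \<Phi> m a \<alpha>' * f \<alpha>'))"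
        using m by (simp add: A_def \<Phi>f)
      then show ?thesis using isometry[OF _ that] m by simp
    qed
    then show ?thesis using \<Phi>f[OF a] by simp
  qed
  have orthA: "(\<Sum>\<alpha><K (i - 1). \<Sum>x<n i. A i \<alpha> x e * A i \<alpha> x e') = (if e = e' then 1 else 0)"
    if i: "i \<in> {1..<d}" and e: "e < K i" "e' < K i" for i e e'
  proof -
    define m where "m = i - 1"
    have m: "i = Suc m" "Suc m < d" "m < d" using i by (auto simp: m_def)
    have "(\<Sum>a\<in>?LI m. \<Phi> (Suc m) (a @ [x]) e * \<Phi> (Suc m) (a @ [x]) e') = (\<Sum>\<alpha><K m. A (Suc m) \<alpha> x e * A (Suc m) \<alpha> x e')"
      if x: "x < n (Suc m)" for x
    proof -
      have "(\<Sum>a\<in>?LI m. \<Phi> (Suc m) (a @ [x]) e * \<Phi> (Suc m) (a @ [x]) e')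
          = (\<Sum>a\<in>?LI m. (\<Sum>\<alpha><K m. \<Phi> m a \<alpha> * A (Suc m) \<alpha> x e) * (\<Sum>\<alpha><K m. \<Phi> m a \<alpha> * A (Suc m) \<alpha> x e'))"
        using \<Phi>_Suc[OF m(2) _ x, of _ e] \<Phi>_Suc[OF m(2) _ x, of _ e'] e m by simp
      also have "\<dots> = (\<Sum>\<alpha><K m. A (Suc m) \<alpha> x e * A (Suc m) \<alpha> x e')"
        by (rule inner[OF m(3)])
      finally show ?thesis .
    qed
    then have "(\<Sum>x<n (Suc m). \<Sum>\<alpha><K m. A (Suc m) \<alpha> x e * A (Suc m) \<alpha> x e')
        = (\<Sum>x<n (Suc m). \<Sum>a\<in>?LI m. \<Phi> (Suc m) (a @ [x]) e * \<Phi> (Suc m) (a @ [x]) e')" by simp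
    also have "\<dots> = (\<Sum>a\<in>?LI (Suc m). \<Phi> (Suc m) a e * \<Phi> (Suc m) a e')"
      unfolding sum_left_snoc by (rule sum.swap)
    finally show ?thesis using orth[OF m(2), of e e'] e m by (subst sum.swap) simp
  qed
  have trainY: "train K A b (Suc m) c = Y m c b" if "m \<le> d - 1" "c < K m" "b \<in> ?RI m" for m c b
    using that
  proof (induction m arbitrary: c b rule: inc_induct)
    case base
    then obtain x where "b = [x]" using d by (auto simp: sizes_Cons idx_Cons)
    then show ?case using d K by (simp add: A_def)
  next
    case (step m)
    then have m: "Suc m < d" "m < d" by auto
    obtain x b' where b: "b = x # b'" "x < n (Suc m)" "b' \<in> ?RI (Suc m)"
      using step.prems(2) m by (auto simp: sizes_Cons[of "Suc m"] idx_Cons)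
    have "Y m c b = (\<Sum>a\<in>?LI m. \<Phi> m a c * (\<Sum>\<beta><K (Suc m). \<Phi> (Suc m) (a @ [x]) \<beta> * Y (Suc m) \<beta> b'))"
      unfolding Y_def[of m] b(1)
    proof (rule sum.cong[OF refl])
      fix a assume "a \<in> ?LI m"
      then show "\<Phi> m a c * t (a @ x # b') = \<Phi> m a c * (\<Sum>\<beta><K (Suc m). \<Phi> (Suc m) (a @ [x]) \<beta> * Y (Suc m) \<beta> b')"
        using repr[OF m(1) mem[OF _ b(2)] b(3)] by simp
    qed
    also have "\<dots> = (\<Sum>\<beta><K (Suc m). A (Suc m) c x \<beta> * Y (Suc m) \<beta> b')"
      unfolding sum_vec_mat_vec using m by (simp add: A_def)
    finally show ?case using step.IH b by (simp add: b(1))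
  qed
  show ?thesis
  proof (rule that[of A])
    show "tt_param d n K S A (\<lambda>_ _ _ _. 0) (\<lambda>_ _ _ _. 0) (\<lambda>_ _ _ _. 0)"
    proof
      show "(\<Sum>\<alpha><K (i - 1). \<Sum>x<n i. A i \<alpha> x e * A i \<alpha> x e') = (if e = e' then 1 else 0)"
        if "i \<in> {1..<d}" "e < K i" "e' < K i" for i e e'
        by (rule orthA[OF that])
      show "(\<Sum>\<alpha><K (i - 1). \<Sum>x<n i. A i \<alpha> x e * 0) = 0" for i e by simp
      show "(\<Sum>\<alpha><K (i - 1). \<Sum>x<n i. A i \<alpha> x e * 0) = 0" for i e by simp
      show "(\<Sum>x<n i. \<Sum>b\<in>?RI i. (\<Sum>\<beta><K i. 0 * train K A b (Suc i) \<beta>) * train K A (x # b) i e) = 0" for i e by simp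
    qed (fact d K)+
    show "train K A j 1 0 = t j" if "j \<in> idx (sizes n 1 d)" for j
      using trainY[of 0 0 j] that K by (simp add: Y_def \<Phi>_def)
  qed
qed

section \<open>Expansion along a ray\<close>

text \<open>An excursion can be left only through the scaled \<open>V\<close>, so its tails carry a
  factor \<open>t\<close> and have no constant term. Entering it through the unscaled
  \<open>U\<close> thus contributes to first order what it contributes to the tangent vector. Of the
  remainders only continuity is recorded.\<close>

lemma retract_expansion:
  fixes K S :: "nat \<Rightarrow> nat" and A U X Z V :: "nat \<Rightarrow> nat \<Rightarrow> nat \<Rightarrow> nat \<Rightarrow> real"
  defines "R \<equiv> \<lambda>t. retract K S A U (\<lambda>i \<alpha> x \<beta>. t * X i \<alpha> x \<beta>) Z (\<lambda>i \<alpha> x \<beta>. t * V i \<alpha> x \<beta>)"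
    and "T \<equiv> train K A" and "E \<equiv> excursion K S A Z V" and "G \<equiv> tangent K S A U X Z V"
  shows "(\<exists>p. \<forall>\<alpha>. continuous_on UNIV (p \<alpha>) \<and> (\<forall>t. R t b i (Inl \<alpha>) = T b i \<alpha> + t * G b i \<alpha> + t\<^sup>2 * p \<alpha> t)) \<and>
    (\<exists>q. \<forall>\<sigma>. continuous_on UNIV (q \<sigma>) \<and> (\<forall>t. R t b i (Inr \<sigma>) = t * E b i \<sigma> + t\<^sup>2 * q \<sigma> t))"
proof (induction b arbitrary: i)
  case Nil
  show ?case
    by (intro conjI; rule exI[of _ "\<lambda>_ _. 0"]) (simp_all add: R_def T_def E_def G_def)
next
  case (Cons x b)
  from Cons.IH[of "Suc i"] obtain p q where
    p: "\<forall>\<beta>. continuous_on UNIV (p \<beta>) \<and> (\<forall>t. R t b (Suc i) (Inl \<beta>) = T b (Suc i) \<beta> + t * G b (Suc i) \<beta> + t\<^sup>2 * p \<beta> t)"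
    and q: "\<forall>\<tau>. continuous_on UNIV (q \<tau>) \<and> (\<forall>t. R t b (Suc i) (Inr \<tau>) = t * E b (Suc i) \<tau> + t\<^sup>2 * q \<tau> t)"
    by (elim conjE exE) (rule that)
  have cont: "continuous_on UNIV (p \<beta>)" "continuous_on UNIV (q \<tau>)" for \<beta> \<tau>
    using p q by simp_all
  have Rb: "R t b (Suc i) (Inl \<beta>) = T b (Suc i) \<beta> + t * G b (Suc i) \<beta> + t\<^sup>2 * p \<beta> t"
    "R t b (Suc i) (Inr \<tau>) = t * E b (Suc i) \<tau> + t\<^sup>2 * q \<tau> t" for t \<beta> \<tau>
    using p q by simp_all
  define p' where "p' \<alpha> t = (\<Sum>\<beta><K i. A i \<alpha> x \<beta> * p \<beta> t + X i \<alpha> x \<beta> * (G b (Suc i) \<beta> + t * p \<beta> t))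
      + (\<Sum>\<tau><S i. U i \<alpha> x \<tau> * q \<tau> t)" for \<alpha> t
  define q' where "q' \<sigma> t = (\<Sum>\<beta><K i. V i \<sigma> x \<beta> * (G b (Suc i) \<beta> + t * p \<beta> t))
      + (\<Sum>\<tau><S i. Z i \<sigma> x \<tau> * q \<tau> t)" for \<sigma> t
  have "R t (x # b) i (Inl \<alpha>) = T (x # b) i \<alpha> + t * G (x # b) i \<alpha> + t\<^sup>2 * p' \<alpha> t" for t \<alpha>
  proof -
    have "R t (x # b) i (Inl \<alpha>) = (\<Sum>\<beta><K i. (A i \<alpha> x \<beta> + t * X i \<alpha> x \<beta>) * R t b (Suc i) (Inl \<beta>)) + (\<Sum>\<tau><S i. U i \<alpha> x \<tau> * R t b (Suc i) (Inr \<tau>))"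
      by (simp add: R_def)
    also have "(\<Sum>\<beta><K i. (A i \<alpha> x \<beta> + t * X i \<alpha> x \<beta>) * R t b (Suc i) (Inl \<beta>))
       = (\<Sum>\<beta><K i. A i \<alpha> x \<beta> * T b (Suc i) \<beta> + t * (A i \<alpha> x \<beta> * G b (Suc i) \<beta>) + t * (X i \<alpha> x \<beta> * T b (Suc i) \<beta>)
          + t\<^sup>2 * (A i \<alpha> x \<beta> * p \<beta> t + X i \<alpha> x \<beta> * (G b (Suc i) \<beta> + t * p \<beta> t)))"
      by (rule sum.cong[OF refl]) (simp add: Rb algebra_simps power2_eq_square)
    also have "(\<Sum>\<tau><S i. U i \<alpha> x \<tau> * R t b (Suc i) (Inr \<tau>)) = (\<Sum>\<tau><S i. t * (U i \<alpha> x \<tau> * E b (Suc i) \<tau>) + t\<^sup>2 * (U i \<alpha> x \<tau> * q \<tau> t))"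
      by (rule sum.cong[OF refl]) (simp add: Rb algebra_simps)
    finally show ?thesis
      unfolding p'_def T_def G_def E_def train.simps tangent.simps sum.distrib sum_distrib_left[symmetric]
      by (simp add: distrib_left)
  qed
  moreover have "R t (x # b) i (Inr \<sigma>) = t * E (x # b) i \<sigma> + t\<^sup>2 * q' \<sigma> t" for t \<sigma>
  proof -
    have "R t (x # b) i (Inr \<sigma>) = (\<Sum>\<beta><K i. t * V i \<sigma> x \<beta> * R t b (Suc i) (Inl \<beta>)) + (\<Sum>\<tau><S i. Z i \<sigma> x \<tau> * R t b (Suc i) (Inr \<tau>))"
      by (simp add: R_def)
    also have "(\<Sum>\<beta><K i. t * V i \<sigma> x \<beta> * R t b (Suc i) (Inl \<beta>))
       = (\<Sum>\<beta><K i. t * (V i \<sigma> x \<beta> * T b (Suc i) \<beta>) + t\<^sup>2 * (V i \<sigma> x \<beta> * (G b (Suc i) \<beta> + t * p \<beta> t)))"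
      by (rule sum.cong[OF refl]) (simp add: Rb algebra_simps power2_eq_square)
    also have "(\<Sum>\<tau><S i. Z i \<sigma> x \<tau> * R t b (Suc i) (Inr \<tau>)) = (\<Sum>\<tau><S i. t * (Z i \<sigma> x \<tau> * E b (Suc i) \<tau>) + t\<^sup>2 * (Z i \<sigma> x \<tau> * q \<tau> t))"
      by (rule sum.cong[OF refl]) (simp add: Rb algebra_simps)
    finally show ?thesis
      unfolding q'_def T_def E_def excursion.simps sum.distrib sum_distrib_left[symmetric]
      by (simp add: distrib_left)
  qed
  moreover have "continuous_on UNIV (p' \<alpha>)" "continuous_on UNIV (q' \<sigma>)" for \<alpha> \<sigma>
    unfolding p'_def q'_def by (intro continuous_intros cont)+
  ultimately show ?case by blast
qed

section \<open>From trains back to tensors\<close>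

lemma tendsto_fun_iff:
  fixes f :: "'a \<Rightarrow> 'b \<Rightarrow> real"
  shows "(f \<longlongrightarrow> l) F \<longleftrightarrow> (\<forall>i. ((\<lambda>x. f x i) \<longlongrightarrow> l i) F)"
  using limitin_componentwise[of "\<lambda>_::'b. euclidean :: real topology" UNIV f l F]
  by (simp add: euclidean_product_topology)

text \<open>The constructed cores are functions of all natural numbers, whereas tensors vanish
  outside their sizes. The two are compared only on the ranges reached by the sums.\<close>

definition agree :: "nat \<Rightarrow> (nat \<Rightarrow> nat) \<Rightarrow> (nat \<Rightarrow> nat) \<Rightarrow> (nat \<Rightarrow> nat) \<Rightarrow>
    (nat \<Rightarrow> nat \<Rightarrow> nat \<Rightarrow> nat \<Rightarrow> real) \<Rightarrow> (nat \<Rightarrow> nat \<Rightarrow> nat \<Rightarrow> nat \<Rightarrow> real) \<Rightarrow> bool" where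
  "agree d n P Q A A' \<longleftrightarrow>
     (\<forall>i\<in>{1..d}. \<forall>\<alpha><P (i - 1). \<forall>x<n i. \<forall>\<beta><Q i. A i \<alpha> x \<beta> = A' i \<alpha> x \<beta>)"

lemma agreeD:
  "agree d n P Q A A' \<Longrightarrow> 1 \<le> i \<Longrightarrow> i \<le> d \<Longrightarrow> \<alpha> < P (i - 1) \<Longrightarrow> x < n i \<Longrightarrow> \<beta> < Q i \<Longrightarrow> A i \<alpha> x \<beta> = A' i \<alpha> x \<beta>"
  unfolding agree_def by auto

lemma right_index_Cons:
  "x # b \<in> idx (sizes n i d) \<longleftrightarrow> i \<le> d \<and> x < n i \<and> b \<in> idx (sizes n (Suc i) d)"
  by (cases "i \<le> d") (auto simp: sizes_Cons[of i d])

text \<open>Serves to replace \<open>C(i := V i)\<close> by \<open>C\<close> in the tail after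
  position \<open>i\<close>.\<close>

lemma train_cong_above:
  assumes "\<And>j \<alpha> x \<beta>. l \<le> j \<Longrightarrow> j \<le> d \<Longrightarrow> A j \<alpha> x \<beta> = A' j \<alpha> x \<beta>"
    and "l \<le> i" "b \<in> idx (sizes n i d)"
  shows "train K A b i \<alpha> = train K A' b i \<alpha>"
  using assms(2,3)
  by (induction b arbitrary: i \<alpha>) (auto simp: right_index_Cons assms(1) intro!: sum.cong)

lemma train_cong:
  assumes "agree d n K K A A'" "1 \<le> i" "b \<in> idx (sizes n i d)" "\<alpha> < K (i - 1)"
  shows "train K A b i \<alpha> = train K A' b i \<alpha>"
  using assms(2-4)
proof (induction b arbitrary: i \<alpha>)
  case Nil
  show ?case by simp
next
  case (Cons x b)
  then have "i \<le> d" "x < n i" "b \<in> idx (sizes n (Suc i) d)" by (simp_all add: right_index_Cons)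
  then show ?case
    using Cons agreeD[OF assms(1)] by (auto intro!: sum.cong)
qed

lemma excursion_cong:
  assumes A: "agree d n K K A A'" and Z: "agree d n S S Z Z'" and V: "agree d n S K V V'"
    and "1 \<le> i" "b \<in> idx (sizes n i d)" "\<sigma> < S (i - 1)"
  shows "excursion K S A Z V b i \<sigma> = excursion K S A' Z' V' b i \<sigma>"
  using assms(4-)
proof (induction b arbitrary: i \<sigma>)
  case Nil
  show ?case by simp
next
  case (Cons x b)
  then have *: "i \<le> d" "x < n i" "b \<in> idx (sizes n (Suc i) d)" by (simp_all add: right_index_Cons)
  have "(\<Sum>\<beta><K i. V i \<sigma> x \<beta> * train K A b (Suc i) \<beta>) = (\<Sum>\<beta><K i. V' i \<sigma> x \<beta> * train K A' b (Suc i) \<beta>)"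
    by (rule sum.cong) (use Cons.prems * agreeD[OF V] train_cong[OF A, of "Suc i"] in auto)
  moreover have "(\<Sum>\<tau><S i. Z i \<sigma> x \<tau> * excursion K S A Z V b (Suc i) \<tau>) = (\<Sum>\<tau><S i. Z' i \<sigma> x \<tau> * excursion K S A' Z' V' b (Suc i) \<tau>)"
    by (rule sum.cong) (use Cons.prems * agreeD[OF Z] Cons.IH[of "Suc i"] in auto)
  ultimately show ?case by simp
qed

lemma tangent_cong:
  assumes A: "agree d n K K A A'" and U: "agree d n K S U U'" and X: "agree d n K K X X'"
    and Z: "agree d n S S Z Z'" and V: "agree d n S K V V'"
    and "1 \<le> i" "b \<in> idx (sizes n i d)" "\<alpha> < K (i - 1)"
  shows "tangent K S A U X Z V b i \<alpha> = tangent K S A' U' X' Z' V' b i \<alpha>"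
  using assms(6-)
proof (induction b arbitrary: i \<alpha>)
  case Nil
  show ?case by simp
next
  case (Cons x b)
  then have *: "i \<le> d" "x < n i" "b \<in> idx (sizes n (Suc i) d)" by (simp_all add: right_index_Cons)
  have "(\<Sum>\<beta><K i. X i \<alpha> x \<beta> * train K A b (Suc i) \<beta>) = (\<Sum>\<beta><K i. X' i \<alpha> x \<beta> * train K A' b (Suc i) \<beta>)"
    by (rule sum.cong) (use Cons.prems * agreeD[OF X] train_cong[OF A, of "Suc i"] in auto)
  moreover have "(\<Sum>\<tau><S i. U i \<alpha> x \<tau> * excursion K S A Z V b (Suc i) \<tau>) = (\<Sum>\<tau><S i. U' i \<alpha> x \<tau> * excursion K S A' Z' V' b (Suc i) \<tau>)"
    by (rule sum.cong) (use Cons.prems * agreeD[OF U] excursion_cong[OF A Z V, of "Suc i"] in auto)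
  moreover have "(\<Sum>\<beta><K i. A i \<alpha> x \<beta> * tangent K S A U X Z V b (Suc i) \<beta>) = (\<Sum>\<beta><K i. A' i \<alpha> x \<beta> * tangent K S A' U' X' Z' V' b (Suc i) \<beta>)"
    by (rule sum.cong) (use Cons.prems * agreeD[OF A] Cons.IH[of "Suc i"] in auto)
  ultimately show ?case by simp
qed

lemma tt_param_cong:
  assumes A: "agree d n K K A A'" and U: "agree d n K S U U'" and X: "agree d n K K X X'"
    and V: "agree d n S K V V'" and P: "tt_param d n K S A U X V"
  shows "tt_param d n K S A' U' X' V'"
proof -
  interpret P: tt_param d n K S A U X Z V for Z by (rule P)
  show ?thesis
  proof
    fix i e e' assume i: "i \<in> {1..<d}" "e < K i" "e' < K i"
    have "(\<Sum>\<alpha><K (i - 1). \<Sum>x<n i. A' i \<alpha> x e * A' i \<alpha> x e') = (\<Sum>\<alpha><K (i - 1). \<Sum>x<n i. A i \<alpha> x e * A i \<alpha> x e')"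
      by (intro sum.cong refl) (use i agreeD[OF A, of i] in auto)
    then show "(\<Sum>\<alpha><K (i - 1). \<Sum>x<n i. A' i \<alpha> x e * A' i \<alpha> x e') = (if e = e' then 1 else 0)"
      using P.orthA[OF i] by simp
    have "(\<Sum>\<alpha><K (i - 1). \<Sum>x<n i. A' i \<alpha> x e * X' i \<alpha> x e') = (\<Sum>\<alpha><K (i - 1). \<Sum>x<n i. A i \<alpha> x e * X i \<alpha> x e')"
      by (intro sum.cong refl) (use i agreeD[OF A, of i] agreeD[OF X, of i] in auto)
    then show "(\<Sum>\<alpha><K (i - 1). \<Sum>x<n i. A' i \<alpha> x e * X' i \<alpha> x e') = 0"
      using P.orthX[OF i] by simp
  next
    fix i e \<tau> assume i: "i \<in> {1..<d}" "e < K i" "\<tau> < S i"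
    have "(\<Sum>\<alpha><K (i - 1). \<Sum>x<n i. A' i \<alpha> x e * U' i \<alpha> x \<tau>) = (\<Sum>\<alpha><K (i - 1). \<Sum>x<n i. A i \<alpha> x e * U i \<alpha> x \<tau>)"
      by (intro sum.cong refl) (use i agreeD[OF A, of i] agreeD[OF U, of i] in auto)
    then show "(\<Sum>\<alpha><K (i - 1). \<Sum>x<n i. A' i \<alpha> x e * U' i \<alpha> x \<tau>) = 0"
      using P.orthU[OF i] by simp
  next
    fix i \<sigma> e assume i: "i \<in> {2..d}" "\<sigma> < S (i - 1)" "e < K (i - 1)"
    have "(\<Sum>x<n i. \<Sum>b\<in>idx (sizes n (Suc i) d). (\<Sum>\<beta><K i. V' i \<sigma> x \<beta> * train K A' b (Suc i) \<beta>) * train K A' (x # b) i e)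
        = (\<Sum>x<n i. \<Sum>b\<in>idx (sizes n (Suc i) d). (\<Sum>\<beta><K i. V i \<sigma> x \<beta> * train K A b (Suc i) \<beta>) * train K A (x # b) i e)"
    proof (intro sum.cong refl arg_cong2[where f = "(*)"])
      fix x b \<beta> assume "x \<in> {..<n i}" "b \<in> idx (sizes n (Suc i) d)" "\<beta> \<in> {..<K i}"
      then show "V' i \<sigma> x \<beta> = V i \<sigma> x \<beta>" "train K A' b (Suc i) \<beta> = train K A b (Suc i) \<beta>"
        using i agreeD[OF V, of i \<sigma> x \<beta>] train_cong[OF A, of "Suc i" b \<beta>] by auto
    next
      fix x b assume "x \<in> {..<n i}" "b \<in> idx (sizes n (Suc i) d)"
      then show "train K A' (x # b) i e = train K A (x # b) i e"
        using i train_cong[OF A, of i "x # b" e] by (simp add: right_index_Cons)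
    qed
    then show "(\<Sum>x<n i. \<Sum>b\<in>idx (sizes n (Suc i) d). (\<Sum>\<beta><K i. V' i \<sigma> x \<beta> * train K A' b (Suc i) \<beta>) * train K A' (x # b) i e) = 0"
      using P.orthV[OF i] by simp
  qed (rule P.d2 P.K0 P.Kd P.Sd)+
qed

section \<open>Matrix conditions on cores in terms of entries\<close>

lemma sum_front:
  assumes "i \<in> {1..<d}"
  shows "(\<Sum>p\<in>idx (front n k i). f p) = (\<Sum>\<alpha><bonds 1 d k (i - 1). \<Sum>x<n i. f ((if i = 1 then [] else [\<alpha>]) @ [x]))"
  using assms by (cases "i = 1") (auto simp: front_def sum_idx_Cons)

lemma gram_core_iff:
  assumes "i \<in> {1..<d}"
  shows "transpose_mat (matricize (front n k i) [a] (C i)) * matricize (front n k i) [b] (Y i) = mat a b f \<longleftrightarrow>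
    (\<forall>e<a. \<forall>e'<b. (\<Sum>\<alpha><bonds 1 d k (i - 1). \<Sum>x<n i. core d C i \<alpha> x e * core d Y i \<alpha> x e') = f (e, e'))"
  unfolding matricize_gram_right sum_front[OF assms] using assms by (simp add: core_def)

lemma gram_excursion_iff:
  assumes "2 \<le> d" "i \<in> {2..d}"
  shows "matricize [a] (sizes n i d) (tt_prods d k (C(i := V i)) i)
      * transpose_mat (matricize [c] (sizes n i d) (tt_prods d k C i)) = 0\<^sub>m a c \<longleftrightarrow>
    (\<forall>\<sigma><a. \<forall>e<c. (\<Sum>x<n i. \<Sum>b\<in>idx (sizes n (Suc i) d).
      (\<Sum>\<beta><bonds 1 d k i. core d V i \<sigma> x \<beta> * train (bonds 1 d k) (core d C) b (Suc i) \<beta>)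
        * train (bonds 1 d k) (core d C) (x # b) i e) = 0)"
proof -
  have i: "1 \<le> i" "i \<le> d" "i \<noteq> 1" using assms by auto
  have tC: "tt_prods d k C' i (c # q) = train (bonds 1 d k) (core d C') q i c" if "q \<in> idx (sizes n i d)" for C' c q
    using tt_prods_train[OF i(1,2), of q k C' c] i length_idx[OF that] by simp
  have tV: "train (bonds 1 d k) (core d (C(i := V i))) (x # b) i \<sigma>
      = (\<Sum>\<beta><bonds 1 d k i. core d V i \<sigma> x \<beta> * train (bonds 1 d k) (core d C) b (Suc i) \<beta>)"
    if "b \<in> idx (sizes n (Suc i) d)" for x b \<sigma>
  proof -
    have "train (bonds 1 d k) (core d (C(i := V i))) b (Suc i) \<beta> = train (bonds 1 d k) (core d C) b (Suc i) \<beta>" for \<beta>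
      by (rule train_cong_above[OF _ order_refl that]) (simp add: core_def)
    then show ?thesis by (simp add: core_def)
  qed
  have "(\<Sum>q\<in>idx (sizes n i d). tt_prods d k (C(i := V i)) i (\<sigma> # q) * tt_prods d k C i (e # q))
     = (\<Sum>x<n i. \<Sum>b\<in>idx (sizes n (Suc i) d).
      (\<Sum>\<beta><bonds 1 d k i. core d V i \<sigma> x \<beta> * train (bonds 1 d k) (core d C) b (Suc i) \<beta>)
        * train (bonds 1 d k) (core d C) (x # b) i e)" for \<sigma> e
  proof -
    have "(\<Sum>q\<in>idx (sizes n i d). tt_prods d k (C(i := V i)) i (\<sigma> # q) * tt_prods d k C i (e # q))
       = (\<Sum>q\<in>idx (sizes n i d). train (bonds 1 d k) (core d (C(i := V i))) q i \<sigma> * train (bonds 1 d k) (core d C) q i e)"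
      by (simp add: tC del: train.simps)
    then show ?thesis unfolding sum_right_Cons[OF i(2)]
      by (simp only:) (intro sum.cong refl arg_cong2[where f = "(*)"] tV)
  qed
  then show ?thesis unfolding zero_mat_def matricize_gram_left by simp
qed

text \<open>Collects the size conditions of a parametrization, so that all other conditions can be
  stated on entries.\<close>

definition param_tensors where
  "param_tensors d n k s C U X Z V \<longleftrightarrow>
     (\<forall>i\<in>{1..d-1}. C i \<in> tensors (front n k i @ [k i])) \<and> C d \<in> tensors [k (d - 1), n d] \<and>
     (\<forall>i\<in>{1..d-1}. U i \<in> tensors (front n k i @ [s i])) \<and>
     (\<forall>i\<in>{1..d-1}. X i \<in> tensors (front n k i @ [k i])) \<and> X d \<in> tensors [k (d-1), n d] \<and>
     (\<forall>i\<in>{2..d-1}. Z i \<in> tensors [s (i-1), n i, s i]) \<and>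
     (\<forall>i\<in>{2..d-1}. V i \<in> tensors [s (i-1), n i, k i]) \<and> V d \<in> tensors [s (d-1), n d]"

lemma param_tensors_first:
  assumes "2 \<le> d" "param_tensors d n k s C U X Z V"
  shows "C 1 \<in> tensors ([n 1] @ [k 1])" "U 1 \<in> tensors ([n 1] @ [s 1])" "X 1 \<in> tensors ([n 1] @ [k 1])"
proof -
  have j: "1 \<in> {1..d-1}" and f: "front n k 1 = [n 1]" using assms(1) by (auto simp: front_def)
  show "C 1 \<in> tensors ([n 1] @ [k 1])" "U 1 \<in> tensors ([n 1] @ [s 1])" "X 1 \<in> tensors ([n 1] @ [k 1])"
    using assms(2)[unfolded param_tensors_def] j unfolding f[symmetric] by blast+
qed

lemma param_tensors_inner:
  assumes "2 \<le> j" "j < d" "param_tensors d n k s C U X Z V"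
  shows "C j \<in> tensors ([k (j - 1), n j] @ [k j])" "U j \<in> tensors ([k (j - 1), n j] @ [s j])"
    "X j \<in> tensors ([k (j - 1), n j] @ [k j])"
    "Z j \<in> tensors ([s (j - 1), n j] @ [s j])" "V j \<in> tensors ([s (j - 1), n j] @ [k j])"
proof -
  have j: "j \<in> {1..d-1}" "j \<in> {2..d-1}" and f: "front n k j = [k (j - 1), n j]"
    using assms(1,2) by (auto simp: front_def)
  show "C j \<in> tensors ([k (j - 1), n j] @ [k j])" "U j \<in> tensors ([k (j - 1), n j] @ [s j])"
    "X j \<in> tensors ([k (j - 1), n j] @ [k j])"
    using assms(3)[unfolded param_tensors_def] j unfolding f[symmetric] by blast+
  show "Z j \<in> tensors ([s (j - 1), n j] @ [s j])" "V j \<in> tensors ([s (j - 1), n j] @ [k j])"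
    using assms(3)[unfolded param_tensors_def] j by simp_all
qed

lemma tangent_core_tensors:
  assumes "2 \<le> d" "param_tensors d n k s C U X Z V"
  shows "tt_prods d (\<lambda>i. k i + s i + k i) (tangent_core d k s C U X Z V) 1 \<in> tensors (sizes n 1 d)"
proof -
  have "tangent_core d k s C U X Z V j \<in> tensors (front n (\<lambda>i. k i + s i + k i) j @ [k j + s j + k j])" if "j \<in> {1..d - 1}" for j
  proof -
    have h: "hcat (k j) P (hcat (s j) P' P'') \<in> tensors (ps @ [k j + s j + k j])"
      if "P \<in> tensors (ps @ [k j])" "P' \<in> tensors (ps @ [s j])" "P'' \<in> tensors (ps @ [k j])" for P P' P'' ps
      using hcat_tensors[OF that(1) hcat_tensors[OF that(2,3)]] by (simp add: add.assoc)
    have v: "vcat (k (j - 1)) P (vcat (s (j - 1)) P' P'') \<in> tensors ((k (j - 1) + s (j - 1) + k (j - 1)) # qs)"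
      if "P \<in> tensors (k (j - 1) # qs)" "P' \<in> tensors (s (j - 1) # qs)" "P'' \<in> tensors (k (j - 1) # qs)" for P P' P'' qs
      using vcat_tensors[OF that(1) vcat_tensors[OF that(2,3)]] by (simp add: add.assoc)
    show ?thesis
    proof (cases "j = 1")
      case True
      then show ?thesis using h[OF param_tensors_first[OF assms, folded True]]
        by (simp add: tangent_core_def front_def)
    next
      case False
      then have j: "2 \<le> j" "j < d" using that by auto
      note P = param_tensors_inner[OF j assms(2)]
      have "vcat (k (j - 1)) (hcat (k j) (C j) (hcat (s j) (U j) (X j)))
         (vcat (s (j - 1)) (hcat (k j) (\<lambda>_. 0) (hcat (s j) (Z j) (V j)))
                         (hcat (k j) (\<lambda>_. 0) (hcat (s j) (\<lambda>_. 0) (C j)))) \<in> tensors ((k (j - 1) + s (j - 1) + k (j - 1)) # [n j, k j + s j + k j])"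
        by (rule v) (use h[OF P(1-3)] h[OF tensors_zero P(4,5)] h[OF tensors_zero tensors_zero P(1)] in simp_all)
      then show ?thesis using j False by (simp add: tangent_core_def front_def)
    qed
  qed
  moreover have "tangent_core d k s C U X Z V d \<in> tensors [k (d - 1) + s (d - 1) + k (d - 1), n d]"
    using vcat_tensors[of "X d" "k (d - 1)" "[n d]" _ "s (d - 1) + k (d - 1)", OF _ vcat_tensors[of "V d" "s (d - 1)" "[n d]" "C d" "k (d - 1)"]] assms
    by (simp add: tangent_core_def param_tensors_def add.assoc)
  ultimately show ?thesis
    using tt_prods_tensors[of d "tangent_core d k s C U X Z V" n "\<lambda>i. k i + s i + k i" 1] assms(1) by simp
qed

lemma retr_core_tensors:
  assumes "2 \<le> d" "param_tensors d n k s C U X Z V"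
  shows "tt_prods d (\<lambda>i. k i + s i) (retr_core d k s C U X Z V) 1 \<in> tensors (sizes n 1 d)"
proof -
  have CX: "(\<lambda>l. C j l + X j l) \<in> tensors (front n k j @ [k j])" if "j \<in> {1..d - 1}" for j
    using assms(2) that by (intro tensors_add) (auto simp: param_tensors_def)
  have "retr_core d k s C U X Z V j \<in> tensors (front n (\<lambda>i. k i + s i) j @ [k j + s j])" if j: "j \<in> {1..d - 1}" for j
  proof (cases "j = 1")
    case True
    then show ?thesis using hcat_tensors[OF CX[OF j], of "U j" "s j"] param_tensors_first(2)[OF assms, folded True]
      by (simp add: retr_core_def front_def)
  next
    case False
    then have j2: "2 \<le> j" "j < d" using j by auto
    note P = param_tensors_inner[OF j2 assms(2)]
    have "vcat (k (j - 1)) (hcat (k j) (\<lambda>l. C j l + X j l) (U j)) (hcat (k j) (V j) (Z j))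
        \<in> tensors ((k (j - 1) + s (j - 1)) # [n j, k j + s j])"
      by (rule vcat_tensors) (use hcat_tensors[OF tensors_add[OF P(1,3)] P(2)] hcat_tensors[OF P(5,4)] in simp_all)
    then show ?thesis using j2 False by (simp add: retr_core_def front_def)
  qed
  moreover have "retr_core d k s C U X Z V d \<in> tensors [k (d - 1) + s (d - 1), n d]"
    using vcat_tensors[of "\<lambda>l. C d l + X d l" "k (d - 1)" "[n d]" "V d" "s (d - 1)"] tensors_add[of "C d" _ "X d"] assms
    by (simp add: retr_core_def param_tensors_def)
  ultimately show ?thesis
    using tt_prods_tensors[of d "retr_core d k s C U X Z V" n "\<lambda>i. k i + s i" 1] assms(1) by simp
qed

lemma tensors_eqI:
  "A \<in> tensors ms \<Longrightarrow> B \<in> tensors ms \<Longrightarrow> (\<And>j. j \<in> idx ms \<Longrightarrow> A j = B j) \<Longrightarrow> A = B"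
  unfolding tensors_iff by (rule ext) metis

text \<open>The dictionary between tensors and trains. Both directions are used: uniqueness and the
  expansion along a ray take given tensors apart, existence and scaling assemble them. Membership in
  \<open>tensors\<close> stands beside the entrywise equations because these say nothing outside the
  size.\<close>

lemma left_admissible_iff:
  assumes d: "2 \<le> d"
  defines "K k \<equiv> bonds 1 d k" and "S s \<equiv> bonds 0 d s"
  shows "left_orthogonal_tt d n k A C \<and> admissible d n k s C \<X> U X Z V \<longleftrightarrow>
    param_tensors d n k s C U X Z V \<and> A \<in> tensors (sizes n 1 d) \<and> \<X> \<in> tensors (sizes n 1 d) \<and>
    (\<forall>j\<in>idx (sizes n 1 d). A j = train (K k) (core d C) j 1 0) \<and>
    (\<forall>j\<in>idx (sizes n 1 d). \<X> j = tangent (K k) (S s) (core d C) (core d U) (core d X) (core d Z) (core d V) j 1 0) \<and>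
    tt_param d n (K k) (S s) (core d C) (core d U) (core d X) (core d V)"
proof -
  have C_tensors: "tt_prods d k C 1 \<in> tensors (sizes n 1 d)" if "param_tensors d n k s C U X Z V"
    using tt_prods_tensors[of d C n k 1] d that by (simp add: param_tensors_def)
  have A_iff: "A = tt_prods d k C 1 \<longleftrightarrow> A \<in> tensors (sizes n 1 d) \<and> (\<forall>j\<in>idx (sizes n 1 d). A j = train (K k) (core d C) j 1 0)"
    if "param_tensors d n k s C U X Z V"
  proof -
    have "tt_prods d k C 1 j = train (K k) (core d C) j 1 0" if "j \<in> idx (sizes n 1 d)" for j
      using tt_prods_train[of 1 d j k C 0] d length_idx[OF that] by (simp add: K_def)
    then show ?thesis using C_tensors[OF that] tensors_eqI[OF _ C_tensors[OF that], of A] by auto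
  qed
  have X_iff: "\<X> = tt_prods d (\<lambda>i. k i + s i + k i) (tangent_core d k s C U X Z V) 1 \<longleftrightarrow> \<X> \<in> tensors (sizes n 1 d) \<and>
      (\<forall>j\<in>idx (sizes n 1 d). \<X> j = tangent (K k) (S s) (core d C) (core d U) (core d X) (core d Z) (core d V) j 1 0)"
    if "param_tensors d n k s C U X Z V"
  proof -
    have "tt_prods d (\<lambda>i. k i + s i + k i) (tangent_core d k s C U X Z V) 1 j
        = tangent (K k) (S s) (core d C) (core d U) (core d X) (core d Z) (core d V) j 1 0" if "j \<in> idx (sizes n 1 d)" for j
      unfolding K_def S_def by (rule tangent_train[OF d]) (use length_idx[OF that] in simp)
    then show ?thesis using tangent_core_tensors[OF d that] tensors_eqI[OF _ tangent_core_tensors[OF d that], of \<X>] by auto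
  qed
  have param_iff: "tt_param d n (K k) (S s) (core d C) (core d U) (core d X) (core d V) \<longleftrightarrow>
    (\<forall>i\<in>{1..d-1}. transpose_mat (matricize (front n k i) [k i] (C i)) * matricize (front n k i) [k i] (C i) = 1\<^sub>m (k i)) \<and>
    (\<forall>i\<in>{1..d-1}. transpose_mat (matricize (front n k i) [k i] (C i)) * matricize (front n k i) [s i] (U i) = 0\<^sub>m (k i) (s i)) \<and>
    (\<forall>i\<in>{1..d-1}. transpose_mat (matricize (front n k i) [k i] (C i)) * matricize (front n k i) [k i] (X i) = 0\<^sub>m (k i) (k i)) \<and>
    (\<forall>i\<in>{2..d}. matricize [s (i-1)] (sizes n i d) (tt_prods d k (C(i := V i)) i)
      * transpose_mat (matricize [k (i-1)] (sizes n i d) (tt_prods d k C i)) = 0\<^sub>m (s (i-1)) (k (i-1)))"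
  proof -
    have dd: "{1..d-1} = {1..<d}" using d by auto
    have KS: "i \<in> {1..<d} \<Longrightarrow> K k i = k i \<and> S s i = s i" "i \<in> {2..d} \<Longrightarrow> K k (i - 1) = k (i - 1) \<and> S s (i - 1) = s (i - 1)" for i
      using d by (auto simp: K_def S_def)
    have K0: "K k 0 = 1" "K k d = 1" "S s d = 0" by (simp_all add: K_def S_def)
    have g1: "transpose_mat (matricize (front n k i) [k i] (C i)) * matricize (front n k i) [k i] (C i) = 1\<^sub>m (k i) \<longleftrightarrow>
        (\<forall>e e'. e < K k i \<longrightarrow> e' < K k i \<longrightarrow> (\<Sum>\<alpha><K k (i - 1). \<Sum>x<n i. core d C i \<alpha> x e * core d C i \<alpha> x e') = (if e = e' then 1 else 0))"
      if "i \<in> {1..<d}" for i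
      unfolding one_mat_def gram_core_iff[OF that] using KS(1)[OF that] by (auto simp: K_def)
    have g2: "transpose_mat (matricize (front n k i) [k i] (C i)) * matricize (front n k i) [l] (Y i) = 0\<^sub>m (k i) l \<longleftrightarrow>
        (\<forall>e e'. e < K k i \<longrightarrow> e' < l \<longrightarrow> (\<Sum>\<alpha><K k (i - 1). \<Sum>x<n i. core d C i \<alpha> x e * core d Y i \<alpha> x e') = 0)"
      if "i \<in> {1..<d}" for i l Y
      unfolding zero_mat_def gram_core_iff[OF that] using KS(1)[OF that] by (auto simp: K_def)
    have g3: "matricize [s (i-1)] (sizes n i d) (tt_prods d k (C(i := V i)) i)
        * transpose_mat (matricize [k (i-1)] (sizes n i d) (tt_prods d k C i)) = 0\<^sub>m (s (i-1)) (k (i-1)) \<longleftrightarrow>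
        (\<forall>\<sigma> e. \<sigma> < S s (i - 1) \<longrightarrow> e < K k (i - 1) \<longrightarrow> (\<Sum>x<n i. \<Sum>b\<in>idx (sizes n (Suc i) d).
          (\<Sum>\<beta><K k i. core d V i \<sigma> x \<beta> * train (K k) (core d C) b (Suc i) \<beta>) * train (K k) (core d C) (x # b) i e) = 0)"
      if "i \<in> {2..d}" for i
      unfolding gram_excursion_iff[OF d that] using KS(2)[OF that] by (auto simp: K_def)
    show ?thesis unfolding tt_param_def dd
      using d K0 g1 g2[where Y = U] g2[where Y = X] g3 KS(1) by (simp add: Ball_def cong: conj_cong imp_cong)
  qed
  show ?thesis
    unfolding left_orthogonal_tt_def admissible_def param_iff
    using A_iff X_iff unfolding param_tensors_def by blast
qed

text \<open>Inverse to \<open>core\<close> on the relevant ranges: a function of states and index is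
  truncated to a tensor, with missing outer bonds read as state zero.\<close>

definition tensor_core where
  "tensor_core d n l r G i j =
    (if j \<in> idx ((if i = 1 then [] else [l (i - 1)]) @ n i # (if i = d then [] else [r i]))
     then G i (if i = 1 then 0 else hd j) (if i = 1 then hd j else hd (tl j)) (if i = d then 0 else last j) else 0)"

lemma tensor_core_tensors:
  "tensor_core d n l r G i \<in> tensors ((if i = 1 then [] else [l (i - 1)]) @ n i # (if i = d then [] else [r i]))"
  unfolding tensors_iff tensor_core_def by simp

lemma core_tensor_core:
  assumes "2 \<le> d" "if i = 1 then \<alpha> = 0 else \<alpha> < l (i - 1)" "x < n i" "if i = d then \<beta> = 0 else \<beta> < r i"
  shows "core d (tensor_core d n l r G) i \<alpha> x \<beta> = G i \<alpha> x \<beta>"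
  using assms by (auto simp: core_def tensor_core_def split: if_splits)

lemma param_tensors_tensor_core:
  assumes "2 \<le> d"
  shows "param_tensors d n k s (tensor_core d n k k C) (tensor_core d n k s U) (tensor_core d n k k X)
    (tensor_core d n s s Z) (tensor_core d n s k V)"
proof -
  have t: "tensor_core d n l r G i \<in> tensors (front n l i @ [r i])" if "i \<in> {1..d - 1}" for l r G i
    using tensor_core_tensors[of d n l r G i] that by (auto simp: front_def split: if_splits)
  have t2: "tensor_core d n l r G i \<in> tensors [l (i - 1), n i, r i]" if "i \<in> {2..d - 1}" for l r G i
    using tensor_core_tensors[of d n l r G i] that by (auto split: if_splits)
  have td: "tensor_core d n l r G d \<in> tensors [l (d - 1), n d]" for l r G
    using tensor_core_tensors[of d n l r G d] assms by (simp split: if_splits)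
  show ?thesis unfolding param_tensors_def using t t2 td by blast
qed

lemma exists_parametrization:
  fixes d :: nat and n r :: "nat \<Rightarrow> nat"
  assumes d: "2 \<le> d" and A: "A \<in> tt_variety d n r"
    and \<X>: "\<X> \<in> tangent_cone (sizes n 1 d) (tt_variety d n r) A"
  defines "k \<equiv> tt_rank d n A" and "s \<equiv> \<lambda>i. r i - tt_rank d n A i"
  obtains C U X Z V where "left_orthogonal_tt d n k A C" "admissible d n k s C \<X> U X Z V"
proof -
  let ?LI = "\<lambda>m. idx (sizes n 1 m)" and ?RI = "\<lambda>m. idx (sizes n (Suc m) d)"
  define K where "K = bonds 1 d k"
  define S where "S = bonds 0 d s"
  have KS: "K 0 = 1" "K d = 1" "S d = 0" "S 0 = 0" by (simp_all add: K_def S_def)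
  have KSm: "K m = k m" "S m = s m" if "m \<in> {1..<d}" for m using that by (simp_all add: K_def S_def)
  have A_tensor: "A \<in> tensors (sizes n 1 d)" and kr: "\<And>m. m \<in> {1..<d} \<Longrightarrow> k m \<le> r m"
    using A d by (auto simp: tt_variety_def k_def)
  have in_full: "a @ b \<in> idx (sizes n 1 d)" if "a \<in> ?LI m" "b \<in> ?RI m" "m \<in> {1..<d}" for a b m
    using that length_idx[OF that(1)] sizes_append[of m d n] by simp
  have fact: "factors (?LI m) (?RI m) (K m) (\<lambda>a b. A (a @ b))"
    if "m \<in> {1..<d}" for m
    using tt_rank_le_iff[of d n A m "k m"] KSm[OF that] by (simp add: k_def)
  have minimal: "K m \<le> q" if "m \<in> {1..<d}"
    "factors (?LI m) (?RI m) q (\<lambda>a b. A (a @ b))" for m q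
    using tt_rank_le_iff[of d n A m q] KSm[OF that(1)] that(2) by (simp add: k_def)
  obtain G where G: "tt_param d n K S G (\<lambda>_ _ _ _. 0) (\<lambda>_ _ _ _. 0) (\<lambda>_ _ _ _. 0)"
    and trainG: "\<And>j. j \<in> idx (sizes n 1 d) \<Longrightarrow> train K G j 1 0 = A j"
    by (rule left_orthogonal_cores[where d = d and n = n and K = K and S = S and t = A, OF d KS(1-3) fact minimal])
      (assumption+, rule that)
  \<comment> \<open>With the remaining cores zero, the facts on heads and tails of \<open>A\<close>
    are available before any core of \<open>\<X>\<close> exists.\<close>
  interpret P: tt_param d n K S G "\<lambda>_ _ _ _. 0" "\<lambda>_ _ _ _. 0" "\<lambda>_ _ _ _. 0" "\<lambda>_ _ _ _. 0"
    by (rule G)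
  define good where "good m D \<longleftrightarrow> (\<forall>c e. c < K m \<longrightarrow> e < K m \<longrightarrow> (\<Sum>b\<in>?RI m. P.tn b (Suc m) c * D b e) = (if c = e then 1 else 0)) \<and>
      (\<forall>b b'. b \<in> ?RI m \<longrightarrow> b' \<in> ?RI m \<longrightarrow>
        (\<Sum>c<K m. D b c * P.tn b' (Suc m) c) = (\<Sum>c<K m. D b' c * P.tn b (Suc m) c))" for m D
  have "\<exists>D. good m D" if m: "m \<in> {1..<d}" for m
  proof (rule right_pseudoinverse[of "?RI m" "K m" "\<lambda>c b. P.tn b (Suc m) c"], goal_cases)
    case 1
    show ?case by simp
  next
    case (2 q)
    have "factors (?LI m) (?RI m) q (\<lambda>a b. P.tn (a @ b) 1 0)"
      by (rule factors_mult_left[OF 2 P.train_split])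
    then show ?case using minimal[OF m] trainG in_full[OF _ _ m]
      factors_cong[of "?LI m" "?RI m" "\<lambda>a b. P.tn (a @ b) 1 0" "\<lambda>a b. A (a @ b)" q] by simp
  next
    case (3 D)
    show ?case unfolding good_def by (rule exI[of _ D]) (intro conjI allI impI 3)
  qed
  then have "\<forall>m. \<exists>D. m \<in> {1..<d} \<longrightarrow> good m D" by blast
  then obtain D where D: "\<forall>m. m \<in> {1..<d} \<longrightarrow> good m (D m)"
    by (rule choice[THEN exE])
  interpret T: tangent_data d n K S G \<X> D
  proof
    show "(\<Sum>b\<in>?RI m. P.tn b (Suc m) c * D m b e) = (if c = e then 1 else 0)"
      if "m \<in> {1..<d}" "c < K m" "e < K m" for m c e
      using D[THEN spec, THEN mp, OF that(1), unfolded good_def, THEN conjunct1] that by blast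
    show "(\<Sum>c<K m. D m b c * P.tn b' (Suc m) c) = (\<Sum>c<K m. D m b' c * P.tn b (Suc m) c)"
      if "m \<in> {1..<d}" "b \<in> ?RI m" "b' \<in> ?RI m" for m b b'
      using D[THEN spec, THEN mp, OF that(1), unfolded good_def, THEN conjunct2] that by blast
  qed
  from \<X> obtain x :: "nat \<Rightarrow> tensor" and c :: "nat \<Rightarrow> real" where \<X>_tensor: "\<X> \<in> tensors (sizes n 1 d)"
    and x: "\<And>l. x l \<in> tt_variety d n r" "x \<longlonglongrightarrow> A" "(\<lambda>l j. c l * (x l j - A j)) \<longlonglongrightarrow> \<X>"
    unfolding tangent_cone_def by blast
  define splits where "splits m L \<longleftrightarrow> (\<forall>a b. a \<in> ?LI m \<longrightarrow> b \<in> ?RI m \<longrightarrow>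
        T.G m a b = (\<Sum>\<tau><S m. L a \<tau> * (\<Sum>a'\<in>?LI m. L a' \<tau> * T.G m a' b))) \<and>
      (\<forall>e \<tau>. e < K m \<longrightarrow> \<tau> < S m \<longrightarrow> (\<Sum>a\<in>?LI m. P.hh a e * L a \<tau>) = 0)" for m L
  have "\<exists>L. splits m L" if m: "m \<in> {1..<d}" for m
  proof (rule T.normal_factorization[where m = m and x = x and c = c and r = "r m" and s = "S m"], goal_cases)
    case 1
    show ?case by (rule m)
  next
    case (2 l)
    have "m \<in> {1..d - 1}" using m by auto
    then have "tt_rank d n (x l) m \<le> r m" using x(1)[of l] unfolding tt_variety_def by blast
    then show ?case unfolding tt_rank_le_iff .
  next
    case (3 a b)
    then show ?case using x(2) trainG[OF in_full[OF 3 m]] by (simp add: tendsto_fun_iff)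
  next
    case (4 a b)
    then show ?case using x(3) trainG[OF in_full[OF 4 m]] by (simp add: tendsto_fun_iff)
  next
    \<comment> \<open>The truncated subtraction in \<open>s\<close> is exact, since \<open>A\<close>
      lies in the variety.\<close>
    case 5
    show ?case using KSm[OF m] kr[OF m] by (simp add: s_def k_def)
  next
    case (6 L)
    show ?case unfolding splits_def by (rule exI[of _ L]) (intro conjI allI impI 6)
  qed
  then have "\<forall>m. \<exists>L. m \<in> {1..<d} \<longrightarrow> splits m L" by blast
  then obtain L where L: "\<forall>m. m \<in> {1..<d} \<longrightarrow> splits m (L m)"
    by (rule choice[THEN exE])
  interpret N: tangent_normal_data d n K S G \<X> D L
  proof
    show "T.G m a b = (\<Sum>\<tau><S m. L m a \<tau> * (\<Sum>a'\<in>?LI m. L m a' \<tau> * T.G m a' b))"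
      if "m \<in> {1..<d}" "a \<in> ?LI m" "b \<in> ?RI m" for m a b
      by (rule L[THEN spec, THEN mp, OF that(1), unfolded splits_def, THEN conjunct1, THEN spec, THEN spec, THEN mp, THEN mp, OF that(2,3)])
    show "(\<Sum>a\<in>?LI m. P.hh a e * L m a \<tau>) = 0" if "m \<in> {1..<d}" "e < K m" "\<tau> < S m" for m e \<tau>
      by (rule L[THEN spec, THEN mp, OF that(1), unfolded splits_def, THEN conjunct2, THEN spec, THEN spec, THEN mp, THEN mp, OF that(2,3)])
  qed
  \<comment> \<open>Truncation to tensors; by \<open>ag\<close> below it changes no value that
    enters the trains.\<close>
  let ?C = "tensor_core d n k k G" and ?U = "tensor_core d n k s N.nU" and ?X = "tensor_core d n k k N.nX"
    and ?Z = "tensor_core d n s s N.nZ" and ?V = "tensor_core d n s k N.nV"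
  have agree: "agree d n (bonds a d l) (bonds e d q) G' (core d (tensor_core d n l q G'))"
    if "a \<le> 1" "e \<le> 1" for a e l q G'
    unfolding agree_def using that d
    by (intro ballI allI impI core_tensor_core[symmetric]) (auto simp: bonds_def split: if_splits)
  have ag: "agree d n K K G (core d ?C)" "agree d n K S N.nU (core d ?U)" "agree d n K K N.nX (core d ?X)"
    "agree d n S S N.nZ (core d ?Z)" "agree d n S K N.nV (core d ?V)"
    unfolding K_def S_def by (rule agree; simp)+
  have "left_orthogonal_tt d n k A ?C \<and> admissible d n k s ?C \<X> ?U ?X ?Z ?V"
    unfolding left_admissible_iff[OF d] K_def[symmetric] S_def[symmetric]
  proof (intro conjI ballI)
    show "param_tensors d n k s ?C ?U ?X ?Z ?V" by (rule param_tensors_tensor_core[OF d])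
    show "A \<in> tensors (sizes n 1 d)" "\<X> \<in> tensors (sizes n 1 d)" by fact+
    show "A j = train K (core d ?C) j 1 0" if "j \<in> idx (sizes n 1 d)" for j
      using trainG[OF that] train_cong[OF ag(1) order_refl that, of 0] KS by simp
    show "\<X> j = tangent K S (core d ?C) (core d ?U) (core d ?X) (core d ?Z) (core d ?V) j 1 0" if "j \<in> idx (sizes n 1 d)" for j
      using N.tangent_eq[OF that] tangent_cong[OF ag order_refl that, of 0] KS by simp
    show "tt_param d n K S (core d ?C) (core d ?U) (core d ?X) (core d ?V)"
      by (rule tt_param_cong[OF ag(1,2,3,5) N.normal_tt_param])
  qed
  then show ?thesis using that by blast
qed

lemma retr_value_unique:
  assumes d: "2 \<le> d" and Y: "retr_value d n r A \<X> Y" and Y': "retr_value d n r A \<X> Y'"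
  shows "Y = Y'"
proof -
  define k where "k = tt_rank d n A"
  define s where "s = (\<lambda>i. r i - k i)"
  let ?K = "bonds 1 d k" and ?S = "bonds 0 d s"
  obtain C U X Z V where P: "left_orthogonal_tt d n k A C \<and> admissible d n k s C \<X> U X Z V"
    and Yeq: "Y = tt_prods d (\<lambda>i. k i + s i) (retr_core d k s C U X Z V) 1"
    using Y unfolding retr_value_def Let_def k_def s_def by blast
  obtain C' U' X' Z' V' where P': "left_orthogonal_tt d n k A C' \<and> admissible d n k s C' \<X> U' X' Z' V'"
    and Yeq': "Y' = tt_prods d (\<lambda>i. k i + s i) (retr_core d k s C' U' X' Z' V') 1"
    using Y' unfolding retr_value_def Let_def k_def s_def by blast
  note p = P[unfolded left_admissible_iff[OF d]] and p' = P'[unfolded left_admissible_iff[OF d]]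
  interpret B: tt_param d n ?K ?S "core d C" "core d U" "core d X" "core d Z" "core d V" using p by blast
  interpret B': tt_param d n ?K ?S "core d C'" "core d U'" "core d X'" "core d Z'" "core d V'" using p' by blast
  interpret tt_param_pair d n ?K ?S "core d C" "core d U" "core d X" "core d Z" "core d V"
    "core d C'" "core d U'" "core d X'" "core d Z'" "core d V'"
  proof
    show "B.tn j 1 0 = B'.tn j 1 0" if "j \<in> idx (sizes n 1 d)" for j
    proof -
      have "A j = B.tn j 1 0" "A j = B'.tn j 1 0" using p p' that by blast+
      then show ?thesis by simp
    qed
    show "B.tg j 1 0 = B'.tg j 1 0" if "j \<in> idx (sizes n 1 d)" for j
    proof -
      have "\<X> j = B.tg j 1 0" "\<X> j = B'.tg j 1 0" using p p' that by blast+
      then show ?thesis by simp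
    qed
    \<comment> \<open>The bonds of both parametrizations are the ranks of the unfoldings of
      \<open>A\<close>; this supplies the minimality behind the comparison of heads.\<close>
    show "?K m \<le> q" if m: "m \<in> {1..<d}"
      and f: "factors (idx (sizes n 1 m)) (idx (sizes n (Suc m) d)) q (\<lambda>a b. B.tn (a @ b) 1 0)" for m q
    proof -
      have "B.tn (a @ b) 1 0 = A (a @ b)" if "a \<in> idx (sizes n 1 m)" "b \<in> idx (sizes n (Suc m) d)" for a b
      proof -
        have "a @ b \<in> idx (sizes n 1 d)"
          using that length_idx[OF that(1)] sizes_append[of m d n] m by simp
        then have "A (a @ b) = B.tn (a @ b) 1 0" using p by blast
        then show ?thesis by simp
      qed
      then have "factors (idx (sizes n 1 m)) (idx (sizes n (Suc m) d)) q (\<lambda>a b. A (a @ b))"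
        using f factors_cong[of "idx (sizes n 1 m)" "idx (sizes n (Suc m) d)" "\<lambda>a b. B.tn (a @ b) 1 0" "\<lambda>a b. A (a @ b)" q] by simp
      then show ?thesis using tt_rank_le_iff[of d n A m q] m by (simp add: k_def)
    qed
  qed
  show ?thesis
  proof (rule tensors_eqI)
    show "Y \<in> tensors (sizes n 1 d)" unfolding Yeq by (rule retr_core_tensors[OF d p[THEN conjunct1]])
    show "Y' \<in> tensors (sizes n 1 d)" unfolding Yeq' by (rule retr_core_tensors[OF d p'[THEN conjunct1]])
    show "Y j = Y' j" if j: "j \<in> idx (sizes n 1 d)" for j
      unfolding Yeq Yeq' using retract_eq[OF j] length_idx[OF j] by (simp only: retr_train[OF d] length_sizes)
  qed
qed

text \<open>At bond \<open>m\<close> the train of the retraction has \<open>k m + s m = r m\<close>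
  states, and cutting it there into head and tail factors the unfolding.\<close>

lemma retr_value_in_variety:
  assumes d: "2 \<le> d" and A: "A \<in> tt_variety d n r" and Y: "retr_value d n r A \<X> Y"
  shows "Y \<in> tt_variety d n r"
proof -
  define k where "k = tt_rank d n A"
  define s where "s = (\<lambda>i. r i - k i)"
  obtain C U X Z V where P: "left_orthogonal_tt d n k A C \<and> admissible d n k s C \<X> U X Z V"
    and Yeq: "Y = tt_prods d (\<lambda>i. k i + s i) (retr_core d k s C U X Z V) 1"
    using Y unfolding retr_value_def Let_def k_def s_def by blast
  let ?K = "bonds 1 d (\<lambda>i. k i + s i)" and ?B = "core d (retr_core d k s C U X Z V)"
  have "tt_rank d n Y m \<le> r m" if m: "m \<in> {1..d-1}" for m
  proof -
    have r: "k m + s m = r m" using A m by (auto simp: tt_variety_def k_def s_def)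
    have Km: "?K m = r m" using m r d by (auto simp: bonds_def)
    have "factors (idx (sizes n 1 m)) (idx (sizes n (Suc m) d)) (r m) (\<lambda>a b. Y (a @ b))"
      unfolding factors_def
    proof (intro exI ballI)
      fix a b assume ab: "a \<in> idx (sizes n 1 m)" "b \<in> idx (sizes n (Suc m) d)"
      have l: "length a = m" "length (a @ b) = d" using length_idx[OF ab(1)] length_idx[OF ab(2)] m by auto
      have "Y (a @ b) = train ?K ?B (a @ b) 1 0"
        using tt_prods_train[of 1 d "a @ b" "\<lambda>i. k i + s i" "retr_core d k s C U X Z V" 0] d l by (simp add: Yeq)
      also have "\<dots> = (\<Sum>c<?K m. head ?K ?B a c * train ?K ?B b (Suc m) c)"
        using train_append[of ?K ?B a b] l by simp
      finally show "Y (a @ b) = (\<Sum>c<r m. head ?K ?B a c * (\<lambda>c b. train ?K ?B b (Suc m) c) c b)"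
        using Km by simp
    qed
    then show ?thesis by (simp add: tt_rank_le_iff)
  qed
  moreover have "Y \<in> tensors (sizes n 1 d)"
    unfolding Yeq using retr_core_tensors[OF d] P[unfolded left_admissible_iff[OF d]] by blast
  ultimately show ?thesis by (simp add: tt_variety_def)
qed

section \<open>Scaling a tangent vector together with its parametrization\<close>

lemma excursion_scale:
  "excursion K S A Z (\<lambda>i \<alpha> x \<beta>. t * V i \<alpha> x \<beta>) b i \<sigma> = t * excursion K S A Z V b i \<sigma>"
  by (induction b arbitrary: i \<sigma>) (simp_all add: distrib_left sum_distrib_left mult_ac)

lemma tangent_scale:
  "tangent K S A U (\<lambda>i \<alpha> x \<beta>. t * X i \<alpha> x \<beta>) Z (\<lambda>i \<alpha> x \<beta>. t * V i \<alpha> x \<beta>) b i \<alpha> = t * tangent K S A U X Z V b i \<alpha>"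
  by (induction b arbitrary: i \<alpha>) (simp_all add: excursion_scale distrib_left sum_distrib_left mult_ac)

lemma tt_param_scale:
  assumes "tt_param d n K S A U X V"
  shows "tt_param d n K S A U (\<lambda>i \<alpha> x \<beta>. t * X i \<alpha> x \<beta>) (\<lambda>i \<alpha> x \<beta>. t * V i \<alpha> x \<beta>)"
proof -
  interpret P: tt_param d n K S A U X Z V for Z by (rule assms)
  show ?thesis
  proof
    show "(\<Sum>\<alpha><K (i - 1). \<Sum>x<n i. A i \<alpha> x e * A i \<alpha> x e') = (if e = e' then 1 else 0)"
      if "i \<in> {1..<d}" "e < K i" "e' < K i" for i e e' by (rule P.orthA[OF that])
    show "(\<Sum>\<alpha><K (i - 1). \<Sum>x<n i. A i \<alpha> x e * U i \<alpha> x \<tau>) = 0"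
      if "i \<in> {1..<d}" "e < K i" "\<tau> < S i" for i e \<tau> by (rule P.orthU[OF that])
    show "(\<Sum>\<alpha><K (i - 1). \<Sum>x<n i. A i \<alpha> x e * (t * X i \<alpha> x e')) = 0"
      if "i \<in> {1..<d}" "e < K i" "e' < K i" for i e e'
      using P.orthX[OF that] by (simp add: mult.left_commute[of _ t] sum_distrib_left[symmetric])
    show "(\<Sum>x<n i. \<Sum>b\<in>idx (sizes n (Suc i) d).
        (\<Sum>\<beta><K i. t * V i \<sigma> x \<beta> * train K A b (Suc i) \<beta>) * train K A (x # b) i e) = 0"
      if "i \<in> {2..d}" "\<sigma> < S (i - 1)" "e < K (i - 1)" for i \<sigma> e
      using P.orthV[OF that] by (simp add: mult.assoc sum_distrib_left[symmetric])
  qed (rule P.d2 P.K0 P.Kd P.Sd)+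
qed

lemma param_tensors_scale:
  "param_tensors d n k s C U X Z V \<Longrightarrow> param_tensors d n k s C U (\<lambda>i j. t * X i j) Z (\<lambda>i j. t * V i j)"
  unfolding param_tensors_def by (simp add: tensors_scale)

text \<open>A path through the tangent cores from the first to the last block row uses exactly one
  block among the \<open>X\<close> and \<open>V\<close>, so scaling these scales the product, while
  \<open>U\<close> and \<open>Z\<close> stay.\<close>

lemma admissible_scale:
  assumes "2 \<le> d" "left_orthogonal_tt d n k A C \<and> admissible d n k s C \<X> U X Z V"
  shows "left_orthogonal_tt d n k A C \<and> admissible d n k s C (\<lambda>j. t * \<X> j) U (\<lambda>i j. t * X i j) Z (\<lambda>i j. t * V i j)"
proof -
  have core: "core d (\<lambda>i j. t * Y i j) = (\<lambda>i \<alpha> x \<beta>. t * core d Y i \<alpha> x \<beta>)" for Y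
    by (simp add: core_def fun_eq_iff)
  note p = assms(2)[unfolded left_admissible_iff[OF assms(1)]]
  show ?thesis
    unfolding left_admissible_iff[OF assms(1)] core tangent_scale
    using p param_tensors_scale[of d n k s C U X Z V t] tt_param_scale[of d n "bonds 1 d k" "bonds 0 d s" "core d C" "core d U" "core d X" "core d V" t]
    by (auto simp: tensors_scale)
qed

theorem lemma21:
  fixes d :: nat and n r :: "nat \<Rightarrow> nat"
  assumes "d \<ge> 2"
    and "\<forall>i\<in>{1..d}. n i > 0"
  shows "(\<forall>A\<in>tt_variety d n r. \<forall>\<X>\<in>tangent_cone (sizes n 1 d) (tt_variety d n r) A.
            \<exists>!Y. retr_value d n r A \<X> Y) \<and>
         is_retraction (sizes n 1 d) (tt_variety d n r)
           (\<lambda>(A, \<X>). THE Y. retr_value d n r A \<X> Y)"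
proof -
  note d = \<open>d \<ge> 2\<close>
  let ?M = "tt_variety d n r" and ?T = "tangent_cone (sizes n 1 d) (tt_variety d n r)"
  have the: "(THE Y. retr_value d n r A \<X> Y) = Y" if "retr_value d n r A \<X> Y" for A \<X> Y
    using that retr_value_unique[OF d] by blast
  have ex: "\<exists>Y. retr_value d n r A \<X> Y" if A: "A \<in> ?M" and \<X>: "\<X> \<in> ?T A" for A \<X>
  proof -
    obtain C U X Z V where "left_orthogonal_tt d n (tt_rank d n A) A C"
      "admissible d n (tt_rank d n A) (\<lambda>i. r i - tt_rank d n A i) C \<X> U X Z V"
      by (rule exists_parametrization[OF d A \<X>])
    then show ?thesis unfolding retr_value_def Let_def by blast
  qed
  have curve: "continuous_on {0..} (\<lambda>t::real. THE Y. retr_value d n r A (\<lambda>j. t * v j) Y) \<and>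
      ((\<lambda>t::real. \<lambda>j. ((THE Y. retr_value d n r A (\<lambda>j. t * v j) Y) j - A j - t * v j) / t) \<longlongrightarrow> (\<lambda>_. 0)) (at_right 0)"
    if A: "A \<in> ?M" and v: "v \<in> ?T A" for A v
  proof -
    define k where "k = tt_rank d n A"
    define s where "s = (\<lambda>i. r i - k i)"
    obtain C U X Z V where P: "left_orthogonal_tt d n k A C \<and> admissible d n k s C v U X Z V"
      unfolding k_def s_def by (rule exists_parametrization[OF d A v]) blast
    note p = P[unfolded left_admissible_iff[OF d]]
    \<comment> \<open>One parametrization of \<open>v\<close> serves the whole ray; by uniqueness
      the value does not depend on this choice.\<close>
    define Y where "Y t = tt_prods d (\<lambda>i. k i + s i) (retr_core d k s C U (\<lambda>i j. t * X i j) Z (\<lambda>i j. t * V i j)) 1" for t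
    have val: "retr_value d n r A (\<lambda>j. t * v j) (Y t)" for t
      using admissible_scale[OF d P, of t]
      unfolding retr_value_def Let_def k_def[symmetric] Y_def s_def by blast
    have core: "core d (\<lambda>i j. t * Y i j) = (\<lambda>i \<alpha> x \<beta>. t * core d Y i \<alpha> x \<beta>)" for Y and t :: real
      by (simp add: core_def fun_eq_iff)
    \<comment> \<open>Continuity and the limit are both checked entry by entry. Outside the size all
      three tensors vanish, so there the remainder is zero.\<close>
    have expansion: "\<exists>q. continuous_on UNIV q \<and> (\<forall>t. Y t j = A j + t * v j + t\<^sup>2 * q t)" for j
    proof (cases "j \<in> idx (sizes n 1 d)")
      case True
      obtain q where q: "\<forall>\<alpha>. continuous_on UNIV (q \<alpha>) \<and> (\<forall>t. retract (bonds 1 d k) (bonds 0 d s) (core d C) (core d U)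
          (\<lambda>i \<alpha> x \<beta>. t * core d X i \<alpha> x \<beta>) (core d Z) (\<lambda>i \<alpha> x \<beta>. t * core d V i \<alpha> x \<beta>) j 1 (Inl \<alpha>)
        = train (bonds 1 d k) (core d C) j 1 \<alpha> + t * tangent (bonds 1 d k) (bonds 0 d s) (core d C) (core d U) (core d X) (core d Z) (core d V) j 1 \<alpha>
          + t\<^sup>2 * q \<alpha> t)"
        by (rule exE[OF retract_expansion[THEN conjunct1]])
      have "A j = train (bonds 1 d k) (core d C) j 1 0"
        "v j = tangent (bonds 1 d k) (bonds 0 d s) (core d C) (core d U) (core d X) (core d Z) (core d V) j 1 0"
        using p True by blast+
      moreover have "Y t j = retract (bonds 1 d k) (bonds 0 d s) (core d C) (core d U)
          (\<lambda>i \<alpha> x \<beta>. t * core d X i \<alpha> x \<beta>) (core d Z) (\<lambda>i \<alpha> x \<beta>. t * core d V i \<alpha> x \<beta>) j 1 (Inl 0)" for t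
        unfolding Y_def core[symmetric] by (rule retr_train[OF d]) (use length_idx[OF True] in simp)
      ultimately show ?thesis using q[THEN spec, of 0] by (intro exI[of _ "q 0"]) simp
    next
      case False
      have "Y t \<in> tensors (sizes n 1 d)" for t
        using retr_value_in_variety[OF d A val] by (simp add: tt_variety_def)
      then show ?thesis using False p by (intro exI[of _ "\<lambda>_. 0"]) (simp add: tensors_iff)
    qed
    have "continuous_on {0..} Y"
    proof (rule continuous_on_coordinatewise_then_product)
      fix j
      obtain q where q: "continuous_on UNIV q" "\<And>t. Y t j = A j + t * v j + t\<^sup>2 * q t" using expansion by blast
      have "continuous_on {0..} q" using q(1) continuous_on_subset by blast
      then show "continuous_on {0..} (\<lambda>t. Y t j)" unfolding q(2) by (intro continuous_intros)
    qed
    moreover have "((\<lambda>t j. (Y t j - A j - t * v j) / t) \<longlongrightarrow> (\<lambda>_. 0)) (at_right 0)"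
      unfolding tendsto_fun_iff
    proof
      fix j
      obtain q where q: "continuous_on UNIV q" "\<And>t. Y t j = A j + t * v j + t\<^sup>2 * q t" using expansion by blast
      \<comment> \<open>For nonzero \<open>t\<close> the difference quotient is
        \<open>t * q t\<close>.\<close>
      have "continuous_on UNIV (\<lambda>t. t * q t)" by (intro continuous_intros q(1))
      then have "((\<lambda>t. t * q t) \<longlongrightarrow> 0 * q 0) (at 0)"
        using isContD[of 0 "\<lambda>t. t * q t"] by (simp add: continuous_on_eq_continuous_at)
      then have "((\<lambda>t. t * q t) \<longlongrightarrow> 0 * q 0) (at_right 0)"
        by (rule tendsto_mono[OF at_le[OF subset_UNIV]])
      then have "((\<lambda>t. t * q t) \<longlongrightarrow> 0) (at_right 0)" by simp
      then show "((\<lambda>t. (Y t j - A j - t * v j) / t) \<longlongrightarrow> 0) (at_right 0)"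
        by (rule Lim_transform_eventually) (auto simp: eventually_at_filter q(2) power2_eq_square)
    qed
    ultimately show ?thesis unfolding the[OF val] by blast
  qed
  have "\<exists>!Y. retr_value d n r A \<X> Y" if "A \<in> ?M" "\<X> \<in> ?T A" for A \<X>
    using ex[OF that] retr_value_unique[OF d] by blast
  moreover have "(THE Y. retr_value d n r A \<X> Y) \<in> ?M" if "A \<in> ?M" "\<X> \<in> ?T A" for A \<X>
    using ex[OF that] the retr_value_in_variety[OF d that(1)] by metis
  ultimately show ?thesis
    using curve unfolding is_retraction_def tangent_bundle_def by auto
qed

end
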